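(* Let $(w_n)_{n\ge0}$ be nonnegative reals with $W(z)=\sum_{n\ge0}w_nz^n$, and assume there are $\rho_w>0$ and a slowly varying $L_w$ with $w_n\sim L_w(n)n^{-1}\rho_w^{-n}$ and $W(\rho_w)\in(0,\infty)$. Let $X,X_1,X_2,\dots$ be i.i.d. with probability generating function $W(\rho_w z)/W(\rho_w)$, $S_k=X_1+\dots+X_k$, and suppose there is $\gamma\ge0$ with $\lim_{n\to\infty}\mathbb{P}(X>n^t)/\mathbb{P}(X>n)=t^{-\gamma}$ for all $0<t<1$. Let $\Lambda$ be the Borel measure on $(0,1]$ with $\Lambda([a,b])=a^{-\gamma}-b^{-\gamma}$ for $0<a<b\le1$. Let $k_n$ be positive integers with $k_n\mathbb{P}(X>n)\to x>0$, and let $$(\widehat X_1,\dots,\widehat X_{k_n-1})$$ have the law of $\tau(X_1,\dots,X_{k_n})$ conditionally on $S_{k_n}=n$. Then the point process $\sum_{i=1}^{k_n-1}\delta_{\log(\widehat X_i)/\log(n)}\mathbb{1}_{\widehat X_i>1}$ on $(0,1]$ converges in distribution (vague topology) to an inhomogeneous Poisson point process on $(0,1]$ with intensity measure $x\Lambda$.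
   Context: The "delete first maximum" operator $\tau$ maps $(x_1,\dots,x_k)$ to $(x_1,\dots,x_{J-1},x_{J+1},\dots,x_k)$ where $J=\min\{j:x_j=\max_i x_i\}$. $\delta_y$ is the Dirac measure at $y$. *)

theory Defs
  imports "HOL-Probability.Probability" "HOL-Library.Landau_Symbols"
begin

definition slowly_varying :: "(real \<Rightarrow> real) \<Rightarrow> bool" where
  "slowly_varying L \<longleftrightarrow> L \<in> borel_measurable borel \<and> (\<forall>\<^sub>F t in at_top. L t > 0) \<and>
     (\<forall>lam>0. ((\<lambda>t. L (lam * t) / L t) \<longlongrightarrow> 1) at_top)"

definition delete_first_max :: "nat list \<Rightarrow> nat list" where
  "delete_first_max xs = remove1 (Max (set xs)) xs"

text \<open>Point configurations (locally finite counting measures) on (0,1], represented by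
  their multiplicity function c: the measure is sum over y of c(y) times delta_y.\<close>
definition Conf :: "(real \<Rightarrow> nat) set" where
  "Conf = {c. (\<forall>y. 0 < c y \<longrightarrow> y \<in> {0<..1}) \<and> (\<forall>a>0. finite {y. a \<le> y \<and> 0 < c y})}"

definition cnt :: "(real \<Rightarrow> nat) \<Rightarrow> real set \<Rightarrow> enat" where
  "cnt c B = (if finite {y\<in>B. 0 < c y} then enat (\<Sum>y\<in>{y\<in>B. 0 < c y}. c y) else \<infinity>)"

definition lin :: "(real \<Rightarrow> real) \<Rightarrow> (real \<Rightarrow> nat) \<Rightarrow> real" where
  "lin f c = (\<Sum>y\<in>{y. 0 < c y \<and> f y \<noteq> 0}. real (c y) * f y)"

definition Cc :: "(real \<Rightarrow> real) set" where
  "Cc = {f. continuous_on {0<..1} f \<and> (\<exists>a>0. \<forall>y\<in>{0<..1}. y < a \<longrightarrow> f y = 0)}"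

definition vague_topology :: "(real \<Rightarrow> nat) topology" where
  "vague_topology = topology_generated_by
     {{c\<in>Conf. lin f c \<in> U} | f U. f \<in> Cc \<and> open U}"

definition conf_measure :: "(real \<Rightarrow> nat) measure" where
  "conf_measure = sigma Conf
     {{c\<in>Conf. cnt c B = k} | B k. B \<in> sets borel \<and> B \<subseteq> {0<..1}}"

definition conv_distr_vague :: "(nat \<Rightarrow> (real \<Rightarrow> nat) measure) \<Rightarrow> (real \<Rightarrow> nat) measure \<Rightarrow> bool" where
  "conv_distr_vague P Q \<longleftrightarrow>
     (\<forall>F. continuous_map vague_topology euclideanreal F \<and> (\<exists>B. \<forall>c\<in>Conf. \<bar>F c\<bar> \<le> B) \<longrightarrow>
        (\<lambda>n. \<integral>c. F c \<partial>(P n)) \<longlonglongrightarrow> (\<integral>c. F c \<partial>Q))"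

definition is_poisson_pp :: "'a measure \<Rightarrow> real measure \<Rightarrow> ('a \<Rightarrow> (real \<Rightarrow> nat)) \<Rightarrow> bool" where
  "is_poisson_pp M mu xi \<longleftrightarrow> prob_space M \<and> xi \<in> measurable M conf_measure \<and>
     (\<forall>B k. B \<in> sets borel \<and> B \<subseteq> {0<..1} \<and> emeasure mu B < \<infinity> \<longrightarrow>
        measure M {\<omega>\<in>space M. cnt (xi \<omega>) B = enat k} =
          exp (- enn2real (emeasure mu B)) * enn2real (emeasure mu B) ^ k / fact k) \<and>
     (\<forall>(m::nat) B. (\<forall>i<m. B i \<in> sets borel \<and> B i \<subseteq> {0<..1} \<and> emeasure mu (B i) < \<infinity>)
        \<and> disjoint_family_on B {..<m} \<longrightarrow>
        prob_space.indep_vars M (\<lambda>_. count_space UNIV) (\<lambda>i \<omega>. cnt (xi \<omega>) (B i)) {..<m})"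

definition log_pp :: "nat \<Rightarrow> nat list \<Rightarrow> (real \<Rightarrow> nat)" where
  "log_pp n xs = (\<lambda>y. length (filter (\<lambda>m. 1 < m \<and> ln (real m) / ln (real n) = y) xs))"

end

theory Submission
  imports Defs "HOL-Combinatorics.Multiset_Permutations"
begin

text \<open>Since \<open>P(X = n)\<close> is regularly varying with index \<open>-1\<close> and \<open>k\<^sub>n P(X > n)\<close> stays bounded, the event
  \<open>S = n\<close> is realised by a single summand of size \<open>n - o(n)\<close>, the others being at most \<open>n\<close> and of total
  size \<open>o(n)\<close>. Deleting the maximum thus leaves, asymptotically, independent copies of \<open>X\<close> conditioned
  on \<open>X \<le> n\<close>, for which the numbers of points in disjoint intervals of the logarithmic scale are
  multinomial with a Poisson limit.

  The error terms are controlled by truncated exponential moments: the tail hypothesis yields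
  \<open>k\<^sub>n E[X; X \<le> n] = o(n)\<close>, and the size of the largest summand is split into dyadic blocks.
  Passing from counts to vague convergence uses no compactness: only lower bounds for the
  probabilities of count vectors are required, because Fatou's lemma can be applied to a functional
  and to its negative.\<close>

text \<open>The tail hypothesis also counts values above \<open>n\<close>, so the expected number of
  summands above \<open>n^t\<close> tends to \<open>x t^(-\<gamma>)\<close>. The intensity
  \<open>x (t^(-\<gamma>) - 1)\<close> of \<open>(t, 1]\<close> appears because the other summands
  cannot exceed \<open>n\<close> when the sum is \<open>n\<close>: \<open>P(S = n)\<close> behaves
  like \<open>k P(X = n) e^(-x)\<close>, where \<open>e^(-x)\<close> is the limit of
  \<open>P(X <= n)^(k-1)\<close>, and dividing by it supplies a factor \<open>e^x\<close>. Each half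
  of this quotient is estimated in one direction only: \<open>P(S = n)\<close> from above, its
  intersection with a count event from below. That is enough because the limiting probabilities of
  count vectors sum to 1, so no mass can hide elsewhere. All estimates concern functions of the
  multiset of remaining summands. An exchange formula marks one summand and integrates it out, so
  ties and the position of the maximum never have to be tracked. Two further obstacles are
  measure-theoretic: vaguely continuous functionals are not given as measurable for the
  sigma-algebra of counts, and the limiting process has to be constructed.\<close>

section \<open>Slowly varying functions\<close>

text \<open>Steinhaus-type argument: if the increments failed to vanish uniformly along
  \<open>u n\<close>, \<open>v n\<close>, then the sets of \<open>y\<close> with small increments at \<open>u n\<close>, and those with small increments
  at \<open>u n + v n\<close> shifted by \<open>v n\<close>, would eventually both fill more than half of an interval of
  length 3, hence meet.\<close>

lemma uniform_increment_limit:
  fixes h :: "real \<Rightarrow> real"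
  assumes h[measurable]: "h \<in> borel_measurable borel"
    and lim: "\<And>v. ((\<lambda>u. h (u + v) - h u) \<longlongrightarrow> 0) at_top"
    and e: "e > 0"
  shows "\<exists>U. \<forall>u\<ge>U. \<forall>v\<in>{0..1}. \<bar>h (u + v) - h u\<bar> < e"
proof (rule ccontr)
  assume "\<not> ?thesis"
  then have "\<exists>u v. u \<ge> real n \<and> v \<in> {0..1} \<and> \<bar>h (u + v) - h u\<bar> \<ge> e" for n
    by (meson not_le)
  then obtain u v where uv: "\<And>n. u n \<ge> real n" "\<And>n. v n \<in> {0..1}"
    and big: "\<And>n. \<bar>h (u n + v n) - h (u n)\<bar> \<ge> e"
    by metis
  define S where "S c N = {y\<in>{0..2}. \<forall>n\<ge>N. \<bar>h (c n + y) - h (c n)\<bar> < e / 2}" for c :: "nat \<Rightarrow> real" and N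
  have S_sets: "S c N \<in> sets borel" for c N
    unfolding S_def by measurable
  have S_large: "\<forall>\<^sub>F N in sequentially. measure lborel (S c N) > 3/2" if c: "\<And>n. c n \<ge> real n" for c
  proof -
    have ctop: "filterlim c at_top sequentially"
      using c by (intro filterlim_at_top_mono[OF filterlim_real_sequentially]) auto
    have inc: "incseq (S c)"
      unfolding S_def incseq_def by force
    have Un: "(\<Union>N. S c N) = {0..2}"
    proof (intro antisym subsetI)
      fix y :: real assume y: "y \<in> {0..2}"
      have "(\<lambda>n. h (c n + y) - h (c n)) \<longlonglongrightarrow> 0"
        using filterlim_compose[OF lim[of y] ctop] .
      then have "\<forall>\<^sub>F n in sequentially. \<bar>h (c n + y) - h (c n)\<bar> < e / 2"
        using e by (auto dest!: tendstoD[where e = "e/2"])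
      then show "y \<in> (\<Union>N. S c N)"
        using y by (auto simp: S_def eventually_sequentially)
    qed (auto simp: S_def)
    have "(\<lambda>N. measure lborel (S c N)) \<longlonglongrightarrow> measure lborel (\<Union>N. S c N)"
    proof (rule Lim_measure_incseq)
      show "range (S c) \<subseteq> sets lborel" using S_sets by auto
      show "emeasure lborel (\<Union> (range (S c))) \<noteq> \<infinity>" by (simp add: Un)
    qed (fact inc)
    then show ?thesis
      unfolding Un by (intro order_tendstoD) auto
  qed
  have "\<forall>\<^sub>F N in sequentially. measure lborel (S u N) > 3/2"
    using uv by (intro S_large) auto
  moreover have "\<forall>\<^sub>F N in sequentially. measure lborel (S (\<lambda>n. u n + v n) N) > 3/2"
    using uv by (intro S_large) (auto intro: add_increasing2)
  ultimately have "\<forall>\<^sub>F N in sequentially. measure lborel (S u N) > 3/2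
      \<and> measure lborel (S (\<lambda>n. u n + v n) N) > 3/2"
    by eventually_elim auto
  then obtain N where N: "measure lborel (S u N) > 3/2" "measure lborel (S (\<lambda>n. u n + v n) N) > 3/2"
    by (auto simp: eventually_sequentially)
  define A B where "A = S u N" and "B = (+) (v N) ` S (\<lambda>n. u n + v n) N"
  have B_eq: "B = (\<lambda>y. y - v N) -` S (\<lambda>n. u n + v n) N"
    by (force simp: B_def image_iff algebra_simps)
  have AB_sets: "A \<in> sets borel" "B \<in> sets borel"
    using S_sets[of u N] measurable_sets_borel[OF _ S_sets[of "\<lambda>n. u n + v n" N], of "\<lambda>y. y - v N"]
    by (auto simp: A_def B_eq)
  have sub: "A \<subseteq> {0..3}" "B \<subseteq> {0..3}"
    using uv(2)[of N] by (auto simp: A_def B_def S_def)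
  have mB: "measure lborel B = measure lborel (S (\<lambda>n. u n + v n) N)"
    unfolding B_def using measure_translation[of "v N" "S (\<lambda>n. u n + v n) N"] S_sets
    by (metis AB_sets(2) B_def measure_completion sets_lborel)
  have "A \<inter> B \<noteq> {}"
  proof
    assume disj: "A \<inter> B = {}"
    have i03: "{0..3::real} \<in> fmeasurable lborel" by (simp add: fmeasurable_def)
    have fin: "A \<in> fmeasurable lborel" "B \<in> fmeasurable lborel"
      using fmeasurableI2[OF i03 sub(1)] fmeasurableI2[OF i03 sub(2)] AB_sets by simp_all
    have "measure lborel A + measure lborel B = measure lborel (A \<union> B)"
      using disj fin by (intro measure_Union[symmetric]) (auto simp: fmeasurable_def)
    also have "\<dots> \<le> measure lborel {0..3::real}"
      using sub AB_sets by (intro measure_mono_fmeasurable) (auto simp: fmeasurable_def)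
    finally show False
      using N by (simp add: A_def mB)
  qed
  then obtain y where "y \<in> S u N" "y - v N \<in> S (\<lambda>n. u n + v n) N"
    unfolding A_def B_eq by auto
  then have "\<bar>h (u N + y) - h (u N)\<bar> < e/2" "\<bar>h (u N + y) - h (u N + v N)\<bar> < e/2"
    unfolding S_def by (auto dest!: spec[of _ N])
  with big[of N] show False by linarith
qed

text \<open>On the logarithmic scale \<open>h u = ln (L (exp u))\<close> slow variation says that
  increments of \<open>h\<close> vanish pointwise, and \<open>uniform_increment_limit\<close> makes
  this uniform. A window of one factor 2 fits because \<open>ln 2 <= 1\<close>; larger ratios are
  reached later by iterated halving.\<close>

lemma slowly_varying_uniform:
  assumes L: "slowly_varying L" and e: "e > 0"
  shows "\<exists>T. \<forall>t\<ge>T. \<forall>s\<in>{t/2..t}. L s > 0 \<and> \<bar>L s / L t - 1\<bar> < e"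
proof -
  have [measurable]: "L \<in> borel_measurable borel"
    using L by (simp add: slowly_varying_def)
  obtain T0 where T0: "\<And>t. t \<ge> T0 \<Longrightarrow> L t > 0"
    using L by (auto simp: slowly_varying_def eventually_at_top_linorder)
  define h where "h u = ln (L (exp u))" for u
  have [measurable]: "h \<in> borel_measurable borel"
    unfolding h_def by measurable
  have lim: "((\<lambda>u. h (u + v) - h u) \<longlongrightarrow> 0) at_top" for v
  proof -
    have "((\<lambda>t. L (exp v * t) / L t) \<longlongrightarrow> 1) at_top"
      using L by (simp add: slowly_varying_def)
    then have "((\<lambda>t. ln (L (exp v * t) / L t)) \<longlongrightarrow> ln 1) at_top"
      by (rule tendsto_ln) auto
    then have lim0: "((\<lambda>u. ln (L (exp v * exp u) / L (exp u))) \<longlongrightarrow> 0) at_top"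
      using filterlim_compose[OF _ exp_at_top] by fastforce
    have "\<forall>\<^sub>F u in at_top. exp u \<ge> T0 \<and> exp (u + v) \<ge> T0"
    proof (intro eventually_conj)
      show "\<forall>\<^sub>F u in at_top. exp u \<ge> T0"
        using exp_at_top by (auto simp: filterlim_at_top)
      have "filterlim (\<lambda>u::real. exp (u + v)) at_top at_top"
        by (rule filterlim_compose[OF exp_at_top])
           (use filterlim_tendsto_add_at_top[OF tendsto_const[of v] filterlim_ident] in \<open>simp add: add.commute\<close>)
      then show "\<forall>\<^sub>F u in at_top. exp (u + v) \<ge> T0"
        by (auto simp: filterlim_at_top)
    qed
    then have "\<forall>\<^sub>F u in at_top. ln (L (exp v * exp u) / L (exp u)) = h (u + v) - h u"
    proof eventually_elim
      case (elim u)
      then have "L (exp (u + v)) > 0" "L (exp u) > 0" using T0 by auto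
      then show ?case
        by (simp add: h_def ln_div exp_add[symmetric] add.commute)
    qed
    from Lim_transform_eventually[OF lim0 this] show ?thesis .
  qed
  \<comment> \<open>With this \<open>d\<close>, a ratio whose logarithm is below \<open>d\<close> in
    absolute value differs from 1 by less than \<open>e\<close>; the cap 1/2 keeps the logarithm
    meaningful when \<open>e >= 1\<close>.\<close>
  define d where "d = min (ln (1 + e)) (- ln (1 - min e (1/2)))"
  have d: "d > 0" "exp d \<le> 1 + e" "exp (-d) \<ge> 1 - e"
  proof -
    show "d > 0" using e by (auto simp: d_def ln_less_zero)
    have "exp d \<le> exp (ln (1 + e))" unfolding d_def by simp
    then show "exp d \<le> 1 + e" using e by simp
    have "exp (-d) \<ge> exp (ln (1 - min e (1/2)))" unfolding d_def exp_le_cancel_iff by linarith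
    also have "exp (ln (1 - min e (1/2))) = 1 - min e (1/2)" by (subst exp_ln) auto
    finally show "exp (-d) \<ge> 1 - e" by linarith
  qed
  obtain U where U: "\<And>u v. u \<ge> U \<Longrightarrow> v \<in> {0..1} \<Longrightarrow> \<bar>h (u + v) - h u\<bar> < d"
    using uniform_increment_limit[of h d] lim d by (auto simp: Ball_def)
  show ?thesis
  proof (intro exI allI impI ballI)
    fix t s assume t: "t \<ge> max (2 * exp U) (max 1 (2 * T0))" and s: "s \<in> {t/2..t}"
    have pos: "t > 0" "s > 0" using t s by auto
    have Lp: "L t > 0" "L s > 0" using t s pos by (auto intro!: T0)
    have "ln 2 \<le> (1::real)" using ln_le_minus_one[of "2::real"] by simp
    moreover have "ln (t / s) \<le> ln 2" using s pos by (subst ln_le_cancel_iff) (auto simp: field_simps)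
    moreover have "ln (t / s) \<ge> 0" using s pos by (auto simp: field_simps)
    ultimately have r: "ln (t / s) \<in> {0..1}" by auto
    have "exp U \<le> s" using t s by auto
    then have "U \<le> ln s" using pos by (simp add: ln_ge_iff)
    from U[OF this r] have "\<bar>ln (L t) - ln (L s)\<bar> < d"
      using pos by (simp add: h_def ln_div)
    then have "- d < ln (L s / L t)" "ln (L s / L t) < d"
      using Lp by (auto simp: ln_div)
    then have "exp (-d) < L s / L t" "L s / L t < exp d"
      using Lp by (metis divide_pos_pos exp_less_cancel_iff exp_ln)+
    then show "L s > 0 \<and> \<bar>L s / L t - 1\<bar> < e" using d Lp by auto
  qed
qed

text \<open>The powers of \<open>\<rho>\<close> cancel, so \<open>m * pmf pX m\<close> equals
  \<open>L m / W\<close> up to a factor \<open>q m\<close> that tends to 1. Index -1 thus means that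
  \<open>m * pmf pX m\<close> varies slowly.\<close>

lemma regular_variation_pmf:
  fixes w :: "nat \<Rightarrow> real" and pX :: "nat pmf"
  assumes rho: "\<rho> > 0" and L: "slowly_varying L"
    and w: "w \<sim>[sequentially] (\<lambda>n. L (real n) * (real n) powr (-1) * \<rho> powr (- real n))"
    and W: "W > 0" and p: "\<And>m. pmf pX m = w m * \<rho> ^ m / W"
    and e: "e > 0"
  shows "\<exists>N>0. \<forall>n\<ge>N. \<forall>m. n \<le> 2 * m \<and> m \<le> n \<longrightarrow>
    pmf pX n > 0 \<and> \<bar>(real m * pmf pX m) / (real n * pmf pX n) - 1\<bar> < e"
proof -
  define q where "q m = real m * pmf pX m * W / L m" for m :: nat
  have L_pos: "\<forall>\<^sub>F n in sequentially. L (real n) > 0"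
    using L filterlim_real_sequentially by (auto simp: slowly_varying_def filterlim_iff)
  have "((\<lambda>n. w n / (L (real n) * (real n) powr (-1) * \<rho> powr (- real n))) \<longlongrightarrow> 1) sequentially"
  proof (rule asymp_equivD_strong[OF w])
    show "\<forall>\<^sub>F n in sequentially. w n \<noteq> 0 \<or> L (real n) * (real n) powr (-1) * \<rho> powr (- real n) \<noteq> 0"
      using L_pos eventually_gt_at_top[of 0] by eventually_elim (use rho in auto)
  qed
  moreover have "\<forall>\<^sub>F n in sequentially. w n / (L (real n) * (real n) powr (-1) * \<rho> powr (- real n)) = q n"
    using eventually_gt_at_top[of 0]
    by eventually_elim (use rho W in \<open>simp add: q_def p powr_minus powr_realpow field_simps\<close>)
  ultimately have q1: "q \<longlonglongrightarrow> 1"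
    by (rule Lim_transform_eventually)
  \<comment> \<open>Below, \<open>q m * a - q n\<close> is at most \<open>4 * d\<close> in absolute
    value, and division by \<open>q n >= 1/2\<close> doubles this; \<open>8 * d\<close> stays below
    \<open>e\<close>.\<close>
  define d where "d = min (1/2) (e / 10)"
  have d: "d > 0" "d \<le> 1/2" "10 * d \<le> e" using e by (auto simp: d_def)
  have "\<forall>\<^sub>F n in sequentially. \<bar>q n - 1\<bar> < d"
    using q1 d by (auto dest!: tendstoD[where e = d] simp: dist_real_def)
  then obtain N1 where N1: "\<And>n. n \<ge> N1 \<Longrightarrow> \<bar>q n - 1\<bar> < d"
    by (auto simp: eventually_sequentially)
  obtain T where T: "\<forall>t\<ge>T. \<forall>s\<in>{t/2..t}. L s > 0 \<and> \<bar>L s / L t - 1\<bar> < d"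
    using slowly_varying_uniform[OF L d(1)] by (elim exE)
  show ?thesis
  proof (intro exI conjI allI impI)
    fix n m :: nat
    assume n: "n \<ge> Suc (2 * N1 + nat \<lceil>T\<rceil>)" and m: "n \<le> 2 * m \<and> m \<le> n"
    have mn: "m > 0" "n > 0" "m \<ge> N1" "n \<ge> N1" "real n \<ge> T" using n m by linarith+
    have Ls: "L m > 0" "\<bar>L m / L n - 1\<bar> < d" "L n > 0"
      using T[rule_format, of "real n" "real m"] T[rule_format, of "real n" "real n"] mn m by auto
    have qs: "\<bar>q m - 1\<bar> < d" "\<bar>q n - 1\<bar> < d" using N1 mn by auto
    then have qp: "q n > 0" "q n \<ge> 1/2" using d by auto
    have eq: "real i * pmf pX i = q i * L i / W" if "L i > 0" for i :: nat
      using that W by (simp add: q_def)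
    show "pmf pX n > 0"
      using qp Ls W mn by (simp add: q_def zero_less_mult_iff zero_less_divide_iff)
    define a where "a = L m / L n"
    have "(real m * pmf pX m) / (real n * pmf pX n) = q m / q n * a"
      using Ls W by (simp add: eq a_def)
    moreover have "\<bar>q m / q n * a - 1\<bar> < e"
    proof -
      have "\<bar>q m / q n * a - 1\<bar> = \<bar>q m * a - q n\<bar> / q n"
        using qp by (simp add: field_simps)
      moreover have "\<bar>q m * a - q n\<bar> \<le> 4 * d"
      proof -
        have "q m * a - q n = (q m - 1) * a + (a - 1) + (1 - q n)" by algebra
        moreover have "\<bar>(q m - 1) * a\<bar> \<le> d * 2"
          unfolding abs_mult using qs Ls d by (intro mult_mono) (auto simp: a_def)
        ultimately show ?thesis using qs Ls(2) unfolding a_def by linarith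
      qed
      moreover have "\<bar>q m * a - q n\<bar> / q n \<le> (4 * d) / (1/2)"
        using qp calculation(2) by (intro frac_le) auto
      ultimately have "\<bar>q m / q n * a - 1\<bar> \<le> 8 * d" by simp
      then show ?thesis using d by linarith
    qed
    ultimately show "\<bar>(real m * pmf pX m) / (real n * pmf pX n) - 1\<bar> < e" by simp
  qed simp
qed

text \<open>A crude Potter bound, obtained by halving \<open>n\<close> down towards
  \<open>m\<close>: each halving costs a factor 5/4 in \<open>m * p m\<close>, while
  \<open>n / m\<close> drops by nearly 2. The exponent 2 is far from optimal, but it only has to
  lose against exponential bounds.\<close>

lemma potter_quadratic:
  fixes p :: "nat \<Rightarrow> real"
  assumes R: "\<And>n m. n \<ge> N \<Longrightarrow> n \<le> 2 * m \<Longrightarrow> m \<le> n \<Longrightarrow>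
      p n > 0 \<and> \<bar>(real m * p m) / (real n * p n) - 1\<bar> < 1/4"
    and N: "N > 1"
    and mn: "N \<le> m" "m \<le> n"
  shows "p m \<le> 2 * (real n / real m)\<^sup>2 * p n"
proof -
  have step: "real m * p m \<le> 5/4 * (real n * p n)" if "n \<ge> N" "n \<le> 2 * m" "m \<le> n" for n m
  proof -
    have "p n > 0" "(real m * p m) / (real n * p n) < 5/4" using R[OF that] unfolding abs_less_iff by auto
    moreover have "0 < real n * p n" using \<open>p n > 0\<close> that N by simp
    ultimately show ?thesis by (simp only: pos_divide_less_eq)
  qed
  have "real m * p m \<le> 2 * (real n / real m) * (real n * p n)"
    using mn
  proof (induction n rule: less_induct)
    case (less n)
    have pn: "p n > 0" using R[of n n] less.prems by auto
    show ?case
    proof (cases "n \<le> 2 * m")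
      case True
      have "real m * p m \<le> 5/4 * (real n * p n)" using step less.prems True by auto
      also have "\<dots> \<le> 2 * (real n / real m) * (real n * p n)"
        using less.prems N pn by (intro mult_right_mono) (auto simp: field_simps)
      finally show ?thesis .
    next
      case False
      \<comment> \<open>Rounding up preserves \<open>n <= 2 * n'\<close> and \<open>m <= n'\<close>;
        from \<open>2 * n' <= n + 1\<close> and \<open>n >= 2\<close> there still follows
        \<open>5 * n' <= 4 * n\<close>, which absorbs the factor 5/4.\<close>
      define n' where "n' = (n + 1) div 2"
      have n': "n' < n" "m \<le> n'" "n \<le> 2 * n'" "n' \<le> n" "N \<le> n'" "2 * n' \<le> n + 1"
        using False less.prems N by (auto simp: n'_def)
      have "real m * p m \<le> 2 * (real n' / real m) * (real n' * p n')"
        using less.IH[of n'] n' less.prems by auto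
      also have "\<dots> \<le> 2 * (real n' / real m) * (5/4 * (real n * p n))"
        using step[of n n'] n' less.prems by (intro mult_left_mono) auto
      also have "\<dots> = 2 * (5/4 * real n' / real m) * (real n * p n)"
        by simp
      also have "\<dots> \<le> 2 * (real n / real m) * (real n * p n)"
      proof -
        have "5 * real n' \<le> 4 * real n" using n' N less.prems by linarith
        then show ?thesis using pn N less.prems
          by (intro mult_right_mono mult_left_mono divide_right_mono) auto
      qed
      finally show ?thesis .
    qed
  qed
  then show ?thesis
    using mn N by (simp add: field_simps power2_eq_square)
qed

section \<open>Independent summands conditioned on their sum\<close>

abbreviation pr :: "'a pmf \<Rightarrow> 'a set \<Rightarrow> real" where
  "pr p \<equiv> measure_pmf.prob p"

abbreviation trunc_tail :: "real \<Rightarrow> nat \<Rightarrow> nat list set" where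
  "trunc_tail y m \<equiv> {xs. y \<le> real (sum_list xs) \<and> (\<forall>x\<in>set xs. x \<le> m)}"

lemma nn_integral_pmf_swap:
  "(\<integral>\<^sup>+x. \<integral>\<^sup>+y. f x y \<partial>measure_pmf q \<partial>measure_pmf p) = (\<integral>\<^sup>+y. \<integral>\<^sup>+x. f x y \<partial>measure_pmf p \<partial>measure_pmf q)"
proof -
  have "(\<integral>\<^sup>+x. \<integral>\<^sup>+y. f x y \<partial>measure_pmf q \<partial>measure_pmf p) = (\<integral>\<^sup>+z. f (fst z) (snd z) \<partial>pair_pmf p q)"
    by (simp add: nn_integral_pair_pmf')
  also have "\<dots> = (\<integral>\<^sup>+z. f (snd z) (fst z) \<partial>pair_pmf q p)"
    by (subst pair_commute_pmf) (simp add: case_prod_beta)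
  finally show ?thesis
    by (simp add: nn_integral_pair_pmf')
qed

lemma nn_integral_replicate_pmf_Suc:
  "(\<integral>\<^sup>+xs. f xs \<partial>replicate_pmf (Suc k) p) = (\<integral>\<^sup>+x. \<integral>\<^sup>+xs. f (x # xs) \<partial>replicate_pmf k p \<partial>p)"
  by simp

text \<open>A Palm-type formula: by exchangeability each of the \<open>k\<close> positions
  contributes equally, and since \<open>f\<close> sees the unmarked entries only as a multiset, the
  marked entry can be integrated out independently. The induction separates marking the head from
  marking inside the tail.\<close>

lemma nn_integral_replicate_exchange:
  fixes f :: "'a \<Rightarrow> 'a multiset \<Rightarrow> ennreal"
  shows "(\<integral>\<^sup>+xs. (\<Sum>a\<in>#mset xs. f a (mset xs - {#a#})) \<partial>replicate_pmf k p) =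
    of_nat k * (\<integral>\<^sup>+xs. \<integral>\<^sup>+a. f a (mset xs) \<partial>p \<partial>replicate_pmf (k - 1) p)"
proof (induction k arbitrary: f)
  case 0
  then show ?case by simp
next
  case (Suc k)
  have split: "(\<Sum>a\<in>#mset (x # xs). f a (mset (x # xs) - {#a#})) =
      f x (mset xs) + (\<Sum>a\<in>#mset xs. f a (add_mset x (mset xs - {#a#})))" for x xs
  proof -
    have "image_mset (\<lambda>a. f a (add_mset x (mset xs) - {#a#})) (mset xs) =
        image_mset (\<lambda>a. f a (add_mset x (mset xs - {#a#}))) (mset xs)"
      by (intro image_mset_cong) (auto simp: multiset_eq_iff)
    then show ?thesis by simp
  qed
  have "(\<integral>\<^sup>+xs. (\<Sum>a\<in>#mset xs. f a (mset xs - {#a#})) \<partial>replicate_pmf (Suc k) p) =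
     (\<integral>\<^sup>+x. \<integral>\<^sup>+xs. f x (mset xs) \<partial>replicate_pmf k p \<partial>p) +
     (\<integral>\<^sup>+x. \<integral>\<^sup>+xs. (\<Sum>a\<in>#mset xs. f a (add_mset x (mset xs - {#a#}))) \<partial>replicate_pmf k p \<partial>p)"
    unfolding nn_integral_replicate_pmf_Suc split by (simp add: nn_integral_add)
  also have "(\<integral>\<^sup>+x. \<integral>\<^sup>+xs. f x (mset xs) \<partial>replicate_pmf k p \<partial>p) =
      (\<integral>\<^sup>+xs. \<integral>\<^sup>+a. f a (mset xs) \<partial>p \<partial>replicate_pmf k p)"
    by (rule nn_integral_pmf_swap)
  also have "(\<integral>\<^sup>+x. \<integral>\<^sup>+xs. (\<Sum>a\<in>#mset xs. f a (add_mset x (mset xs - {#a#}))) \<partial>replicate_pmf k p \<partial>p) =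
      of_nat k * (\<integral>\<^sup>+x. \<integral>\<^sup>+xs. \<integral>\<^sup>+a. f a (add_mset x (mset xs)) \<partial>p \<partial>replicate_pmf (k - 1) p \<partial>p)"
    using Suc.IH[of "\<lambda>a M. f a (add_mset _ M)"] by (simp add: nn_integral_cmult)
  \<comment> \<open>For \<open>k = 0\<close> the prefactor vanishes; otherwise \<open>x\<close> and
    the \<open>k - 1\<close> further entries recombine into \<open>k\<close> entries.\<close>
  also have "\<dots> = of_nat k * (\<integral>\<^sup>+xs. \<integral>\<^sup>+a. f a (mset xs) \<partial>p \<partial>replicate_pmf k p)"
    by (cases k) simp_all
  finally show ?case
    by (simp add: distrib_right)
qed

lemma nn_integral_replicate_prod:
  fixes f :: "'a \<Rightarrow> ennreal"
  shows "(\<integral>\<^sup>+xs. (\<Prod>x\<leftarrow>xs. f x) \<partial>replicate_pmf k p) = (\<integral>\<^sup>+x. f x \<partial>p) ^ k"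
  by (induction k) (simp_all add: nn_integral_cmult nn_integral_multc)

lemma prob_replicate_all:
  "pr (replicate_pmf k p) {xs. \<forall>x\<in>set xs. x \<in> A} = pr p A ^ k"
proof -
  have *: "indicator {xs. \<forall>x\<in>set xs. x \<in> A} xs = (\<Prod>x\<leftarrow>xs. indicator A x :: ennreal)" for xs
    by (induction xs) (simp_all add: indicator_def of_bool_conj)
  have "emeasure (replicate_pmf k p) {xs. \<forall>x\<in>set xs. x \<in> A} =
      (\<integral>\<^sup>+xs. indicator {xs. \<forall>x\<in>set xs. x \<in> A} xs \<partial>replicate_pmf k p)" by simp
  also have "\<dots> = (\<integral>\<^sup>+xs. (\<Prod>x\<leftarrow>xs. indicator A x) \<partial>replicate_pmf k p)"
    by (simp only: *)
  also have "\<dots> = emeasure p A ^ k"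
    by (subst nn_integral_replicate_prod) simp
  finally have "emeasure (replicate_pmf k p) {xs. \<forall>x\<in>set xs. x \<in> A} = emeasure p A ^ k" .
  then show ?thesis
    by (simp add: measure_pmf.emeasure_eq_measure ennreal_power)
qed

text \<open>Markov's inequality for \<open>exp (s * S)\<close> restricted to entries at most
  \<open>m\<close>. Since \<open>1 - u <= exp (- u)\<close> gives
  \<open>exp u <= 1 + u * exp u\<close>, the truncated transform of one entry is at most 1 plus
  \<open>s * exp (s * m)\<close> times the truncated mean.\<close>

lemma chernoff_truncated:
  fixes s y :: real
  assumes s: "s \<ge> 0"
  shows "pr (replicate_pmf k p) (trunc_tail y m)
    \<le> exp (real k * (s * exp (s * m) * (\<Sum>i\<le>m. real i * pmf p i)) - s * y)"
proof -
  define f where "f x = (if x \<le> m then ennreal (exp (s * real x)) else 0)" for x :: nat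
  define K where "K = (\<Sum>i\<le>m. real i * pmf p i)"
  have prod: "(\<Prod>x\<leftarrow>xs. f x) = ennreal (exp (s * real (sum_list xs)))" if "\<forall>x\<in>set xs. x \<le> m" for xs
    using that by (induction xs) (auto simp: f_def ennreal_mult'[symmetric] exp_add[symmetric] distrib_left)
  have "emeasure (replicate_pmf k p) (trunc_tail y m) =
      (\<integral>\<^sup>+xs. indicator (trunc_tail y m) xs \<partial>replicate_pmf k p)"
    by simp
  also have "\<dots> \<le> (\<integral>\<^sup>+xs. ennreal (exp (- s * y)) * (\<Prod>x\<leftarrow>xs. f x) \<partial>replicate_pmf k p)"
  proof (intro nn_integral_mono)
    fix xs :: "nat list"
    show "indicator (trunc_tail y m) xs \<le>
      ennreal (exp (- s * y)) * (\<Prod>x\<leftarrow>xs. f x)"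
    proof (cases "y \<le> real (sum_list xs) \<and> (\<forall>x\<in>set xs. x \<le> m)")
      case True
      then have "s * y \<le> s * real (sum_list xs)" using s by (intro mult_left_mono) auto
      then have "1 \<le> exp (- s * y + s * real (sum_list xs))" by simp
      then have "1 \<le> ennreal (exp (- s * y) * exp (s * real (sum_list xs)))"
        unfolding exp_add by simp
      then show ?thesis using True by (simp add: prod ennreal_mult')
    qed simp
  qed
  also have "\<dots> = ennreal (exp (- s * y)) * (\<integral>\<^sup>+x. f x \<partial>p) ^ k"
    by (simp add: nn_integral_cmult nn_integral_replicate_prod)
  also have "(\<integral>\<^sup>+x. f x \<partial>p) = (\<Sum>x\<le>m. f x * ennreal (pmf p x))"
    by (rule nn_integral_measure_pmf_support) (auto simp: f_def)
  also have "\<dots> = ennreal (\<Sum>x\<le>m. exp (s * real x) * pmf p x)"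
    by (simp add: f_def ennreal_mult'[symmetric])
  also have "\<dots> \<le> ennreal (exp (s * exp (s * m) * K))"
  proof (rule ennreal_leI)
    have "(\<Sum>x\<le>m. exp (s * real x) * pmf p x) \<le>
        (\<Sum>x\<le>m. pmf p x + s * exp (s * m) * (real x * pmf p x))"
    proof (intro sum_mono)
      fix x assume "x \<in> {..m}"
      define u where "u = s * real x"
      have u: "u \<ge> 0" "u \<le> s * m" using s \<open>x \<in> {..m}\<close> by (auto simp: u_def intro!: mult_left_mono)
      have "1 - u \<le> exp (- u)" using exp_ge_add_one_self[of "-u"] by simp
      then have "(1 - u) * exp u \<le> exp (- u) * exp u" by (intro mult_right_mono) auto
      then have "exp u \<le> 1 + u * exp u" by (simp add: exp_minus algebra_simps)
      also have "\<dots> \<le> 1 + u * exp (s * m)" using u by (intro add_mono mult_left_mono) auto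
      finally have "exp u * pmf p x \<le> (1 + u * exp (s * m)) * pmf p x" by (intro mult_right_mono) auto
      then show "exp (s * real x) * pmf p x \<le> pmf p x + s * exp (s * m) * (real x * pmf p x)"
        by (simp add: u_def algebra_simps)
    qed
    also have "\<dots> = pr p {..m} + s * exp (s * m) * K"
      by (simp add: sum.distrib K_def sum_distrib_left measure_measure_pmf_finite)
    also have "\<dots> \<le> 1 + s * exp (s * m) * K" by simp
    also have "\<dots> \<le> exp (s * exp (s * m) * K)" by (rule exp_ge_add_one_self)
    finally show "(\<Sum>x\<le>m. exp (s * real x) * pmf p x) \<le> exp (s * exp (s * m) * K)" .
  qed
  also have "ennreal (exp (- s * y)) * ennreal (exp (s * exp (s * m) * K)) ^ k =
      ennreal (exp (real k * (s * exp (s * m) * K) - s * y))"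
    by (simp add: ennreal_power ennreal_mult'[symmetric] exp_of_nat_mult[symmetric] exp_diff exp_minus field_simps)
  finally show ?thesis
    by (simp add: measure_pmf.emeasure_eq_measure K_def mult_left_mono power_mono)
qed

lemma nn_integral_pmf_single_point:
  fixes p :: "'a pmf"
  assumes "\<And>a. a \<noteq> b \<Longrightarrow> f a = 0"
  shows "(\<integral>\<^sup>+a. f a \<partial>p) = f b * ennreal (pmf p b)"
proof -
  have "(\<integral>\<^sup>+a. f a \<partial>p) = (\<Sum>a\<in>{b}. f a * ennreal (pmf p a))"
    by (rule nn_integral_measure_pmf_support) (use assms in auto)
  then show ?thesis by simp
qed

text \<open>On \<open>S = n\<close> either some summand \<open>a\<close> is at least \<open>(1 - \<epsilon>) n\<close>, or the largest one is below that
  and at least \<open>n / k\<close>; the index \<open>j\<close> is the dyadic block \<open>n / 2^(j + 1) < a \<le> n / 2^j\<close> of the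
  largest summand, where the other summands must add up to \<open>n - a\<close> while being at most \<open>a\<close>.\<close>

lemma prob_sum_eq_upper:
  fixes p :: "nat pmf" and n k :: nat and \<epsilon> \<eta> :: real
  assumes k: "k > 0" and n: "n > 0" and e: "0 < \<epsilon>" "\<epsilon> < 1" and eta: "\<eta> \<ge> 0"
    and near: "\<And>a. (1 - \<epsilon>) * n \<le> real a \<Longrightarrow> a \<le> n \<Longrightarrow> pmf p a \<le> (1 + \<eta>) * pmf p n"
    and far: "\<And>a. n \<le> k * a \<Longrightarrow> a \<le> n \<Longrightarrow> pmf p a \<le> 2 * (real n / real a)\<^sup>2 * pmf p n"
  defines "R \<equiv> pr (replicate_pmf (k - 1) p)"
  shows "pr (replicate_pmf k p) {xs. sum_list xs = n} \<le>
    real k * pmf p n * ((1 + \<eta>) * R {xs. \<forall>x\<in>set xs. x \<le> n}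
      + 8 * R (trunc_tail (\<epsilon> * n) n)
      + (\<Sum>j=1..n. 8 * 4 ^ j * R (trunc_tail (real n - real n / 2 ^ j) (n div 2 ^ j))))"
proof -
  define A0 where "A0 = {xs. \<forall>x\<in>set xs. x \<le> n}"
  define A1 where "A1 = trunc_tail (\<epsilon> * n) n"
  define A2 where "A2 j = trunc_tail (real n - real n / 2 ^ j) (n div 2 ^ j)" for j
  define B :: "nat list \<Rightarrow> real" where "B xs = (1 + \<eta>) * indicator A0 xs + 8 * indicator A1 xs
      + (\<Sum>j=1..n. 8 * 4 ^ j * indicator (A2 j) xs)" for xs
  have B_nonneg: "B xs \<ge> 0" for xs
    unfolding B_def using eta by (intro add_nonneg_nonneg sum_nonneg) auto
  \<comment> \<open>\<open>Q\<close> selects the entries that may carry the sum. The maximum always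
    qualifies: either it is near \<open>n\<close>, or it dominates the rest and, being at least the
    average, satisfies \<open>n <= k * a\<close>. Several entries may qualify, which only enlarges
    an upper bound.\<close>
  define Q where "Q a M \<longleftrightarrow> a + sum_mset M = n \<and>
     ((1 - \<epsilon>) * n \<le> real a \<or> real a < (1 - \<epsilon>) * n \<and> (\<forall>b\<in>#M. b \<le> a) \<and> n \<le> k * a)" for a M
  define f :: "nat \<Rightarrow> nat multiset \<Rightarrow> ennreal" where "f a M = (if Q a M then 1 else 0)" for a M
  have "emeasure (replicate_pmf k p) {xs. sum_list xs = n} =
      (\<integral>\<^sup>+xs. indicator {xs. sum_list xs = n} xs \<partial>replicate_pmf k p)" by simp
  also have "\<dots> \<le> (\<integral>\<^sup>+xs. (\<Sum>a\<in>#mset xs. f a (mset xs - {#a#})) \<partial>replicate_pmf k p)"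
  proof (intro nn_integral_mono_AE AE_pmfI)
    fix xs assume "xs \<in> set_pmf (replicate_pmf k p)"
    then have len: "length xs = k" by (simp add: set_replicate_pmf)
    show "indicator {xs. sum_list xs = n} xs \<le> (\<Sum>a\<in>#mset xs. f a (mset xs - {#a#}))"
    proof (cases "sum_list xs = n")
      case True
      have ne: "set xs \<noteq> {}" using len k by auto
      define a where "a = Max (set xs)"
      have a: "a \<in> set xs" "\<And>b. b \<in> set xs \<Longrightarrow> b \<le> a" using ne by (auto simp: a_def)
      define M where "M = mset xs - {#a#}"
      have M: "mset xs = add_mset a M" using a by (simp add: M_def)
      have sM: "a + sum_mset M = n" using True M by (simp flip: sum_mset_sum_list)
      have "sum_list xs \<le> length xs * a"
        using sum_list_mono[of xs "\<lambda>x. x" "\<lambda>_. a"] a by (simp add: sum_list_triv)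
      then have "n \<le> k * a" using len True by simp
      moreover have "\<forall>b\<in>#M. b \<le> a" using a by (auto simp: M_def dest: in_diffD)
      ultimately have "Q a M" using sM unfolding Q_def by linarith
      then have "1 \<le> f a M" by (simp add: f_def)
      also have "\<dots> \<le> (\<Sum>a\<in>#mset xs. f a (mset xs - {#a#}))" by (simp add: M)
      finally show ?thesis using True by simp
    qed simp
  qed
  also have "\<dots> = of_nat k * (\<integral>\<^sup>+xs. \<integral>\<^sup>+a. f a (mset xs) \<partial>p \<partial>replicate_pmf (k - 1) p)"
    by (rule nn_integral_replicate_exchange)
  also have "(\<integral>\<^sup>+xs. \<integral>\<^sup>+a. f a (mset xs) \<partial>p \<partial>replicate_pmf (k - 1) p) \<le>
     (\<integral>\<^sup>+xs. ennreal (pmf p n * B xs) \<partial>replicate_pmf (k - 1) p)"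
  proof (intro nn_integral_mono)
    fix xs :: "nat list"
    \<comment> \<open>Given the others, the marked entry is forced to be
      \<open>n - sum_list xs\<close>; if the truncated subtraction cuts off, \<open>Q\<close> fails
      and the integral is 0.\<close>
    define a where "a = n - sum_list xs"
    have "(\<integral>\<^sup>+a. f a (mset xs) \<partial>p) = f a (mset xs) * ennreal (pmf p a)"
      by (rule nn_integral_pmf_single_point) (auto simp: f_def Q_def a_def sum_mset_sum_list)
    also have "\<dots> \<le> ennreal (pmf p n * B xs)"
    proof (cases "Q a (mset xs)")
      case True
      then have sn: "a + sum_list xs = n" by (simp add: Q_def sum_mset_sum_list)
      then have an: "a \<le> n" and all_n: "xs \<in> A0" using member_le_sum_list[of _ xs]
        by (fastforce simp: A0_def)+
      have "pmf p a \<le> pmf p n * B xs"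
      proof (cases "(1 - \<epsilon>) * n \<le> real a")
        case True
        have "pmf p a \<le> pmf p n * (1 + \<eta>)" using near[OF True an] by (simp add: mult.commute)
        also have "\<dots> \<le> pmf p n * B xs"
        proof (intro mult_left_mono)
          show "1 + \<eta> \<le> B xs"
            unfolding B_def using all_n by (simp add: add_increasing2 sum_nonneg add.assoc)
        qed auto
        finally show ?thesis .
      next
        case False
        then have le: "\<forall>b\<in>set xs. b \<le> a" and ka: "n \<le> k * a"
          using \<open>Q a (mset xs)\<close> by (auto simp: Q_def)
        have a0: "a > 0" using ka n by (cases a) auto
        have S: "\<epsilon> * n \<le> real (sum_list xs)"
        proof -
          have "real (sum_list xs) = real n - real a" using sn by linarith
          then show ?thesis using False by (simp add: algebra_simps)
        qed
        have bound: "pmf p a \<le> 2 * (real n / real a)\<^sup>2 * pmf p n" by (rule far[OF ka an])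
        \<comment> \<open>The far bound costs at most \<open>2 * 2^2 = 8\<close> when
          \<open>a\<close> exceeds \<open>n / 2\<close>, and at most
          \<open>2 * (2^(j+1))^2 = 8 * 4^j\<close> in block \<open>j\<close>.\<close>
        show ?thesis
        proof (cases "2 * a > n")
          case True
          have "(real n / real a)\<^sup>2 \<le> 2\<^sup>2" using True a0 by (intro power_mono) (auto simp: field_simps)
          then have "2 * (real n / real a)\<^sup>2 * pmf p n \<le> 8 * pmf p n" by (intro mult_right_mono) auto
          also have "\<dots> \<le> B xs * pmf p n"
          proof (intro mult_right_mono)
            have "xs \<in> A1" using S all_n by (auto simp: A1_def A0_def)
            then show "8 \<le> B xs" unfolding B_def using eta
              by (simp add: add_increasing add_increasing2 sum_nonneg)
          qed auto
          finally show ?thesis using bound by (simp add: mult.commute)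
        next
          case False
          have ex: "\<exists>j. n < a * 2 ^ Suc j"
            using a0 by (intro exI[of _ n]) (metis less_exp less_trans lessI mult_le_mono1 Suc_leI nat_mult_1 order_less_le_trans power_strict_increasing one_less_numeral_iff semiring_norm(76) One_nat_def)
          define j where "j = (LEAST j. n < a * 2 ^ Suc j)"
          have j1: "n < a * 2 ^ Suc j" unfolding j_def by (rule LeastI_ex[OF ex])
          have j0: "j \<noteq> 0" using j1 False by (cases j) auto
          have j2: "a * 2 ^ j \<le> n"
          proof (rule ccontr)
            assume "\<not> a * 2 ^ j \<le> n"
            then have "n < a * 2 ^ Suc (j - 1)" using j0 by simp
            then have "j \<le> j - 1" unfolding j_def by (rule Least_le)
            then show False using j0 by simp
          qed
          have "2 ^ j \<le> n" using j2 a0 by (metis Suc_leI One_nat_def mult_le_mono1 nat_mult_1 order_trans)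
          then have jn: "j \<in> {1..n}" using j0 less_le_trans[OF less_exp[of j], of n] by auto
          have "real n / real a \<le> 2 ^ Suc j"
          proof -
            have "real n \<le> real (a * 2 ^ Suc j)" using j1 by (simp only: of_nat_le_iff)
            then show ?thesis using a0 by (simp add: divide_le_eq mult.commute)
          qed
          then have "(real n / real a)\<^sup>2 \<le> (2 ^ Suc j)\<^sup>2" by (intro power_mono) auto
          also have "(2 ^ Suc j)\<^sup>2 = (4::real) * 4 ^ j"
            by (simp add: power2_eq_square flip: power_mult_distrib)
          finally have "2 * (real n / real a)\<^sup>2 * pmf p n \<le> 8 * 4 ^ j * pmf p n"
            by (intro mult_right_mono) auto
          also have "\<dots> \<le> B xs * pmf p n"
          proof (intro mult_right_mono)
            have "real (a * 2 ^ j) \<le> real n" using j2 by (simp only: of_nat_le_iff)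
            then have "real a \<le> real n / 2 ^ j" by (simp add: field_simps)
            moreover have "a \<le> n div 2 ^ j" using j2 by (simp add: less_eq_div_iff_mult_less_eq)
            ultimately have "xs \<in> A2 j" using le sn by (auto simp: A2_def intro: order_trans)
            then have "8 * 4 ^ j = 8 * 4 ^ j * (indicator (A2 j) xs :: real)" by simp
            also have "\<dots> \<le> (\<Sum>j=1..n. 8 * 4 ^ j * indicator (A2 j) xs)"
              using jn by (intro member_le_sum[of j "{1..n}" "\<lambda>j. 8 * 4 ^ j * indicator (A2 j) xs :: real"]) auto
            also have "\<dots> \<le> B xs" unfolding B_def using eta by simp
            finally show "8 * 4 ^ j \<le> B xs" .
          qed auto
          finally show ?thesis using bound by (simp add: mult.commute)
        qed
      qed
      then show ?thesis using True by (simp add: f_def ennreal_leI)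
    qed (simp add: f_def)
    finally show "(\<integral>\<^sup>+a. f a (mset xs) \<partial>p) \<le> ennreal (pmf p n * B xs)" .
  qed
  also have "\<dots> = ennreal (pmf p n * (\<integral>xs. B xs \<partial>replicate_pmf (k - 1) p))"
  proof -
    have "integrable (replicate_pmf (k - 1) p) B"
      unfolding B_def by (intro Bochner_Integration.integrable_add Bochner_Integration.integrable_sum integrable_mult_right)
        (auto simp: integrable_indicator_iff measure_pmf.emeasure_eq_measure)
    then show ?thesis
      by (subst nn_integral_eq_integral) (auto simp: B_nonneg)
  qed
  also have "(\<integral>xs. B xs \<partial>replicate_pmf (k - 1) p) =
      (1 + \<eta>) * R A0 + 8 * R A1 + (\<Sum>j=1..n. 8 * 4 ^ j * R (A2 j))"
  proof -
    define P where "P = replicate_pmf (k - 1) p"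
    have int: "integrable (measure_pmf P) (\<lambda>xs. c * indicator A xs :: real)" for A c
      by (intro integrable_mult_right) (auto simp: integrable_indicator_iff measure_pmf.emeasure_eq_measure)
    have "(\<integral>xs. B xs \<partial>P) = (\<integral>xs. (1 + \<eta>) * indicator A0 xs \<partial>P) + (\<integral>xs. 8 * indicator A1 xs \<partial>P)
        + (\<integral>xs. (\<Sum>j=1..n. 8 * 4 ^ j * indicator (A2 j) xs) \<partial>P)"
      unfolding B_def
      by (subst Bochner_Integration.integral_add Bochner_Integration.integral_add[OF int int];
          (intro Bochner_Integration.integrable_add Bochner_Integration.integrable_sum int refl)?)+
    also have "(\<integral>xs. (\<Sum>j=1..n. 8 * 4 ^ j * indicator (A2 j) xs) \<partial>P) =
        (\<Sum>j=1..n. 8 * 4 ^ j * pr P (A2 j))"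
      by (subst Bochner_Integration.integral_sum[OF int]) simp
    finally show ?thesis by (simp add: R_def P_def)
  qed
  finally have "emeasure (replicate_pmf k p) {xs. sum_list xs = n} \<le>
      of_nat k * ennreal (pmf p n * ((1 + \<eta>) * R A0 + 8 * R A1 + (\<Sum>j=1..n. 8 * 4 ^ j * R (A2 j))))"
    by (simp add: mult_left_mono)
  also have "\<dots> = ennreal (real k * pmf p n * ((1 + \<eta>) * R A0 + 8 * R A1 + (\<Sum>j=1..n. 8 * 4 ^ j * R (A2 j))))"
    by (simp add: ennreal_mult' mult.assoc ennreal_of_nat_eq_real_of_nat)
  finally show ?thesis
    unfolding A0_def A1_def A2_def
    by (subst (asm) measure_pmf.emeasure_eq_measure, subst (asm) ennreal_le_iff)
       (use eta in \<open>auto simp: R_def intro!: mult_nonneg_nonneg add_nonneg_nonneg sum_nonneg\<close>)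
qed

text \<open>Here the sum over marked entries must not exceed 1. With \<open>\<epsilon> < 1/2\<close>
  a marked entry lies above \<open>n / 2\<close>, so it is the only one and is the maximum; deleting
  it leaves exactly the multiset on which \<open>E\<close> is tested.\<close>

lemma prob_sum_eq_lower:
  fixes p :: "nat pmf" and n k :: nat and \<epsilon> \<eta> :: real
  assumes n: "n > 0" and e: "0 < \<epsilon>" "\<epsilon> < 1/2" and eta: "\<eta> \<le> 1"
    and near: "\<And>a. (1 - \<epsilon>) * n \<le> real a \<Longrightarrow> a \<le> n \<Longrightarrow> pmf p a \<ge> (1 - \<eta>) * pmf p n"
  shows "real k * pmf p n * (1 - \<eta>) *
      pr (replicate_pmf (k - 1) p) {xs. E (mset xs) \<and> real (sum_list xs) \<le> \<epsilon> * n}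
    \<le> pr (replicate_pmf k p) {xs. sum_list xs = n \<and> E (mset (delete_first_max xs))}"
proof -
  define Q where "Q a M \<longleftrightarrow> a + sum_mset M = n \<and> (1 - \<epsilon>) * n \<le> real a \<and> E M" for a M
  define f :: "nat \<Rightarrow> nat multiset \<Rightarrow> ennreal" where "f a M = (if Q a M then 1 else 0)" for a M
  define G where "G = {xs. E (mset xs) \<and> real (sum_list xs) \<le> \<epsilon> * n}"
  define H where "H = {xs. sum_list xs = n \<and> E (mset (delete_first_max xs))}"
  have "of_nat k * (\<integral>\<^sup>+xs. ennreal (pmf p n * (1 - \<eta>)) * indicator G xs \<partial>replicate_pmf (k - 1) p) \<le>
     of_nat k * (\<integral>\<^sup>+xs. \<integral>\<^sup>+a. f a (mset xs) \<partial>p \<partial>replicate_pmf (k - 1) p)"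
  proof (intro mult_left_mono nn_integral_mono)
    fix xs :: "nat list"
    define a where "a = n - sum_list xs"
    have eq: "(\<integral>\<^sup>+a. f a (mset xs) \<partial>p) = f a (mset xs) * ennreal (pmf p a)"
      by (rule nn_integral_pmf_single_point) (auto simp: f_def Q_def a_def sum_mset_sum_list)
    show "ennreal (pmf p n * (1 - \<eta>)) * indicator G xs \<le> (\<integral>\<^sup>+a. f a (mset xs) \<partial>p)"
    proof (cases "xs \<in> G")
      case True
      have "\<epsilon> * real n \<le> real n" using e mult_right_mono[of \<epsilon> 1 "real n"] by simp
      then have le: "sum_list xs \<le> n" using True unfolding G_def of_nat_le_iff[where 'a = real, symmetric]
        by (simp only: mem_Collect_eq) linarith
      then have "real a = real n - real (sum_list xs)" by (simp add: a_def)
      then have a: "(1 - \<epsilon>) * n \<le> real a" using True by (simp add: G_def algebra_simps)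
      then have "Q a (mset xs)" using True le by (simp add: Q_def a_def sum_mset_sum_list G_def)
      moreover have "(1 - \<eta>) * pmf p n \<le> pmf p a" by (rule near[OF a]) (simp add: a_def)
      ultimately show ?thesis using True unfolding eq by (simp add: f_def mult.commute)
    qed simp
  qed simp
  also have "\<dots> = (\<integral>\<^sup>+xs. (\<Sum>a\<in>#mset xs. f a (mset xs - {#a#})) \<partial>replicate_pmf k p)"
    by (rule nn_integral_replicate_exchange[symmetric])
  also have "\<dots> \<le> (\<integral>\<^sup>+xs. indicator H xs \<partial>replicate_pmf k p)"
  proof (intro nn_integral_mono)
    fix xs :: "nat list"
    show "(\<Sum>a\<in>#mset xs. f a (mset xs - {#a#})) \<le> indicator H xs"
    proof (cases "\<exists>a\<in>set xs. Q a (mset xs - {#a#})")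
      case False
      then have "image_mset (\<lambda>a. f a (mset xs - {#a#})) (mset xs) = image_mset (\<lambda>a. 0) (mset xs)"
        by (intro image_mset_cong) (auto simp: f_def)
      then show ?thesis by simp
    next
      case True
      then obtain a where a: "a \<in> set xs" "Q a (mset xs - {#a#})" by blast
      define M where "M = mset xs - {#a#}"
      have M: "mset xs = add_mset a M" using a by (simp add: M_def)
      have sM: "a + sum_mset M = n" and big: "(1 - \<epsilon>) * n \<le> real a" using a by (auto simp: Q_def M_def)
      have half: "(1 - \<epsilon>) * n > real n / 2" using e n by (simp add: field_simps)
      have small: "real b < real n / 2" if "b \<in># M" for b
      proof -
        obtain N where "M = add_mset b N" using multi_member_split[OF \<open>b \<in># M\<close>] by blast
        then have "b \<le> sum_mset M" by simp
        then show ?thesis using sM big half by linarith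
      qed
      have "f b (mset xs - {#b#}) = 0" if "b \<in># M" for b
      proof -
        have "\<not> (1 - \<epsilon>) * real n \<le> real b" using small[OF that] half by linarith
        then show ?thesis by (simp add: f_def Q_def)
      qed
      then have "image_mset (\<lambda>b. f b (mset xs - {#b#})) M = image_mset (\<lambda>a. 0) M"
        by (intro image_mset_cong) auto
      then have "(\<Sum>a\<in>#mset xs. f a (mset xs - {#a#})) \<le> 1" by (simp add: M f_def)
      moreover have "xs \<in> H"
      proof -
        have "set xs = insert a (set_mset M)" using M by (metis set_mset_add_mset_insert set_mset_mset)
        moreover have "b \<le> a" if "b \<in># M" for b
          using small[OF that] big half by linarith
        ultimately have "Max (set xs) = a"
          by (intro Max_eqI) auto
        then have "mset (delete_first_max xs) = M" by (simp add: delete_first_max_def M_def)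
        moreover have "sum_list xs = n" using sM by (simp add: M flip: sum_mset_sum_list)
        ultimately show ?thesis using a by (simp add: H_def Q_def M_def)
      qed
      ultimately show ?thesis by simp
    qed
  qed
  finally have "of_nat k * (\<integral>\<^sup>+xs. ennreal (pmf p n * (1 - \<eta>)) * indicator G xs \<partial>replicate_pmf (k - 1) p) \<le>
      emeasure (replicate_pmf k p) H" by simp
  also have "of_nat k * (\<integral>\<^sup>+xs. ennreal (pmf p n * (1 - \<eta>)) * indicator G xs \<partial>replicate_pmf (k - 1) p) =
     of_nat k * (ennreal (pmf p n * (1 - \<eta>)) * emeasure (replicate_pmf (k - 1) p) G)"
    by (subst nn_integral_cmult_indicator) simp_all
  also have "\<dots> = ennreal (real k * (pmf p n * (1 - \<eta>) * pr (replicate_pmf (k - 1) p) G))"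
    using eta by (simp only: measure_pmf.emeasure_eq_measure ennreal_of_nat_eq_real_of_nat)
      (simp flip: ennreal_mult')
  finally have "real k * (pmf p n * (1 - \<eta>) * pr (replicate_pmf (k - 1) p) G) \<le>
      pr (replicate_pmf k p) H"
    by (simp only: measure_pmf.emeasure_eq_measure ennreal_le_iff measure_nonneg)
  then show ?thesis
    by (simp only: G_def H_def mult.assoc)
qed

section \<open>Multinomial counts\<close>

lemma pmf_replicate_pmf:
  "pmf (replicate_pmf k p) xs = (if length xs = k then \<Prod>x\<leftarrow>xs. pmf p x else 0)"
proof (induction k arbitrary: xs)
  case 0
  then show ?case by (cases xs) (simp_all add: pmf_return)
next
  case (Suc k)
  show ?case
  proof (cases xs)
    case Nil
    then show ?thesis by (simp add: pmf_eq_0_set_pmf)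
  next
    case (Cons y ys)
    have inj: "inj (\<lambda>(x, xs). x # xs)" by (auto intro: injI)
    have "replicate_pmf (Suc k) p = map_pmf (\<lambda>(x, xs). x # xs) (pair_pmf p (replicate_pmf k p))"
      by (simp add: pair_pmf_def map_pmf_def bind_assoc_pmf bind_return_pmf)
    then have "pmf (replicate_pmf (Suc k) p) xs = pmf (pair_pmf p (replicate_pmf k p)) (y, ys)"
      using pmf_map_inj'[OF inj, of "pair_pmf p (replicate_pmf k p)" "(y, ys)"] Cons by simp
    then show ?thesis using Suc.IH[of ys] Cons by (simp add: pmf_pair)
  qed
qed

lemma map_replicate_pmf: "map_pmf (map f) (replicate_pmf k p) = replicate_pmf k (map_pmf f p)"
proof (induction k)
  case (Suc k)
  have "map_pmf (map f) (replicate_pmf (Suc k) p) =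
      bind_pmf p (\<lambda>x. bind_pmf (map_pmf (map f) (replicate_pmf k p)) (\<lambda>xs. return_pmf (f x # xs)))"
    by (simp add: map_bind_pmf bind_map_pmf)
  then show ?case unfolding Suc.IH by (simp add: bind_map_pmf)
qed simp

text \<open>All arrangements of \<open>A\<close> are equally likely, and their number is the
  multinomial coefficient. The superset \<open>F\<close> allows a fixed set of labels: those of
  multiplicity 0 contribute factors 1.\<close>

lemma prob_replicate_mset:
  assumes A: "size A = k" and F: "finite F" "set_mset A \<subseteq> F"
  shows "pr (replicate_pmf k p) {xs. mset xs = A} =
    fact k / (\<Prod>x\<in>F. fact (count A x)) * (\<Prod>x\<in>F. pmf p x ^ count A x)"
proof -
  have eq: "{xs. mset xs = A} = permutations_of_multiset A"
    by (auto simp: permutations_of_multiset_def)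
  have "pr (replicate_pmf k p) {xs. mset xs = A} =
      (\<Sum>xs\<in>permutations_of_multiset A. pmf (replicate_pmf k p) xs)"
    unfolding eq by (rule measure_measure_pmf_finite) simp
  also have "\<dots> = (\<Sum>xs\<in>permutations_of_multiset A. \<Prod>x\<in>#A. pmf p x)"
  proof (intro sum.cong refl)
    fix xs assume "xs \<in> permutations_of_multiset A"
    then have "mset xs = A" by (rule permutations_of_multisetD)
    moreover from this have "length xs = k" using A by (metis size_mset)
    ultimately show "pmf (replicate_pmf k p) xs = (\<Prod>x\<in>#A. pmf p x)"
      by (metis (no_types) pmf_replicate_pmf mset_map prod_mset_prod_list)
  qed
  also have "\<dots> = real (card (permutations_of_multiset A)) * (\<Prod>x\<in>#A. pmf p x)"
    by simp
  also have "(\<Prod>x\<in>#A. pmf p x) = (\<Prod>x\<in>set_mset A. pmf p x ^ count A x)"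
    by (simp add: image_prod_mset_multiplicity)
  also have "\<dots> = (\<Prod>x\<in>F. pmf p x ^ count A x)"
    using F by (intro prod.mono_neutral_left) (auto simp: not_in_iff)
  also have "real (card (permutations_of_multiset A)) = fact k / (\<Prod>x\<in>F. fact (count A x))"
  proof -
    have "(\<Prod>x\<in>set_mset A. fact (count A x) :: nat) = (\<Prod>x\<in>F. fact (count A x))"
      using F by (intro prod.mono_neutral_left) (auto simp: not_in_iff)
    then have "card (permutations_of_multiset A) * (\<Prod>x\<in>F. fact (count A x)) = fact k"
      using card_permutations_of_multiset_aux[of A] A by simp
    then have "real (card (permutations_of_multiset A) * (\<Prod>x\<in>F. fact (count A x))) = real (fact k)"
      by (simp only:)
    moreover have "(\<Prod>x\<in>F. fact (count A x) :: real) \<noteq> 0" using F by simp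
    ultimately show ?thesis by (simp add: eq_divide_eq)
  qed
  finally show ?thesis .
qed

text \<open>The quotient is the falling factorial of length \<open>s\<close> over
  \<open>K^s\<close>; each induction step contributes one factor \<open>1 - s / K\<close>.\<close>

lemma fact_ratio_asymp:
  assumes K: "filterlim K at_top F"
  shows "((\<lambda>n. fact (K n) / (fact (K n - s) * real (K n) ^ s)) \<longlongrightarrow> 1) F"
proof (induction s)
  case 0
  then show ?case by simp
next
  case (Suc s)
  have "((\<lambda>n. 1 - real s * inverse (real (K n))) \<longlongrightarrow> 1 - real s * 0) F"
    using filterlim_compose[OF filterlim_real_sequentially K]
    by (intro tendsto_intros) (auto intro: tendsto_inverse_0_at_top)
  from tendsto_mult[OF Suc.IH this]
  have "((\<lambda>n. fact (K n) / (fact (K n - s) * real (K n) ^ s) * (1 - real s * inverse (real (K n)))) \<longlongrightarrow> 1) F"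
    by simp
  moreover have "\<forall>\<^sub>F n in F. K n \<ge> Suc s"
    using K by (simp add: filterlim_at_top)
  then have "\<forall>\<^sub>F n in F. fact (K n) / (fact (K n - s) * real (K n) ^ s) * (1 - real s * inverse (real (K n))) =
      fact (K n) / (fact (K n - Suc s) * real (K n) ^ Suc s)"
  proof eventually_elim
    case (elim n)
    then have "K n - s = Suc (K n - Suc s)" by simp
    then have "fact (K n - s) = (real (K n - s) * fact (K n - Suc s) :: real)"
      by (metis fact_Suc)
    moreover have "real (K n - s) > 0" "1 - real s * inverse (real (K n)) = real (K n - s) / real (K n)"
      using elim by (auto simp: of_nat_diff field_simps)
    ultimately show ?case by simp
  qed
  ultimately show ?case by (rule Lim_transform_eventually)
qed

text \<open>The bounds \<open>(q - 1) / q <= ln q <= q - 1\<close> squeeze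
  \<open>m * ln q\<close>.\<close>

lemma power_tendsto_exp:
  fixes q :: "'a \<Rightarrow> real"
  assumes q: "(q \<longlongrightarrow> 1) F" and lim: "((\<lambda>n. real (m n) * (1 - q n)) \<longlongrightarrow> c) F"
  shows "((\<lambda>n. q n ^ m n) \<longlongrightarrow> exp (- c)) F"
proof -
  have pos: "\<forall>\<^sub>F n in F. q n > 0" using q by (rule order_tendstoD) simp
  have "((\<lambda>n. real (m n) * ln (q n)) \<longlongrightarrow> - c) F"
  proof (rule tendsto_sandwich)
    show "\<forall>\<^sub>F n in F. - (real (m n) * (1 - q n) / q n) \<le> real (m n) * ln (q n)"
      using pos
    proof eventually_elim
      case (elim n)
      have "ln (inverse (q n)) \<le> inverse (q n) - 1" using elim by (intro ln_le_minus_one) auto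
      then have "- ((1 - q n) / q n) \<le> ln (q n)" using elim by (simp add: ln_inverse ln_div diff_divide_distrib inverse_eq_divide)
      then have "real (m n) * - ((1 - q n) / q n) \<le> real (m n) * ln (q n)" by (intro mult_left_mono) auto
      then show ?case by simp
    qed
    show "\<forall>\<^sub>F n in F. real (m n) * ln (q n) \<le> - (real (m n) * (1 - q n))"
      using pos
    proof eventually_elim
      case (elim n)
      then have "real (m n) * ln (q n) \<le> real (m n) * (q n - 1)"
        by (intro mult_left_mono ln_le_minus_one) auto
      then show ?case by (simp add: algebra_simps)
    qed
    have "((\<lambda>n. - (real (m n) * (1 - q n) / q n)) \<longlongrightarrow> - (c / 1)) F"
      by (intro tendsto_intros lim q) auto
    then show "((\<lambda>n. - (real (m n) * (1 - q n) / q n)) \<longlongrightarrow> - c) F" by simp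
    show "((\<lambda>n. - (real (m n) * (1 - q n))) \<longlongrightarrow> - c) F"
      by (intro tendsto_intros lim)
  qed
  then have "((\<lambda>n. exp (real (m n) * ln (q n))) \<longlongrightarrow> exp (- c)) F"
    by (intro tendsto_intros)
  moreover have "\<forall>\<^sub>F n in F. exp (real (m n) * ln (q n)) = q n ^ m n"
    using pos by eventually_elim (simp add: exp_of_nat_mult)
  ultimately show ?thesis by (rule Lim_transform_eventually)
qed

text \<open>Label 0 takes the remaining places; because of the truncated subtraction the multiset has
  size \<open>k\<close> only if \<open>sum_list v \<le> k\<close>.\<close>

definition label_mset :: "nat \<Rightarrow> nat list \<Rightarrow> nat multiset" where
  "label_mset k v = replicate_mset (k - sum_list v) 0 + (\<Sum>i<length v. replicate_mset (v ! i) (Suc i))"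

lemma count_label_mset:
  "count (label_mset k v) 0 = k - sum_list v"
  "i < length v \<Longrightarrow> count (label_mset k v) (Suc i) = v ! i"
  "i \<ge> length v \<Longrightarrow> count (label_mset k v) (Suc i) = 0"
  by (simp_all add: label_mset_def count_sum)

lemma size_label_mset: "sum_list v \<le> k \<Longrightarrow> size (label_mset k v) = k"
  by (simp add: label_mset_def size_multiset_sum sum_list_sum_nth atLeast0LessThan)

text \<open>\<open>c\<close> may exceed the sum of the \<open>lam i\<close>: mass of
  \<open>q n\<close> on labels beyond \<open>length v\<close> also counts towards the deficit of
  label 0, whereas \<open>label_mset\<close> contains no such label. Their absence is part of the
  event, hence the factor \<open>exp (- c)\<close>.\<close>

lemma multinomial_poisson_limit:
  fixes q :: "nat \<Rightarrow> nat pmf" and K :: "nat \<Rightarrow> nat"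
  assumes K: "filterlim K at_top sequentially"
    and q0: "(\<lambda>n. real (K n) * (1 - pmf (q n) 0)) \<longlonglongrightarrow> c"
    and qs: "\<And>i. i < length v \<Longrightarrow> (\<lambda>n. real (K n) * pmf (q n) (Suc i)) \<longlonglongrightarrow> lam i"
  shows "(\<lambda>n. pr (replicate_pmf (K n) (q n)) {xs. mset xs = label_mset (K n) v}) \<longlonglongrightarrow>
     exp (- c) * (\<Prod>i<length v. lam i ^ (v ! i) / fact (v ! i))"
proof -
  define s where "s = sum_list v"
  have Kreal: "filterlim (\<lambda>n. real (K n)) at_top sequentially"
    by (rule filterlim_compose[OF filterlim_real_sequentially K])
  have inv0: "(\<lambda>n. inverse (real (K n))) \<longlonglongrightarrow> 0"
    using Kreal by (rule tendsto_inverse_0_at_top)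
  have K1: "\<forall>\<^sub>F n in sequentially. K n \<ge> Suc s"
    using K by (simp add: filterlim_at_top)
  have u0: "(\<lambda>n. 1 - pmf (q n) 0) \<longlonglongrightarrow> 0"
  proof (rule Lim_transform_eventually)
    show "(\<lambda>n. real (K n) * (1 - pmf (q n) 0) * inverse (real (K n))) \<longlonglongrightarrow> 0"
      using tendsto_mult[OF q0 inv0] by simp
    show "\<forall>\<^sub>F n in sequentially. real (K n) * (1 - pmf (q n) 0) * inverse (real (K n)) = 1 - pmf (q n) 0"
      using K1 by eventually_elim (simp add: field_simps)
  qed
  have qlim: "(\<lambda>n. pmf (q n) 0) \<longlonglongrightarrow> 1"
    using tendsto_diff[OF tendsto_const[of 1] u0] by simp
  have "(\<lambda>n. real (K n) * (1 - pmf (q n) 0) - real s * (1 - pmf (q n) 0)) \<longlonglongrightarrow> c - real s * 0"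
    by (intro tendsto_intros q0 u0)
  moreover have "\<forall>\<^sub>F n in sequentially. real (K n) * (1 - pmf (q n) 0) - real s * (1 - pmf (q n) 0) =
      real (K n - s) * (1 - pmf (q n) 0)"
    using K1 by eventually_elim (simp add: of_nat_diff left_diff_distrib)
  ultimately have "(\<lambda>n. real (K n - s) * (1 - pmf (q n) 0)) \<longlonglongrightarrow> c"
    by (simp add: Lim_transform_eventually)
  from power_tendsto_exp[OF qlim this]
  have pw: "(\<lambda>n. pmf (q n) 0 ^ (K n - s)) \<longlonglongrightarrow> exp (- c)" .
  \<comment> \<open>The multinomial formula with \<open>K^s\<close> moved from the falling factorial
    into the powers of the label probabilities.\<close>
  have "(\<lambda>n. fact (K n) / (fact (K n - s) * real (K n) ^ s) * (pmf (q n) 0 ^ (K n - s) *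
      (\<Prod>i<length v. (real (K n) * pmf (q n) (Suc i)) ^ (v ! i) / fact (v ! i)))) \<longlonglongrightarrow>
      1 * (exp (- c) * (\<Prod>i<length v. lam i ^ (v ! i) / fact (v ! i)))"
    by (intro tendsto_intros fact_ratio_asymp K pw qs) auto
  moreover have "\<forall>\<^sub>F n in sequentially. fact (K n) / (fact (K n - s) * real (K n) ^ s) * (pmf (q n) 0 ^ (K n - s) *
      (\<Prod>i<length v. (real (K n) * pmf (q n) (Suc i)) ^ (v ! i) / fact (v ! i))) =
     pr (replicate_pmf (K n) (q n)) {xs. mset xs = label_mset (K n) v}"
    using K1
  proof eventually_elim
    case (elim n)
    define F where "F = insert 0 (Suc ` {..<length v})"
    have sub: "set_mset (label_mset (K n) v) \<subseteq> F"
    proof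
      fix x assume x: "x \<in># label_mset (K n) v"
      show "x \<in> F"
      proof (cases x)
        case (Suc i)
        have "i < length v"
          using x count_label_mset(3)[of v i "K n"] Suc by (meson count_eq_zero_iff not_le)
        then show ?thesis using Suc by (simp add: F_def)
      qed (simp add: F_def)
    qed
    have split: "(\<Prod>x\<in>F. g x (count (label_mset (K n) v) x)) = g 0 (K n - s) * (\<Prod>i<length v. g (Suc i) (v ! i))"
      for g :: "nat \<Rightarrow> nat \<Rightarrow> real"
      unfolding F_def by (subst prod.insert) (auto simp: prod.reindex count_label_mset s_def)
    have ps: "(\<Prod>i<length v. real (K n) ^ (v ! i)) = real (K n) ^ s"
      by (simp add: s_def sum_list_sum_nth atLeast0LessThan power_sum)
    show ?case
      using prob_replicate_mset[OF size_label_mset _ sub, of "q n"] elim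
        split[of "\<lambda>_ j. fact j"] split[of "\<lambda>x j. pmf (q n) x ^ j"]
      by (simp add: F_def s_def[symmetric] power_mult_distrib prod.distrib prod_dividef ps)
  qed
  ultimately show ?thesis by (simp add: Lim_transform_eventually)
qed

section \<open>Counts on a grid of cells\<close>

text \<open>The \<open>d\<close> cells of level \<open>d\<close> partition \<open>(1 / (d + 1), 1]\<close>, so a level leaves out a
  neighbourhood of 0, where configurations may accumulate.\<close>

definition thr :: "nat \<Rightarrow> nat \<Rightarrow> real" where
  "thr d i = (real i + 1) / (real d + 1)"

definition cell :: "nat \<Rightarrow> nat \<Rightarrow> real set" where
  "cell d i = {thr d i<..thr d (Suc i)}"

text \<open>On \<open>Conf\<close> the counts are finite, since every cell stays away from 0, so
  \<open>the_enat\<close> never meets infinity there.\<close>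

definition level :: "nat \<Rightarrow> (real \<Rightarrow> nat) \<Rightarrow> nat list" where
  "level d c = map (\<lambda>i. the_enat (cnt c (cell d i))) [0..<d]"

lemma thr_pos: "thr d i > 0"
  by (simp add: thr_def divide_pos_pos)

lemma thr_le_1: "i \<le> d \<Longrightarrow> thr d i \<le> 1"
  by (simp add: thr_def)

lemma thr_self [simp]: "thr d d = 1"
  by (simp add: thr_def)

lemma thr_less_Suc: "thr d i < thr d (Suc i)"
  by (simp add: thr_def divide_strict_right_mono)

lemma thr_mono: "i \<le> j \<Longrightarrow> thr d i \<le> thr d j"
  by (simp add: thr_def divide_right_mono)

lemma cell_subset: "i < d \<Longrightarrow> cell d i \<subseteq> {0<..1}"
  using thr_le_1[of "Suc i" d] thr_pos[of d i] by (auto simp: cell_def)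

lemma cell_disjoint: "i \<noteq> j \<Longrightarrow> cell d i \<inter> cell d j = {}"
  using thr_mono[of "Suc i" j d] thr_mono[of "Suc j" i d]
  by (cases i j rule: linorder_cases) (auto simp: cell_def)

lemma cnt_log_pp:
  "cnt (log_pp n xs) B = enat (length (filter (\<lambda>m. 1 < m \<and> ln (real m) / ln (real n) \<in> B) xs))"
proof -
  define g where "g m = ln (real m) / ln (real n)" for m
  define F where "F = B \<inter> g ` set xs"
  have fin: "finite F" by (simp add: F_def)
  have sub: "{y\<in>B. 0 < log_pp n xs y} \<subseteq> F"
    by (auto simp: log_pp_def F_def g_def filter_empty_conv)
  have "(\<Sum>y\<in>{y\<in>B. 0 < log_pp n xs y}. log_pp n xs y) = (\<Sum>y\<in>F. log_pp n xs y)"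
    using fin sub by (intro sum.mono_neutral_left) (auto simp: F_def)
  also have "\<dots> = (\<Sum>y\<in>F. length (filter (\<lambda>m. 1 < m \<and> g m = y) xs))"
    by (simp add: log_pp_def g_def)
  \<comment> \<open>The list \<open>ys\<close> is decoupled from \<open>F\<close>, which is built
    from \<open>xs\<close>, so that \<open>F\<close> stays fixed during the induction.\<close>
  also have "\<dots> = length (filter (\<lambda>m. 1 < m \<and> g m \<in> F) ys)" if "ys = xs" for ys
    unfolding that[symmetric]
  proof (induction ys)
    case (Cons m ys)
    have "(\<Sum>y\<in>F. length (filter (\<lambda>m. 1 < m \<and> g m = y) (m # ys))) =
        (\<Sum>y\<in>F. (if y = g m then if 1 < m then 1 else 0 else 0) + length (filter (\<lambda>m. 1 < m \<and> g m = y) ys))"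
      by (intro sum.cong) auto
    then show ?case using fin Cons.IH by (simp add: sum.distrib)
  qed simp
  also have "length (filter (\<lambda>m. 1 < m \<and> g m \<in> F) xs) = length (filter (\<lambda>m. 1 < m \<and> g m \<in> B) xs)"
    by (intro arg_cong[where f = length] filter_cong) (auto simp: F_def)
  finally show ?thesis
    using finite_subset[OF sub fin] by (simp add: cnt_def g_def)
qed

text \<open>Label 0 is given to values up to \<open>n powr thr d 0\<close>, label \<open>i + 1\<close> to values whose logarithm to
  base \<open>n\<close> lies in cell \<open>i\<close>, and label \<open>d + 1\<close> to values above \<open>n\<close>.\<close>

definition lab :: "nat \<Rightarrow> nat \<Rightarrow> nat \<Rightarrow> nat" where
  "lab d n m = card {i. i \<le> d \<and> real n powr thr d i < real m}"

text \<open>Thresholds increase with \<open>i\<close>, so the exceeded ones form an initial segment,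
  and their number is the index of the first one that is not exceeded.\<close>

lemma lab_initial_segment:
  assumes "n \<ge> 1"
  shows "{i. i \<le> d \<and> real n powr thr d i < real m} = {..<lab d n m}"
proof -
  define S where "S = {i. i \<le> d \<and> real n powr thr d i < real m}"
  have fin: "finite S" by (simp add: S_def)
  have down: "i \<in> S" if "j \<in> S" "i \<le> j" for i j
    using that assms powr_mono[OF thr_mono[of i j d], of "real n"] by (auto simp: S_def)
  define c where "c = (LEAST i. i \<notin> S)"
  have "\<exists>i. i \<notin> S" by (rule exI[of _ "Suc d"]) (simp add: S_def)
  then have c: "c \<notin> S" unfolding c_def by (rule LeastI_ex)
  have "i \<in> S" if "i < c" for i using not_less_Least[OF that[unfolded c_def]] by simp
  moreover have "i < c" if "i \<in> S" for i using down[OF that, of c] c by (meson not_le)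
  ultimately have "S = {..<c}" by blast
  then show ?thesis unfolding lab_def S_def[symmetric] by simp
qed

lemma lab_Suc_iff:
  assumes "n \<ge> 1" "i < d"
  shows "lab d n m = Suc i \<longleftrightarrow> real n powr thr d i < real m \<and> real m \<le> real n powr thr d (Suc i)"
proof -
  note eq = lab_initial_segment[OF assms(1), of d m]
  have "i \<in> {i. i \<le> d \<and> real n powr thr d i < real m} \<longleftrightarrow> i \<in> {..<lab d n m}"
    "Suc i \<in> {i. i \<le> d \<and> real n powr thr d i < real m} \<longleftrightarrow> Suc i \<in> {..<lab d n m}"
    by (simp_all only: eq)
  then have "real n powr thr d i < real m \<longleftrightarrow> i < lab d n m"
    "real n powr thr d (Suc i) < real m \<longleftrightarrow> Suc i < lab d n m"
    using assms(2) by simp_all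
  then show ?thesis by linarith
qed

lemma lab_0_iff:
  assumes "n \<ge> 1"
  shows "lab d n m = 0 \<longleftrightarrow> real m \<le> real n powr thr d 0"
proof -
  have "0 \<in> {i. i \<le> d \<and> real n powr thr d i < real m} \<longleftrightarrow> 0 \<in> {..<lab d n m}"
    by (simp only: lab_initial_segment[OF assms])
  then show ?thesis by auto
qed

lemma lab_large:
  assumes "n \<ge> 1" "m > n"
  shows "lab d n m = Suc d"
proof -
  have "real n powr thr d d < real m" using assms by simp
  then have "d \<in> {..<lab d n m}"
    by (simp flip: lab_initial_segment[OF assms(1)])
  then have "d < lab d n m" by simp
  moreover have "lab d n m \<le> Suc d"
    unfolding lab_def using card_mono[of "{..d}" "{i. i \<le> d \<and> real n powr thr d i < real m}"] by auto
  ultimately show ?thesis by simp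
qed

lemma count_image_mset_mset: "count (image_mset f (mset xs)) y = length (filter (\<lambda>x. f x = y) xs)"
  by (induction xs) auto

text \<open>Labels ignore the condition \<open>1 < m\<close> of \<open>log_pp\<close>, but the
  values 0 and 1 never exceed \<open>n powr thr d i\<close>, which is at least 1; they get label 0,
  so both counts agree.\<close>

lemma level_log_pp:
  assumes "n \<ge> 2"
  shows "level d (log_pp n xs) = map (\<lambda>i. count (image_mset (lab d n) (mset xs)) (Suc i)) [0..<d]"
proof -
  have "(1 < m \<and> ln (real m) / ln (real n) \<in> cell d i) \<longleftrightarrow> lab d n m = Suc i" if "i < d" for m i
  proof (cases "m > 1")
    case True
    have ln: "ln (real n) > 0" using assms by simp
    have *: "real n powr t < real m \<longleftrightarrow> t < ln (real m) / ln (real n)" for t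
      using assms True ln by (simp add: less_divide_eq powr_def ln_less_cancel_iff[symmetric, of "exp _"] del: ln_less_cancel_iff)
    show ?thesis
      using True that assms *[of "thr d i"] *[of "thr d (Suc i)"]
      by (auto simp: lab_Suc_iff cell_def not_less[symmetric])
  next
    case False
    then have "real m \<le> real n powr thr d i"
      using assms ge_one_powr_ge_zero[of "real n" "thr d i"] thr_pos[of d i] by simp
    then show ?thesis using False that assms by (simp add: lab_Suc_iff)
  qed
  then have "length (filter (\<lambda>m. 1 < m \<and> ln (real m) / ln (real n) \<in> cell d i) xs) =
      count (image_mset (lab d n) (mset xs)) (Suc i)" if "i < d" for i
    using that by (simp add: count_image_mset_mset cong: filter_cong)
  then show ?thesis
    by (simp add: level_def cnt_log_pp)
qed

text \<open>A label multiset built from a list of length \<open>d\<close> has no label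
  \<open>d + 1\<close>, so matching it also forbids values above \<open>n\<close>: the truncation
  comes with the event.\<close>

lemma level_of_label_mset:
  assumes "n \<ge> 2" "image_mset (lab d n) (mset xs) = label_mset k v" "length v = d"
  shows "level d (log_pp n xs) = v" "\<forall>x\<in>set xs. x \<le> n"
proof -
  show "level d (log_pp n xs) = v"
    using assms by (auto intro: nth_equalityI simp: level_log_pp count_label_mset)
  show "\<forall>x\<in>set xs. x \<le> n"
  proof (rule ccontr)
    assume "\<not> ?thesis"
    then obtain x where x: "x \<in> set xs" "x > n" by auto
    moreover have "lab d n x = Suc d" using x assms by (intro lab_large) auto
    ultimately have "Suc d \<in># image_mset (lab d n) (mset xs)" by (metis image_eqI set_image_mset set_mset_mset)
    then show False using assms count_label_mset(3)[of v d k] by (metis count_eq_zero_iff le_refl)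
  qed
qed

section \<open>The principle of a single big jump\<close>

locale log_regular_tail =
  fixes p :: "nat pmf" and \<gamma> :: real and k :: "nat \<Rightarrow> nat" and x :: real
  assumes gamma_nonneg: "\<gamma> \<ge> 0"
    and tail: "\<And>t. 0 < t \<Longrightarrow> t < 1 \<Longrightarrow>
       ((\<lambda>n. pr p {m. real m > real n powr t} / pr p {m. real m > real n})
          \<longlongrightarrow> t powr (-\<gamma>)) sequentially"
    and k_pos: "\<And>n. k n > 0"
    and x_pos: "x > 0"
    and k_lim: "(\<lambda>n. real (k n) * pr p {m. m > n}) \<longlonglongrightarrow> x"
begin

definition T :: "real \<Rightarrow> real" where "T y = pr p {m. real m > y}"

definition K :: "nat \<Rightarrow> real" where "K n = (\<Sum>i\<le>n. real i * pmf p i)"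

lemma T_antimono: "y \<le> z \<Longrightarrow> T z \<le> T y"
  unfolding T_def by (intro measure_pmf.finite_measure_mono) auto

lemma T_nonneg: "T y \<ge> 0"
  by (simp add: T_def)

text \<open>If the tail vanished at some point it would vanish ever after; the quotients in
  \<open>tail\<close> would then be 0 by the convention for division by 0, and could not tend to a
  positive limit.\<close>

lemma T_pos: "T (real n) > 0"
proof (rule ccontr)
  assume "\<not> ?thesis"
  then have "T (real n) = 0" using T_nonneg[of n] by simp
  then have "T (real m) = 0" if "m \<ge> n" for m
    using T_antimono[of "real n" "real m"] T_nonneg[of m] that by simp
  then have "\<forall>\<^sub>F m in sequentially. T (real m powr (1/2)) / T (real m) = 0"
    unfolding eventually_sequentially by (intro exI[of _ n]) simp
  moreover have "(\<lambda>m. T (real m powr (1/2)) / T (real m)) \<longlonglongrightarrow> (1/2) powr (-\<gamma>)"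
    unfolding T_def by (rule tail) auto
  ultimately have "(\<lambda>m. 0::real) \<longlonglongrightarrow> (1/2) powr (-\<gamma>)"
    by (rule Lim_transform_eventually[rotated])
  then show False by (simp add: LIMSEQ_const_iff)
qed

lemma T_tendsto_0: "(\<lambda>n. T (real n)) \<longlonglongrightarrow> 0"
proof -
  have "(\<lambda>n. T (real n)) \<longlonglongrightarrow> pr p (\<Inter>n. {m. real m > real n})"
    unfolding T_def by (intro measure_pmf.finite_Lim_measure_decseq) (auto simp: decseq_def)
  moreover have "(\<Inter>n. {m::nat. real m > real n}) = {}" by auto
  ultimately show ?thesis by simp
qed

lemma k_T_limit:
  assumes "0 < t" "t \<le> 1"
  shows "(\<lambda>n. real (k n) * T (real n powr t)) \<longlonglongrightarrow> x * t powr (-\<gamma>)"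
proof (cases "t = 1")
  case True
  then show ?thesis using k_lim by (simp add: T_def)
next
  case False
  have "(\<lambda>n. (real (k n) * T (real n)) * (T (real n powr t) / T (real n))) \<longlonglongrightarrow> x * t powr (-\<gamma>)"
    using k_lim tail[of t] False assms by (intro tendsto_mult) (auto simp: T_def)
  moreover have "(real (k n) * T (real n)) * (T (real n powr t) / T (real n)) = real (k n) * T (real n powr t)" for n
    using T_pos[of n] by simp
  ultimately show ?thesis by simp
qed

lemma k_T_limit_1: "(\<lambda>n. real (k n) * T (real n)) \<longlonglongrightarrow> x"
  using k_T_limit[of 1] by simp

lemma k_at_top: "filterlim k at_top sequentially"
proof -
  have "filterlim (\<lambda>n. real (k n) * T (real n) * inverse (T (real n))) at_top sequentially"
    by (rule filterlim_tendsto_pos_mult_at_top[OF k_T_limit_1 x_pos])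
       (rule filterlim_inverse_at_top[OF T_tendsto_0], simp add: T_pos)
  then have "filterlim (\<lambda>n. real (k n)) at_top sequentially"
    using T_pos by (simp add: field_simps less_imp_neq[symmetric])
  then show ?thesis
    by (subst (asm) filterlim_sequentially_iff_filterlim_real[symmetric])
qed

section \<open>Slow decay of the tail and truncated means\<close>

lemma powr_minus_one_tendsto_0:
  assumes "t < (1::real)"
  shows "(\<lambda>n. real n powr t / real n) \<longlonglongrightarrow> 0"
proof -
  have "(\<lambda>n. real n powr (t - 1)) \<longlonglongrightarrow> 0"
    using assms by (intro tendsto_neg_powr filterlim_real_sequentially) auto
  then show ?thesis
    by (rule Lim_transform_eventually)
       (use eventually_gt_at_top[of 0] in \<open>eventually_elim, simp add: powr_diff\<close>)
qed

lemma powr_gamma_near_1: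
  assumes "b > 1"
  shows "\<exists>t. 0 < t \<and> t < 1 \<and> t powr (-\<gamma>) < b"
proof -
  have "((\<lambda>t::real. t powr (-\<gamma>)) \<longlongrightarrow> 1 powr (-\<gamma>)) (at_left 1)"
    by (intro tendsto_intros) auto
  then have "\<forall>\<^sub>F t in at_left (1::real). t powr (-\<gamma>) < b"
    using assms by (auto intro: order_tendstoD)
  moreover have "\<forall>\<^sub>F t in at_left (1::real). t \<in> {0<..<1}"
    by (rule eventually_at_leftI[of 0]) auto
  ultimately have "\<forall>\<^sub>F t in at_left (1::real). 0 < t \<and> t < 1 \<and> t powr (-\<gamma>) < b"
    by eventually_elim auto
  then show ?thesis using eventually_happens' trivial_limit_at_left_real by blast
qed

text \<open>Eventually \<open>n^t <= n / 2\<close>, so passing from \<open>n\<close> to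
  \<open>n / 2\<close> multiplies the tail by at most the ratio at \<open>n^t\<close>, whose limit
  \<open>t^(-\<gamma>)\<close> is below \<open>2^s\<close> for \<open>t\<close> close to 1. Iterated
  halving then shows that the tail decays more slowly than any power.\<close>

lemma T_lower:
  assumes s: "s > 0"
  shows "\<exists>c>0. \<exists>N>0. \<forall>n\<ge>N. T (real n) \<ge> c * real n powr (- s)"
proof -
  have "2 powr s > 1" using s powr_less_mono[of 0 s 2] by simp
  then obtain t where t: "0 < t" "t < 1" "t powr (-\<gamma>) < 2 powr s"
    using powr_gamma_near_1 by blast
  have "(\<lambda>n. T (real n powr t) / T (real n)) \<longlonglongrightarrow> t powr (-\<gamma>)"
    unfolding T_def using t by (intro tail) auto
  then have "\<forall>\<^sub>F n in sequentially. T (real n powr t) / T (real n) < 2 powr s"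
    using t by (auto intro: order_tendstoD)
  moreover have "\<forall>\<^sub>F n in sequentially. real n powr t / real n < 1/4"
    using powr_minus_one_tendsto_0[OF t(2)] by (rule order_tendstoD) simp
  ultimately have "\<forall>\<^sub>F n in sequentially. T (real (n div 2)) \<le> 2 powr s * T (real n)"
    using eventually_ge_at_top[of 4]
  proof eventually_elim
    case (elim n)
    have "real n powr t \<le> real (n div 2)" using elim by (simp add: divide_less_eq)
    then have "T (real (n div 2)) \<le> T (real n powr t)" by (rule T_antimono)
    also have "\<dots> \<le> 2 powr s * T (real n)" using elim T_pos[of n] by (simp add: pos_divide_less_eq)
    finally show ?case .
  qed
  then obtain N where N: "\<And>n. n \<ge> N \<Longrightarrow> T (real (n div 2)) \<le> 2 powr s * T (real n)"
    by (auto simp: eventually_sequentially)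
  define N' where "N' = max N 1"
  define c where "c = T (real (2 * N'))"
  have "T (real n) \<ge> c * real n powr (- s)" if "n \<ge> N'" for n
    using that
  proof (induction n rule: less_induct)
    case (less n)
    show ?case
    proof (cases "n < 2 * N'")
      case True
      have "real n powr (- s) \<le> real n powr 0" using less.prems s
        by (intro powr_mono) (auto simp: N'_def)
      then have "real n powr (- s) \<le> 1" using less.prems by (simp add: N'_def)
      then have "c * real n powr (- s) \<le> c * 1" by (intro mult_left_mono) (auto simp: c_def T_nonneg)
      also have "\<dots> \<le> T (real n)" unfolding c_def mult_1_right using True by (intro T_antimono) auto
      finally show ?thesis .
    next
      case False
      define m where "m = n div 2"
      have m: "m < n" "m \<ge> N'" "real m \<le> real n / 2" "m > 0" using False less.prems by (auto simp: m_def N'_def)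
      have "c * real n powr (- s) = 2 powr (- s) * (c * (real n / 2) powr (- s))"
        by (simp add: powr_divide powr_minus field_simps)
      also have "\<dots> \<le> 2 powr (- s) * (c * real m powr (- s))"
        using m s by (intro mult_left_mono powr_mono2') (auto simp: c_def T_nonneg)
      also have "\<dots> \<le> 2 powr (- s) * T (real m)" using less.IH[OF m(1,2)] by (intro mult_left_mono) auto
      also have "\<dots> \<le> 2 powr (- s) * (2 powr s * T (real n))"
        using N[of n] less.prems by (intro mult_left_mono) (auto simp: m_def N'_def)
      also have "\<dots> = T (real n)" by (simp add: powr_minus)
      finally show ?thesis .
    qed
  qed
  moreover have "c > 0" "N' > 0" unfolding c_def by (rule T_pos) (simp add: N'_def)
  ultimately show ?thesis by blast
qed

text \<open>\<open>k n\<close> is asymptotically \<open>x / T n\<close>, and \<open>T n\<close> is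
  at least of order \<open>n^(-s/2)\<close>; the other half of the exponent forces the limit
  0.\<close>

lemma k_subpolynomial:
  assumes s: "s > 0"
  shows "(\<lambda>n. real (k n) * real n powr (- s)) \<longlonglongrightarrow> 0"
proof -
  obtain c N where c: "c > 0" "N > 0" "\<And>n. n \<ge> N \<Longrightarrow> T (real n) \<ge> c * real n powr (- (s/2))"
    using T_lower[of "s/2"] s by auto
  have "(\<lambda>n. real (k n) * T (real n) / c * real n powr (- (s/2))) \<longlonglongrightarrow> x / c * 0"
    by (intro tendsto_mult tendsto_divide k_T_limit_1 tendsto_const tendsto_neg_powr filterlim_real_sequentially)
       (use s c in auto)
  then have lim: "(\<lambda>n. real (k n) * T (real n) / c * real n powr (- (s/2))) \<longlonglongrightarrow> 0" by simp
  show ?thesis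
  proof (rule tendsto_sandwich[OF _ _ tendsto_const lim])
    show "\<forall>\<^sub>F n in sequentially. 0 \<le> real (k n) * real n powr (- s)" by simp
    show "\<forall>\<^sub>F n in sequentially. real (k n) * real n powr (- s) \<le> real (k n) * T (real n) / c * real n powr (- (s/2))"
      using eventually_ge_at_top[of N]
    proof eventually_elim
      case (elim n)
      have "real n powr (- s) = real n powr (- (s/2)) * real n powr (- (s/2))"
        by (simp flip: powr_add)
      also have "\<dots> \<le> T (real n) / c * real n powr (- (s/2))"
        using c(3)[OF elim] c(1) by (intro mult_right_mono) (auto simp: field_simps)
      finally have "real (k n) * real n powr (- s) \<le> real (k n) * (T (real n) / c * real n powr (- (s/2)))"
        by (intro mult_left_mono) auto
      then show ?case by simp
    qed
  qed
qed

lemma K_nonneg: "K n \<ge> 0"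
  unfolding K_def by (intro sum_nonneg) auto

lemma K_mono: "m \<le> n \<Longrightarrow> K m \<le> K n"
  unfolding K_def by (intro sum_mono2) auto

lemma prob_between: "y \<le> z \<Longrightarrow> pr p {m. y < real m \<and> real m \<le> z} = T y - T z"
  unfolding T_def by (subst measure_pmf.finite_measure_Diff[symmetric]) (auto intro!: arg_cong[where f = "pr p"])

lemma K_upper:
  assumes t: "0 < t" "t < 1" and n: "n > 0"
  shows "K n \<le> real n powr t + real n * (T (real n powr t) - T (real n))"
proof -
  have le: "real n powr t \<le> real n" using t n powr_mono[of t 1 "real n"] by simp
  have "K n \<le> (\<Sum>i\<le>n. real n powr t * pmf p i + real n * (if real i > real n powr t then pmf p i else 0))"
    unfolding K_def
  proof (intro sum_mono)
    fix i assume "i \<in> {..n}"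
    then have "real i \<le> real n powr t \<or> real i > real n powr t \<and> real i \<le> real n" by auto
    then show "real i * pmf p i \<le> real n powr t * pmf p i + real n * (if real i > real n powr t then pmf p i else 0)"
      by (auto intro: mult_right_mono intro!: add_increasing)
  qed
  also have "\<dots> = real n powr t * pr p {..n} +
      real n * (\<Sum>i\<le>n. if real i > real n powr t then pmf p i else 0)"
    by (simp add: sum.distrib sum_distrib_left measure_measure_pmf_finite)
  also have "(\<Sum>i\<le>n. if real i > real n powr t then pmf p i else 0) =
      pr p {m. real n powr t < real m \<and> real m \<le> real n}"
    by (subst measure_measure_pmf_finite) (auto intro!: finite_subset[of _ "{..n}"] simp: sum.inter_filter[symmetric] intro!: sum.cong)
  also have "\<dots> = T (real n powr t) - T (real n)" by (rule prob_between[OF le])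
  finally show ?thesis
    using mult_left_mono[of "pr p {..n}" 1 "real n powr t"] by simp
qed

text \<open>Splitting the mean at \<open>n^t\<close> bounds the upper limit by
  \<open>x * (t^(-\<gamma>) - 1)\<close>: values up to \<open>n^t\<close> cost
  \<open>k n * n^(t-1)\<close>, which vanishes by \<open>k_subpolynomial\<close>, and larger ones at
  most \<open>n\<close> times the mass between \<open>n^t\<close> and \<open>n\<close>. Letting
  \<open>t\<close> approach 1 finishes the argument.\<close>

lemma k_K_limit: "(\<lambda>n. real (k n) * K n / real n) \<longlonglongrightarrow> 0"
proof (rule order_tendstoI)
  fix a :: real assume "a < 0"
  then have "a < real (k n) * K n / real n" for n
    using K_nonneg[of n] by (meson divide_nonneg_nonneg less_le_trans mult_nonneg_nonneg of_nat_0_le_iff)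
  then show "\<forall>\<^sub>F n in sequentially. a < real (k n) * K n / real n" by simp
next
  fix a :: real assume a: "a > 0"
  then have "1 + a / x > 1" using x_pos by simp
  then obtain t where t: "0 < t" "t < 1" "t powr (-\<gamma>) < 1 + a / x"
    using powr_gamma_near_1 by blast
  have "(\<lambda>n. real (k n) * real n powr (- (1 - t)) + (real (k n) * T (real n powr t) - real (k n) * T (real n)))
      \<longlonglongrightarrow> 0 + (x * t powr (-\<gamma>) - x)"
    using t by (intro tendsto_add tendsto_diff k_subpolynomial k_T_limit k_T_limit_1) auto
  moreover have "x * t powr (-\<gamma>) < x * (1 + a / x)" using t x_pos by (intro mult_strict_left_mono)
  then have "0 + (x * t powr (-\<gamma>) - x) < a" using x_pos by (simp add: distrib_left)
  ultimately have "\<forall>\<^sub>F n in sequentially. real (k n) * real n powr (- (1 - t)) +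
      (real (k n) * T (real n powr t) - real (k n) * T (real n)) < a"
    by (rule order_tendstoD)
  then show "\<forall>\<^sub>F n in sequentially. real (k n) * K n / real n < a"
    using eventually_gt_at_top[of 0]
  proof eventually_elim
    case (elim n)
    have "real (k n) * K n / real n \<le> real (k n) * (real n powr t + real n * (T (real n powr t) - T (real n))) / real n"
      using K_upper[OF t(1,2) elim(2)] by (intro divide_right_mono mult_left_mono) auto
    also have "\<dots> = real (k n) * real n powr (- (1 - t)) +
      (real (k n) * T (real n powr t) - real (k n) * T (real n))"
      using elim by (simp add: powr_diff field_simps)
    finally show ?case using elim by simp
  qed
qed

section \<open>Large deviations of the remaining summands\<close>

abbreviation rest :: "nat \<Rightarrow> nat list pmf" where
  "rest n \<equiv> replicate_pmf (k n - 1) p"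

text \<open>Only \<open>k n * K n = o(n)\<close> is needed below: by monotonicity of \<open>K\<close> the same bound serves every
  truncation level \<open>m \<le> n\<close>, with the exponential parameter of order \<open>a / m\<close>.\<close>

lemma chernoff_rest:
  fixes y :: real
  assumes s: "s \<ge> 0" and m: "m \<le> n" "s * real m \<le> a"
  shows "pr (rest n) (trunc_tail y m)
    \<le> exp (s * exp a * (real (k n) * K n) - s * y)"
proof -
  have "real (k n - 1) * (s * exp (s * real m) * K m) \<le> real (k n) * (s * exp a * K n)"
    using s m K_nonneg by (intro mult_mono K_mono) auto
  then show ?thesis
    using order_trans[OF chernoff_truncated[OF s, where k = "k n - 1" and p = p and y = y and m = m]] by (simp add: K_def mult_ac)
qed

text \<open>With \<open>s = a / n\<close> the Chernoff exponent tends to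
  \<open>- a * \<epsilon>\<close>, and \<open>a\<close> is at free disposal.\<close>

lemma truncated_sum_small:
  assumes e: "\<epsilon> > 0"
  shows "(\<lambda>n. pr (rest n) (trunc_tail (\<epsilon> * real n) n)) \<longlonglongrightarrow> 0"
    (is "?f \<longlonglongrightarrow> 0")
proof (rule order_tendstoI)
  fix b :: real assume "b < 0"
  then show "\<forall>\<^sub>F n in sequentially. b < ?f n"
    by (intro always_eventually allI) (rule less_le_trans[OF _ measure_nonneg])
next
  fix b :: real assume b: "b > 0"
  define a where "a = max 0 ((1 - ln b) / \<epsilon>)"
  have a: "a \<ge> 0" "exp (- (a * \<epsilon>)) < b"
  proof -
    have "(1 - ln b) / \<epsilon> \<le> a" by (simp add: a_def)
    then have "- (a * \<epsilon>) < ln b" using e by (simp add: field_simps)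
    then show "exp (- (a * \<epsilon>)) < b" using b by (metis exp_less_cancel_iff exp_ln)
  qed (simp add: a_def)
  have "(\<lambda>n. exp (a * exp a * (real (k n) * K n / real n) - a * \<epsilon>)) \<longlonglongrightarrow> exp (a * exp a * 0 - a * \<epsilon>)"
    by (intro tendsto_intros k_K_limit)
  then have "\<forall>\<^sub>F n in sequentially. exp (a * exp a * (real (k n) * K n / real n) - a * \<epsilon>) < b"
    by (rule order_tendstoD) (use a in simp)
  then show "\<forall>\<^sub>F n in sequentially. ?f n < b"
    using eventually_gt_at_top[of 0]
  proof eventually_elim
    case (elim n)
    have "?f n \<le> exp (a / real n * exp a * (real (k n) * K n) - a / real n * (\<epsilon> * real n))"
      using a elim by (intro chernoff_rest) auto
    also have "\<dots> = exp (a * exp a * (real (k n) * K n / real n) - a * \<epsilon>)"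
      using elim by simp
    finally show ?case using elim by simp
  qed
qed

text \<open>The exponents to come are proportional to \<open>2^j\<close>, so a cubic bound gives
  decay \<open>8^(-j)\<close> against the weight \<open>4^j\<close>. It follows from
  \<open>(1 + y / 3)^3 <= exp y\<close>.\<close>

lemma exp_minus_le_cubic:
  assumes "y > (0::real)"
  shows "exp (- y) \<le> 27 / y ^ 3"
proof -
  have "(y / 3) ^ 3 \<le> (1 + y / 3) ^ 3" using assms by (intro power_mono) auto
  also have "\<dots> \<le> exp y" using exp_ge_one_plus_x_over_n_power_n[of 3 y] assms by simp
  finally have "y ^ 3 / 27 \<le> exp y" by (simp add: power_divide)
  then show ?thesis using assms by (simp add: exp_minus field_simps)
qed

lemma dyadic_blocks_small:
  "(\<lambda>n. \<Sum>j=1..n. 8 * 4 ^ j * pr (rest n)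
      (trunc_tail (real n - real n / 2 ^ j) (n div 2 ^ j))) \<longlonglongrightarrow> 0"
    (is "?f \<longlonglongrightarrow> 0")
proof (rule order_tendstoI)
  fix b :: real assume "b < 0"
  then show "\<forall>\<^sub>F n in sequentially. b < ?f n"
    by (intro always_eventually allI) (rule less_le_trans, assumption, intro sum_nonneg, simp)
next
  fix b :: real assume b: "b > 0"
  \<comment> \<open>13824 is \<open>8 * 27 * 4^3\<close>: the weight 8, the constant of the cubic
    bound, and the cube of the 4 dividing the exponent. Taking 13825 makes the inequality strict,
    and \<open>a >= 1\<close> gives \<open>a <= a^3\<close>.\<close>
  define a where "a = max 1 (13825 / b)"
  have a: "a \<ge> 1" "13824 / a ^ 3 < b"
  proof -
    have "13825 / b \<le> a" by (simp add: a_def)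
    then have ab: "13824 < a * b" using b by (simp add: field_simps)
    have "a ^ 1 \<le> a ^ 3" by (rule power_increasing) (auto simp: a_def)
    then have "a * b \<le> a ^ 3 * b" using b by (intro mult_right_mono) auto
    then have "13824 < b * a ^ 3" using ab by (simp add: mult.commute)
    moreover have "a ^ 3 > 0" by (simp add: a_def)
    ultimately show "13824 / a ^ 3 < b" by (simp add: pos_divide_less_eq)
  qed (simp add: a_def)
  have "(\<lambda>n. exp a * (real (k n) * K n / real n)) \<longlonglongrightarrow> exp a * 0"
    by (intro tendsto_intros k_K_limit)
  then have "\<forall>\<^sub>F n in sequentially. exp a * (real (k n) * K n / real n) < 1/4"
    by (rule order_tendstoD) simp
  then show "\<forall>\<^sub>F n in sequentially. ?f n < b"
    using eventually_gt_at_top[of 0]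
  proof eventually_elim
    case (elim n)
    have "?f n \<le> (\<Sum>j=1..n. 13824 / a ^ 3 * (1 / 2) ^ j)"
    proof (intro sum_mono)
      fix j assume j: "j \<in> {1..n}"
      \<comment> \<open>The truncation level is at most \<open>n / 2^j\<close>, so this
        \<open>s\<close> keeps its product with the level below \<open>a\<close>. The exponent is
        then at most \<open>a * 2^j / 4 - a * (2^j - 1)\<close>, and \<open>2^j >= 2\<close> bounds
        it by \<open>- a * 2^j / 4\<close>.\<close>
      define s where "s = a * 2 ^ j / real n"
      define y where "y = real n - real n / 2 ^ j"
      have "real (n div 2 ^ j) \<le> real n / 2 ^ j" using of_nat_div_le_of_nat[of n "2 ^ j", where 'a = real] by simp
      then have "s * real (n div 2 ^ j) \<le> s * (real n / 2 ^ j)" using a by (intro mult_left_mono) (auto simp: s_def)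
      also have "\<dots> = a" using elim by (simp add: s_def)
      finally have "pr (rest n) (trunc_tail y (n div 2 ^ j))
          \<le> exp (s * exp a * (real (k n) * K n) - s * y)"
        using a by (intro chernoff_rest) (auto simp: s_def)
      also have "s * exp a * (real (k n) * K n) - s * y = a * 2 ^ j * (exp a * (real (k n) * K n / real n)) - a * (2 ^ j - 1)"
        using elim by (simp add: s_def y_def field_simps)
      also have "exp (a * 2 ^ j * (exp a * (real (k n) * K n / real n)) - a * (2 ^ j - 1)) \<le>
          exp (a * 2 ^ j * (1/4) - a * (2 ^ j - 1))"
        unfolding exp_le_cancel_iff using elim a by (intro diff_right_mono mult_left_mono) auto
      also have "\<dots> \<le> exp (- (a * 2 ^ j / 4))"
      proof -
        have "(2::real) ^ 1 \<le> 2 ^ j" using j by (intro power_increasing) auto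
        then have "a * 2 \<le> a * 2 ^ j" using a by (intro mult_left_mono) auto
        then show ?thesis by (simp add: algebra_simps)
      qed
      also have "\<dots> \<le> 27 / (a * 2 ^ j / 4) ^ 3"
        using a by (intro exp_minus_le_cubic) auto
      also have "\<dots> = 1728 / a ^ 3 * (1 / 8) ^ j"
      proof -
        have "(2 ^ j) ^ 3 = ((2::real) ^ 3) ^ j" by (simp only: power_mult[symmetric] mult.commute)
        then have "(2 ^ j) ^ 3 = (8::real) ^ j" by simp
        then show ?thesis using a by (simp add: power_divide power_mult_distrib)
      qed
      finally have "8 * 4 ^ j * pr (rest n) (trunc_tail y (n div 2 ^ j))
          \<le> 8 * 4 ^ j * (1728 / a ^ 3 * (1 / 8) ^ j)" by (intro mult_left_mono) auto
      also have "\<dots> = 13824 / a ^ 3 * (4 * (1 / 8)) ^ j" unfolding power_mult_distrib by simp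
      finally show "8 * 4 ^ j * pr (rest n) (trunc_tail (real n - real n / 2 ^ j) (n div 2 ^ j))
          \<le> 13824 / a ^ 3 * (1 / 2) ^ j" by (simp add: y_def)
    qed
    also have "\<dots> = 13824 / a ^ 3 * (\<Sum>j=1..n. (1 / 2) ^ j)" by (simp add: sum_distrib_left)
    also have "\<dots> \<le> 13824 / a ^ 3 * 1"
    proof (intro mult_left_mono)
      have "(\<Sum>j=1..n. (1 / 2 :: real) ^ j) = 1 - (1/2) ^ n" by (induction n) (auto simp: field_simps)
      then show "(\<Sum>j=1..n. (1 / 2 :: real) ^ j) \<le> 1" by simp
    qed (use a in auto)
    finally show ?case using a by simp
  qed
qed

end

section \<open>Asymptotics of the event that the sum equals n\<close>

locale local_big_jump = log_regular_tail +
  assumes local_ratio: "\<And>e. e > 0 \<Longrightarrow> \<exists>N>0. \<forall>n\<ge>N. \<forall>m. n \<le> 2 * m \<and> m \<le> n \<longrightarrow>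
    pmf p n > 0 \<and> \<bar>(real m * pmf p m) / (real n * pmf p n) - 1\<bar> < e"
begin

lemma pmf_pos: "\<forall>\<^sub>F n in sequentially. pmf p n > 0"
proof -
  obtain N where N: "\<And>n m. n \<ge> N \<Longrightarrow> n \<le> 2 * m \<and> m \<le> n \<Longrightarrow> pmf p n > 0"
    using local_ratio[OF zero_less_one] by blast
  have "pmf p n > 0" if "n \<ge> N" for n using N[of n n] that by simp
  then show ?thesis
    unfolding eventually_sequentially by (intro exI[of _ N]) auto
qed

text \<open>A value with \<open>n <= k n * a\<close> is at least \<open>n / k n\<close>, which tends
  to infinity because \<open>k\<close> grows subpolynomially; so \<open>a\<close> finally lies in
  the range where the Potter bound holds.\<close>

lemma pmf_far:
  "\<forall>\<^sub>F n in sequentially. \<forall>a. n \<le> k n * a \<and> a \<le> n \<longrightarrow> pmf p a \<le> 2 * (real n / real a)\<^sup>2 * pmf p n"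
proof -
  obtain N where N: "\<And>n m. n \<ge> N \<Longrightarrow> n \<le> 2 * m \<Longrightarrow> m \<le> n \<Longrightarrow>
    pmf p n > 0 \<and> \<bar>(real m * pmf p m) / (real n * pmf p n) - 1\<bar> < 1/4"
    using local_ratio[of "1/4"] by fastforce
  define M where "M = max 2 N"
  have "\<forall>\<^sub>F n in sequentially. real (k n) * real n powr (- 1) < 1 / real M"
    using k_subpolynomial[of 1] by (rule order_tendstoD) (auto simp: M_def)
  then show ?thesis
    using eventually_gt_at_top[of 0]
  proof eventually_elim
    case (elim n)
    show ?case
    proof (intro allI impI)
      fix a assume a: "n \<le> k n * a \<and> a \<le> n"
      have "real (k n) / real n < 1 / real M" using elim by (simp add: powr_minus divide_inverse)
      moreover have "real n \<le> real (k n * a)" using a by (simp only: of_nat_le_iff)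
      then have "1 \<le> real (k n) / real n * real a" using elim by (simp add: field_simps)
      ultimately have "1 \<le> 1 / real M * real a"
        by (meson less_imp_le mult_right_mono of_nat_0_le_iff order_trans)
      then have "M \<le> a" by (simp add: M_def field_simps)
      then show "pmf p a \<le> 2 * (real n / real a)\<^sup>2 * pmf p n"
        using a N by (intro potter_quadratic[where N = M]) (auto simp: M_def)
    qed
  qed
qed

lemma pmf_near:
  assumes eta: "\<eta> > 0"
  shows "\<exists>\<epsilon>. 0 < \<epsilon> \<and> \<epsilon> < 1/2 \<and> (\<forall>\<^sub>F n in sequentially. \<forall>a. (1 - \<epsilon>) * real n \<le> real a \<and> a \<le> n \<longrightarrow>
    (1 - \<eta>) * pmf p n \<le> pmf p a \<and> pmf p a \<le> (1 + \<eta>) * pmf p n)"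
proof -
  \<comment> \<open>For \<open>e <= 1/4\<close> one has
    \<open>(1 + e) / (1 - e) <= 1 + 4 * e\<close>, hence the division of \<open>\<eta>\<close> by
    4.\<close>
  define e where "e = min (1/4) (\<eta> / 4)"
  have e: "0 < e" "e \<le> 1/4" "4 * e \<le> \<eta>" using eta by (auto simp: e_def)
  obtain N where N: "N > 0" "\<And>n m. n \<ge> N \<Longrightarrow> n \<le> 2 * m \<Longrightarrow> m \<le> n \<Longrightarrow>
    pmf p n > 0 \<and> \<bar>(real m * pmf p m) / (real n * pmf p n) - 1\<bar> < e"
    using local_ratio[OF e(1)] by force
  show ?thesis
  proof (intro exI[of _ e] conjI)
    show "\<forall>\<^sub>F n in sequentially. \<forall>a. (1 - e) * real n \<le> real a \<and> a \<le> n \<longrightarrow>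
        (1 - \<eta>) * pmf p n \<le> pmf p a \<and> pmf p a \<le> (1 + \<eta>) * pmf p n"
      using eventually_ge_at_top[of N]
    proof eventually_elim
      case (elim n)
      show ?case
      proof (intro allI impI)
        fix a assume a: "(1 - e) * real n \<le> real a \<and> a \<le> n"
        have n0: "real n > 0" using elim N by simp
        have "real n / 2 \<le> (1 - e) * real n" using e n0 by (simp add: field_simps)
        then have "n \<le> 2 * a" using a by linarith
        then have r: "pmf p n > 0" "\<bar>(real a * pmf p a) / (real n * pmf p n) - 1\<bar> < e"
          using N(2)[OF elim] a by auto
        define r where "r = pmf p a / pmf p n"
        define u where "u = real a / real n"
        have u: "1 - e \<le> u" "u \<le> 1" using a n0 by (auto simp: u_def field_simps)
        have ur: "u * r > 1 - e" "u * r < 1 + e"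
          using r(2) by (auto simp: u_def r_def abs_less_iff)
        have r0: "r \<ge> 0" by (simp add: r_def)
        have "u * r \<le> 1 * r" using u r0 by (intro mult_right_mono)
        then have "r \<ge> 1 - \<eta>" using ur e by linarith
        moreover have "r \<le> 1 + \<eta>"
        proof -
          have "(1 - e) * r \<le> u * r" using u r0 by (intro mult_right_mono)
          then have "(1 - e) * r < 1 + e" using ur by linarith
          also have "\<dots> \<le> (1 - e) * (1 + 4 * e)"
          proof -
            have "4 * e * e \<le> 1 * e" using e by (intro mult_right_mono) auto
            then show ?thesis using e by (simp add: algebra_simps)
          qed
          finally have "r < 1 + 4 * e" using e by simp
          then show ?thesis using e by linarith
        qed
        ultimately show "(1 - \<eta>) * pmf p n \<le> pmf p a \<and> pmf p a \<le> (1 + \<eta>) * pmf p n"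
          using r(1) by (simp add: r_def pos_le_divide_eq pos_divide_le_eq)
      qed
    qed
  qed (use e in auto)
qed

lemma rest_all_small_limit:
  "(\<lambda>n. pr (rest n) {xs. \<forall>x\<in>set xs. x \<le> n}) \<longlonglongrightarrow> exp (- x)"
proof -
  have eq: "pr p {..n} = 1 - T (real n)" for n
  proof -
    have "pr p {..n} + T (real n) = pr p ({..n} \<union> {m. real m > real n})"
      unfolding T_def by (intro measure_pmf.finite_measure_Union[symmetric]) auto
    also have "{..n} \<union> {m. real m > real n} = UNIV" by auto
    finally show ?thesis by simp
  qed
  have "(\<lambda>n. real (k n) * T (real n) - T (real n)) \<longlonglongrightarrow> x - 0"
    by (intro tendsto_diff k_T_limit_1 T_tendsto_0)
  moreover have "real (k n) * T (real n) - T (real n) = real (k n - 1) * (1 - (1 - T (real n)))" for n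
    using k_pos[of n] by (simp add: of_nat_diff left_diff_distrib)
  ultimately have "(\<lambda>n. (1 - T (real n)) ^ (k n - 1)) \<longlonglongrightarrow> exp (- x)"
    by (intro power_tendsto_exp) (use tendsto_diff[OF tendsto_const[of 1] T_tendsto_0] in auto)
  moreover have "pr (rest n) {xs. \<forall>x\<in>set xs. x \<le> n} = (1 - T (real n)) ^ (k n - 1)" for n
    using prob_replicate_all[of "k n - 1" p "{..n}"] by (simp add: eq)
  ultimately show ?thesis by simp
qed

lemma prob_sum_eq_upper_asymp:
  assumes d: "\<delta> > 0"
  shows "\<forall>\<^sub>F n in sequentially. pr (replicate_pmf (k n) p) {xs. sum_list xs = n} \<le>
    real (k n) * pmf p n * (exp (- x) + \<delta>)"
proof -
  define \<eta> where "\<eta> = \<delta> / 2"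
  have eta: "\<eta> > 0" using d by (simp add: \<eta>_def)
  obtain \<epsilon> where e: "0 < \<epsilon>" "\<epsilon> < 1/2" and near: "\<forall>\<^sub>F n in sequentially. \<forall>a. (1 - \<epsilon>) * real n \<le> real a \<and> a \<le> n \<longrightarrow>
    (1 - \<eta>) * pmf p n \<le> pmf p a \<and> pmf p a \<le> (1 + \<eta>) * pmf p n"
    using pmf_near[OF eta] by auto
  define U where "U n = (1 + \<eta>) * pr (rest n) {xs. \<forall>x\<in>set xs. x \<le> n}
      + 8 * pr (rest n) (trunc_tail (\<epsilon> * n) n)
      + (\<Sum>j=1..n. 8 * 4 ^ j * pr (rest n)
          (trunc_tail (real n - real n / 2 ^ j) (n div 2 ^ j)))" for n
  have "U \<longlonglongrightarrow> (1 + \<eta>) * exp (- x) + 8 * 0 + 0"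
    unfolding U_def
    by (intro tendsto_add tendsto_mult tendsto_const rest_all_small_limit truncated_sum_small[OF e(1)] dyadic_blocks_small)
  moreover have "\<eta> * exp (- x) \<le> \<eta> * 1" using eta x_pos by (intro mult_left_mono) auto
  then have "exp (- x) + \<eta> * exp (- x) < exp (- x) + \<delta>"
    using d by (simp only: \<eta>_def)
  then have "(1 + \<eta>) * exp (- x) + 8 * 0 + 0 < exp (- x) + \<delta>"
    by (simp only: distrib_right mult_1 mult_zero_right add_0_right)
  ultimately have "\<forall>\<^sub>F n in sequentially. U n < exp (- x) + \<delta>" by (rule order_tendstoD)
  then show ?thesis
    using near pmf_far eventually_gt_at_top[of 0]
  proof eventually_elim
    case (elim n)
    have "pr (replicate_pmf (k n) p) {xs. sum_list xs = n} \<le> real (k n) * pmf p n * U n"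
      unfolding U_def using elim e eta k_pos by (intro prob_sum_eq_upper) auto
    also have "\<dots> \<le> real (k n) * pmf p n * (exp (- x) + \<delta>)"
      using elim by (intro mult_left_mono) auto
    finally show ?case .
  qed
qed

text \<open>\<open>prob_sum_eq_lower\<close> misses only lists with entries up to \<open>n\<close>
  whose sum is at least \<open>\<epsilon> * n\<close>. The probability of these does not involve
  \<open>E\<close>, so the threshold for \<open>n\<close> is uniform in \<open>E\<close>. Half of
  \<open>\<delta>\<close> pays for them, the other half for the factor
  \<open>1 - \<eta>\<close>.\<close>

lemma prob_sum_eq_lower_asymp:
  assumes d: "\<delta> > 0"
  shows "\<forall>\<^sub>F n in sequentially. \<forall>E. real (k n) * pmf p n *
      (pr (rest n) {xs. E (mset xs) \<and> (\<forall>x\<in>set xs. x \<le> n)} - \<delta>) \<le>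
    pr (replicate_pmf (k n) p) {xs. sum_list xs = n \<and> E (mset (delete_first_max xs))}"
proof -
  define \<eta> where "\<eta> = min 1 (\<delta> / 2)"
  have eta: "\<eta> > 0" "\<eta> \<le> 1" "\<eta> \<le> \<delta> / 2" using d by (auto simp: \<eta>_def)
  obtain \<epsilon> where e: "0 < \<epsilon>" "\<epsilon> < 1/2" and near: "\<forall>\<^sub>F n in sequentially. \<forall>a. (1 - \<epsilon>) * real n \<le> real a \<and> a \<le> n \<longrightarrow>
    (1 - \<eta>) * pmf p n \<le> pmf p a \<and> pmf p a \<le> (1 + \<eta>) * pmf p n"
    using pmf_near[OF eta(1)] by auto
  have "\<forall>\<^sub>F n in sequentially. pr (rest n) (trunc_tail (\<epsilon> * n) n) < \<delta> / 2"
    using truncated_sum_small[OF e(1)] by (rule order_tendstoD) (use d in simp)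
  then show ?thesis
    using near eventually_gt_at_top[of 0]
  proof eventually_elim
    case (elim n)
    show ?case
    proof
      fix E :: "nat multiset \<Rightarrow> bool"
      define a where "a = pr (rest n) {xs. E (mset xs) \<and> (\<forall>x\<in>set xs. x \<le> n)}"
      define b where "b = pr (rest n) {xs. E (mset xs) \<and> real (sum_list xs) \<le> \<epsilon> * n}"
      define c where "c = pr (rest n) (trunc_tail (\<epsilon> * n) n)"
      have "a \<le> pr (rest n) ({xs. E (mset xs) \<and> real (sum_list xs) \<le> \<epsilon> * n} \<union>
          (trunc_tail (\<epsilon> * n) n))"
        unfolding a_def by (intro measure_pmf.finite_measure_mono) auto
      also have "\<dots> \<le> b + c"
        unfolding b_def c_def by (intro measure_Un_le) auto
      finally have "a \<le> b + c" .
      moreover have "c < \<delta> / 2" using elim by (simp add: c_def)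
      moreover have "\<eta> * b \<le> \<eta> * 1" using eta unfolding b_def by (intro mult_left_mono) auto
      moreover have "(1 - \<eta>) * b = b - \<eta> * b" by (simp add: left_diff_distrib)
      ultimately have "a - \<delta> \<le> (1 - \<eta>) * b" using eta by linarith
      then have "real (k n) * pmf p n * (a - \<delta>) \<le> real (k n) * pmf p n * ((1 - \<eta>) * b)"
        by (intro mult_left_mono) auto
      also have "\<dots> = real (k n) * pmf p n * (1 - \<eta>) * b" by simp
      also have "\<dots> \<le> pr (replicate_pmf (k n) p) {xs. sum_list xs = n \<and> E (mset (delete_first_max xs))}"
        unfolding b_def using elim e eta by (intro prob_sum_eq_lower) auto
      finally show "real (k n) * pmf p n * (pr (rest n) {xs. E (mset xs) \<and> (\<forall>x\<in>set xs. x \<le> n)} - \<delta>) \<le>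
        pr (replicate_pmf (k n) p) {xs. sum_list xs = n \<and> E (mset (delete_first_max xs))}"
        unfolding a_def .
    qed
  qed
qed

text \<open>The deficit of label 0 includes values above \<open>n\<close>, so the exponent is the
  full \<open>x * thr d 0 powr (-\<gamma>)\<close>; the correction by \<open>x\<close> is left to
  the conditioning. Replacing \<open>k\<close> by \<open>k - 1\<close> costs one tail probability,
  which vanishes.\<close>

lemma rest_labels_limit:
  assumes len: "length v = d"
  shows "(\<lambda>n. pr (rest n) {xs. image_mset (lab d n) (mset xs) = label_mset (k n - 1) v}) \<longlonglongrightarrow>
    exp (- (x * thr d 0 powr (-\<gamma>))) *
    (\<Prod>i<d. (x * (thr d i powr (-\<gamma>) - thr d (Suc i) powr (-\<gamma>))) ^ (v ! i) / fact (v ! i))"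
proof -
  define q where "q n = map_pmf (lab d n) p" for n
  have q0: "1 - pmf (q n) 0 = T (real n powr thr d 0)" if "n \<ge> 1" for n
  proof -
    have "1 - pmf (q n) 0 = pr p (- (lab d n -` {0}))"
      using measure_pmf.prob_compl[of "lab d n -` {0}" p] by (simp add: q_def pmf_map Compl_eq_Diff_UNIV)
    also have "- (lab d n -` {0}) = {m. real m > real n powr thr d 0}"
      using that by (auto simp: lab_0_iff)
    finally show ?thesis by (simp add: T_def)
  qed
  have qS: "pmf (q n) (Suc i) = T (real n powr thr d i) - T (real n powr thr d (Suc i))" if "n \<ge> 1" "i < d" for n i
  proof -
    have "pmf (q n) (Suc i) = pr p (lab d n -` {Suc i})"
      by (simp add: q_def pmf_map)
    also have "lab d n -` {Suc i} = {m. real n powr thr d i < real m \<and> real m \<le> real n powr thr d (Suc i)}"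
      using that by (auto simp: lab_Suc_iff)
    finally show ?thesis
      using that thr_less_Suc[of d i] by (simp add: prob_between powr_mono)
  qed
  have lim: "(\<lambda>n. real (k n - 1) * T (real n powr t)) \<longlonglongrightarrow> x * t powr (-\<gamma>)" if t: "0 < t" "t \<le> 1" for t
  proof -
    have "(\<lambda>n. T (real n powr t)) \<longlonglongrightarrow> 0"
    proof -
      have "(\<lambda>n. real (k n) * T (real n powr t) * inverse (real (k n))) \<longlonglongrightarrow> x * t powr (-\<gamma>) * 0"
        by (intro tendsto_mult k_T_limit t tendsto_inverse_0_at_top filterlim_compose[OF filterlim_real_sequentially k_at_top])
      then show ?thesis using k_pos by (simp add: field_simps)
    qed
    from tendsto_diff[OF k_T_limit[OF t] this] show ?thesis
      using k_pos by (simp add: of_nat_diff Suc_leI left_diff_distrib)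
  qed
  have "(\<lambda>n. pr (replicate_pmf (k n - 1) (q n)) {xs. mset xs = label_mset (k n - 1) v}) \<longlonglongrightarrow>
     exp (- (x * thr d 0 powr (-\<gamma>))) *
     (\<Prod>i<length v. (x * thr d i powr (-\<gamma>) - x * thr d (Suc i) powr (-\<gamma>)) ^ (v ! i) / fact (v ! i))"
  proof (rule multinomial_poisson_limit)
    show "filterlim (\<lambda>n. k n - 1) at_top sequentially"
      using filterlim_compose[OF filterlim_minus_const_nat_at_top k_at_top] by simp
    show "(\<lambda>n. real (k n - 1) * (1 - pmf (q n) 0)) \<longlonglongrightarrow> x * thr d 0 powr - \<gamma>"
      by (rule Lim_transform_eventually[OF lim[OF thr_pos thr_le_1]])
         (use eventually_ge_at_top[of 1] in \<open>simp, eventually_elim, simp add: q0\<close>)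
    fix i assume "i < length v"
    then have i: "i < d" using len by simp
    have "(\<lambda>n. real (k n - 1) * T (real n powr thr d i) - real (k n - 1) * T (real n powr thr d (Suc i))) \<longlonglongrightarrow>
        x * thr d i powr - \<gamma> - x * thr d (Suc i) powr - \<gamma>"
      using i by (intro tendsto_diff lim thr_pos thr_le_1) auto
    then show "(\<lambda>n. real (k n - 1) * pmf (q n) (Suc i)) \<longlonglongrightarrow> x * thr d i powr - \<gamma> - x * thr d (Suc i) powr - \<gamma>"
      by (rule Lim_transform_eventually)
         (use eventually_ge_at_top[of 1] in \<open>eventually_elim, simp add: qS i right_diff_distrib\<close>)
  qed
  moreover have "pr (replicate_pmf (k n - 1) (q n)) {xs. mset xs = label_mset (k n - 1) v} =
      pr (rest n) {xs. image_mset (lab d n) (mset xs) = label_mset (k n - 1) v}" for n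
    by (simp add: q_def vimage_def flip: map_replicate_pmf)
  ultimately show ?thesis by (simp add: len right_diff_distrib)
qed

lemma sum_eq_prob_pos:
  "\<forall>\<^sub>F n in sequentially. pr (replicate_pmf (k n) p) {xs. sum_list xs = n} > 0"
proof -
  define b where "b = exp (- x) / 2"
  have b: "b > 0" "b < exp (- x)" by (simp_all add: b_def)
  have "\<forall>\<^sub>F n in sequentially. b < pr (rest n) {xs. \<forall>x\<in>set xs. x \<le> n}"
    using rest_all_small_limit b(2) by (rule order_tendstoD)
  with prob_sum_eq_lower_asymp[OF b(1)] pmf_pos show ?thesis
  proof eventually_elim
    case (elim n)
    have "0 < real (k n) * pmf p n * (pr (rest n) {xs. \<forall>x\<in>set xs. x \<le> n} - b)"
      using elim k_pos[of n] by simp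
    also have "\<dots> \<le> pr (replicate_pmf (k n) p) {xs. sum_list xs = n}"
      using elim(1)[rule_format, of "\<lambda>_. True"] by simp
    finally show ?case .
  qed
qed

text \<open>Dividing the lower bound for the joint event by the upper bound for the sum cancels
  \<open>k n * pmf p n\<close> and turns \<open>exp (- x)\<close> into the factor
  \<open>exp x\<close>.\<close>

lemma level_lower_bound:
  assumes len: "length v = d" and \<delta>: "\<delta> > 0"
  shows "\<forall>\<^sub>F n in sequentially.
    exp (x - x * thr d 0 powr (-\<gamma>)) *
    (\<Prod>i<d. (x * (thr d i powr (-\<gamma>) - thr d (Suc i) powr (-\<gamma>))) ^ (v ! i) / fact (v ! i)) - \<delta> \<le>
    pr (cond_pmf (replicate_pmf (k n) p) {xs. sum_list xs = n})
      {xs. level d (log_pp n (delete_first_max xs)) = v}"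
proof -
  define b where "b = exp (- (x * thr d 0 powr (-\<gamma>))) *
    (\<Prod>i<d. (x * (thr d i powr (-\<gamma>) - thr d (Suc i) powr (-\<gamma>))) ^ (v ! i) / fact (v ! i))"
  have "thr d (Suc i) powr (-\<gamma>) \<le> thr d i powr (-\<gamma>)" for i
    using thr_less_Suc[of d i] thr_pos[of d i] gamma_nonneg by (intro powr_mono2') auto
  then have b0: "b \<ge> 0"
    unfolding b_def using x_pos by (intro mult_nonneg_nonneg prod_nonneg ballI divide_nonneg_nonneg zero_le_power) auto
  \<comment> \<open>\<open>\<eta>\<close> is lost twice in the numerator, in the label limit and in
    the joint lower bound, and once in the denominator. The \<open>max\<close> keeps the numerator
    nonnegative, as the comparison of fractions requires.\<close>
  have "((\<lambda>\<eta>. max 0 (b - 2 * \<eta>) / (exp (- x) + \<eta>)) \<longlongrightarrow> max 0 (b - 2 * 0) / (exp (- x) + 0)) (at_right 0)"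
    by (intro tendsto_intros) auto
  moreover have "max 0 (b - 2 * 0) / (exp (- x) + 0) > exp x * b - \<delta>"
    using b0 \<delta> by (simp add: exp_minus field_simps)
  ultimately have "\<forall>\<^sub>F \<eta> in at_right 0. max 0 (b - 2 * \<eta>) / (exp (- x) + \<eta>) > exp x * b - \<delta>"
    by (rule order_tendstoD)
  then have "\<forall>\<^sub>F \<eta> in at_right 0. max 0 (b - 2 * \<eta>) / (exp (- x) + \<eta>) > exp x * b - \<delta> \<and> \<eta> > 0"
    using eventually_at_right_less[of 0] by eventually_elim auto
  then obtain \<eta> where eta: "\<eta> > 0" "max 0 (b - 2 * \<eta>) / (exp (- x) + \<eta>) > exp x * b - \<delta>"
    using eventually_happens'[of "at_right (0::real)"] by force
  have "\<forall>\<^sub>F n in sequentially. b - \<eta> <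
      pr (rest n) {xs. image_mset (lab d n) (mset xs) = label_mset (k n - 1) v}"
    by (rule order_tendstoD(1)[OF rest_labels_limit[OF len]]) (use eta in \<open>simp add: b_def\<close>)
  with prob_sum_eq_lower_asymp[OF eta(1)] prob_sum_eq_upper_asymp[OF eta(1)] sum_eq_prob_pos pmf_pos
    eventually_ge_at_top[of 2]
  show ?thesis
  proof eventually_elim
    case (elim n)
    define P where "P = replicate_pmf (k n) p"
    define S where "S = {xs. sum_list xs = n}"
    define E where "E M \<longleftrightarrow> image_mset (lab d n) M = label_mset (k n - 1) v" for M
    define C where "C = real (k n) * pmf p n"
    have C: "C > 0" using elim k_pos[of n] by (simp add: C_def)
    have ne: "set_pmf P \<inter> S \<noteq> {}"
    proof
      assume "set_pmf P \<inter> S = {}"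
      then have "pr P S = 0" by (simp add: measure_pmf_zero_iff)
      then show False using elim by (simp add: P_def S_def)
    qed
    have E_small: "{xs. E (mset xs) \<and> (\<forall>x\<in>set xs. x \<le> n)} = {xs. E (mset xs)}"
      using level_of_label_mset(2)[OF \<open>n \<ge> 2\<close> _ len] by (auto simp: E_def)
    have "C * (b - 2 * \<eta>) \<le> C * (pr (rest n) {xs. E (mset xs)} - \<eta>)"
      using elim C by (intro mult_left_mono) (auto simp: E_def)
    also have "\<dots> \<le> pr P {xs. sum_list xs = n \<and> E (mset (delete_first_max xs))}"
      using elim(1)[rule_format, of E] unfolding E_small by (simp add: C_def P_def)
    also have "\<dots> \<le> pr P ({xs. level d (log_pp n (delete_first_max xs)) = v} \<inter> S)"
      using level_of_label_mset(1)[OF \<open>n \<ge> 2\<close> _ len]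
      by (intro measure_pmf.finite_measure_mono) (auto simp: E_def S_def)
    finally have num: "C * max 0 (b - 2 * \<eta>) \<le>
        pr P ({xs. level d (log_pp n (delete_first_max xs)) = v} \<inter> S)"
      by (simp add: max_def)
    have den: "pr P S \<le> C * (exp (- x) + \<eta>)" "pr P S > 0"
      using elim by (simp_all add: P_def S_def C_def)
    have "exp x * b - \<delta> < max 0 (b - 2 * \<eta>) / (exp (- x) + \<eta>)" by (rule eta)
    also have "\<dots> = (C * max 0 (b - 2 * \<eta>)) / (C * (exp (- x) + \<eta>))" using C by simp
    also have "\<dots> \<le> pr P ({xs. level d (log_pp n (delete_first_max xs)) = v} \<inter> S) / pr P S"
      using num den C by (intro frac_le) auto
    also have "\<dots> = pr (cond_pmf P S) {xs. level d (log_pp n (delete_first_max xs)) = v}"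
      using ne by (simp add: cond_pmf.rep_eq[OF ne] measure_uniform_measure measure_pmf.emeasure_eq_measure Int_commute
          measure_pmf_zero_iff)
    finally show ?case
      by (simp add: P_def S_def b_def exp_diff exp_minus field_simps)
  qed
qed

end

section \<open>Vague convergence from finitely many counts\<close>

lemma conf_count_sets:
  "B \<in> sets borel \<Longrightarrow> B \<subseteq> {0<..1} \<Longrightarrow> {c\<in>Conf. cnt c B = k} \<in> sets conf_measure"
  unfolding conf_measure_def by (subst sets_measure_of) (auto intro!: sigma_sets.Basic)

lemma space_conf_measure [simp]: "space conf_measure = Conf"
  unfolding conf_measure_def by (rule space_measure_of) auto

lemma measurable_cnt:
  assumes "B \<in> sets borel" "B \<subseteq> {0<..1}"
  shows "(\<lambda>c. cnt c B) \<in> measurable conf_measure (count_space UNIV)"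
  using conf_count_sets[OF assms]
  by (subst measurable_count_space_eq2_countable) (auto simp: vimage_def Int_def conj_commute)

lemma sets_cell [measurable]: "cell d i \<in> sets borel"
  by (simp add: cell_def)

lemma measurable_level: "level d \<in> measurable conf_measure (count_space UNIV)"
proof -
  have "level d -` {v} \<inter> space conf_measure \<in> sets conf_measure" for v :: "nat list"
  proof -
    have [measurable]: "(\<lambda>c. cnt c (cell d i)) \<in> measurable conf_measure (count_space UNIV)" if "i < d" for i
      using cell_subset[OF that] by (intro measurable_cnt) auto
    have "level d c = v \<longleftrightarrow> length v = d \<and> (\<forall>i\<in>{..<d}. the_enat (cnt c (cell d i)) = v ! i)" for c
      by (cases "length v = d") (auto simp: level_def list_eq_iff_nth_eq)
    then have "level d -` {v} \<inter> space conf_measure =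
        {c\<in>space conf_measure. length v = d \<and> (\<forall>i\<in>{..<d}. the_enat (cnt c (cell d i)) = v ! i)}"
      by blast
    also have "\<dots> \<in> sets conf_measure" by measurable
    finally show ?thesis .
  qed
  then show ?thesis
    by (subst measurable_count_space_eq2_countable) auto
qed

section \<open>Linear functionals approximated by counts\<close>

lemma Conf_finite: "c \<in> Conf \<Longrightarrow> a > 0 \<Longrightarrow> finite {y. a \<le> y \<and> 0 < c y}"
  by (simp add: Conf_def)

lemma Conf_support: "c \<in> Conf \<Longrightarrow> 0 < c y \<Longrightarrow> 0 < y \<and> y \<le> 1"
  by (auto simp: Conf_def)

lemma finite_cell_support: "c \<in> Conf \<Longrightarrow> finite {y\<in>cell d i. 0 < c y}"
  by (rule finite_subset[OF _ Conf_finite[OF _ thr_pos[of d i]]]) (auto simp: cell_def)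

lemma nth_level:
  assumes "c \<in> Conf" "i < d"
  shows "level d c ! i = (\<Sum>y\<in>{y\<in>cell d i. 0 < c y}. c y)"
  using assms finite_cell_support[of c d i] by (simp add: level_def cnt_def)

lemma exists_cell:
  assumes "thr d 0 < y" "y \<le> 1"
  shows "\<exists>i<d. y \<in> cell d i"
proof -
  \<comment> \<open>In units of \<open>1 / (d + 1)\<close>, cell \<open>i\<close> runs from
    \<open>i + 1\<close> to \<open>i + 2\<close> and is closed on the right, so the rounded-up value
    \<open>j\<close> belongs to cell \<open>j - 2\<close>.\<close>
  define j where "j = nat \<lceil>y * (real d + 1)\<rceil>"
  have y1: "1 < y * (real d + 1)" using assms by (simp add: thr_def field_simps)
  have y2: "y * (real d + 1) \<le> real d + 1" using assms mult_right_mono[of y 1 "real d + 1"] by simp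
  have j: "real j - 1 < y * (real d + 1)" "y * (real d + 1) \<le> real j"
    using y1 by (simp_all add: j_def of_nat_nat) linarith+
  have "j \<ge> 2" "j \<le> d + 1" using j y1 y2 by linarith+
  moreover from this have "y \<in> cell d (j - 2)"
    using j by (simp add: cell_def thr_def of_nat_diff divide_less_eq le_divide_eq)
  ultimately show ?thesis by (intro exI[of _ "j - 2"]) auto
qed

text \<open>With mesh below \<open>a / 2\<close>, a cell containing a point at or above
  \<open>a\<close> has its left end at or above \<open>a / 2\<close>; so the cells in
  \<open>S\<close> catch every point of \<open>c\<close> at which \<open>f\<close> is
  nonzero.\<close>

lemma lin_cells:
  assumes c: "c \<in> Conf" and a: "a > 0" and f0: "\<And>y. y \<in> {0<..1} \<Longrightarrow> y < a \<Longrightarrow> f y = 0"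
    and d: "1 / (real d + 1) < a / 2"
  defines "S \<equiv> {i. i < d \<and> a / 2 \<le> thr d i}"
  shows "lin f c = (\<Sum>i\<in>S. \<Sum>y\<in>{y\<in>cell d i. 0 < c y}. real (c y) * f y)"
proof -
  define Z where "Z = (\<Union>i\<in>S. {y\<in>cell d i. 0 < c y})"
  have finS: "finite S" by (simp add: S_def)
  have finZ: "finite Z" unfolding Z_def using finS finite_cell_support[OF c] by auto
  have "{y. 0 < c y \<and> f y \<noteq> 0} \<subseteq> Z"
  proof
    fix y assume y: "y \<in> {y. 0 < c y \<and> f y \<noteq> 0}"
    then have y01: "0 < y" "y \<le> 1" using Conf_support[OF c] by auto
    then have ya: "a \<le> y" using y f0[of y] by force
    have "thr d 0 < y" using d ya a by (simp add: thr_def)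
    then obtain i where i: "i < d" "y \<in> cell d i" using exists_cell y01 by blast
    have "y \<le> thr d (Suc i)" using i by (simp add: cell_def)
    also have "thr d (Suc i) = thr d i + 1 / (real d + 1)" by (simp add: thr_def add_divide_distrib)
    finally have "a / 2 \<le> thr d i" using d ya by linarith
    then show "y \<in> Z" using i y by (auto simp: Z_def S_def)
  qed
  then have "lin f c = (\<Sum>y\<in>Z. real (c y) * f y)"
    unfolding lin_def using finZ by (intro sum.mono_neutral_left) (auto simp: Z_def)
  also have "\<dots> = (\<Sum>i\<in>S. \<Sum>y\<in>{y\<in>cell d i. 0 < c y}. real (c y) * f y)"
    unfolding Z_def using finS finite_cell_support[OF c] cell_disjoint
    by (intro sum.UNION_disjoint) blast+
  finally show ?thesis .
qed

lemma lin_level_approx: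
  assumes c: "c \<in> Conf" and a: "a > 0" and f0: "\<And>y. y \<in> {0<..1} \<Longrightarrow> y < a \<Longrightarrow> f y = 0"
    and d: "1 / (real d + 1) < a / 2"
    and osc: "\<And>y z. y \<in> {a/2..1} \<Longrightarrow> z \<in> {a/2..1} \<Longrightarrow> \<bar>y - z\<bar> \<le> 1 / (real d + 1) \<Longrightarrow> \<bar>f y - f z\<bar> \<le> \<eta>"
  defines "S \<equiv> {i. i < d \<and> a / 2 \<le> thr d i}"
  shows "\<bar>lin f c - (\<Sum>i\<in>S. real (level d c ! i) * f (thr d (Suc i)))\<bar> \<le> \<eta> * (\<Sum>i\<in>S. real (level d c ! i))"
proof -
  have "lin f c = (\<Sum>i\<in>S. \<Sum>y\<in>{y\<in>cell d i. 0 < c y}. real (c y) * f y)"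
    unfolding S_def by (rule lin_cells[OF c a f0 d])
  moreover have "(\<Sum>i\<in>S. real (level d c ! i) * f (thr d (Suc i))) =
      (\<Sum>i\<in>S. \<Sum>y\<in>{y\<in>cell d i. 0 < c y}. real (c y) * f (thr d (Suc i)))"
    by (intro sum.cong refl) (simp add: S_def nth_level[OF c] sum_distrib_right)
  ultimately have "lin f c - (\<Sum>i\<in>S. real (level d c ! i) * f (thr d (Suc i))) =
      (\<Sum>i\<in>S. \<Sum>y\<in>{y\<in>cell d i. 0 < c y}. real (c y) * (f y - f (thr d (Suc i))))"
    by (simp add: sum_subtractf right_diff_distrib)
  also have "\<bar>\<dots>\<bar> \<le> (\<Sum>i\<in>S. \<Sum>y\<in>{y\<in>cell d i. 0 < c y}. real (c y) * \<eta>)"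
  proof (rule order_trans[OF sum_abs], intro sum_mono, rule order_trans[OF sum_abs], intro sum_mono)
    fix i y assume i: "i \<in> S" and y: "y \<in> {y \<in> cell d i. 0 < c y}"
    have "thr d (Suc i) = thr d i + 1 / (real d + 1)" by (simp add: thr_def add_divide_distrib)
    moreover have "thr d (Suc i) \<le> 1" using i by (intro thr_le_1) (auto simp: S_def)
    moreover have "thr d i < y" "y \<le> thr d (Suc i)" using y by (auto simp: cell_def)
    moreover have "a / 2 \<le> thr d i" using i by (simp add: S_def)
    ultimately have "\<bar>f y - f (thr d (Suc i))\<bar> \<le> \<eta>"
      by (intro osc) (auto intro: order_trans less_imp_le)
    then show "\<bar>real (c y) * (f y - f (thr d (Suc i)))\<bar> \<le> real (c y) * \<eta>"
      by (simp add: abs_mult mult_left_mono)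
  qed
  also have "\<dots> = \<eta> * (\<Sum>i\<in>S. real (level d c ! i))"
    by (subst sum_distrib_left, intro sum.cong refl)
       (simp add: S_def nth_level[OF c] sum_distrib_left mult.commute)
  finally show ?thesis .
qed

text \<open>Equal counts put both functionals close to the same Riemann sum. The error is the
  oscillation of \<open>f\<close> on a cell times the mass above \<open>a / 2\<close>, and a bound
  for that mass is read off \<open>c\<close> alone, so the threshold for \<open>d\<close> does not
  depend on \<open>c'\<close>.\<close>

lemma lin_level_continuous:
  assumes f: "f \<in> Cc" and c: "c \<in> Conf" and e: "e > 0"
  shows "\<forall>\<^sub>F d in sequentially. \<forall>c'\<in>Conf. level d c' = level d c \<longrightarrow> \<bar>lin f c' - lin f c\<bar> < e"
proof -
  obtain a where a: "a > 0" and f0: "\<And>y. y \<in> {0<..1} \<Longrightarrow> y < a \<Longrightarrow> f y = 0"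
    using f by (auto simp: Cc_def)
  define N where "N = (\<Sum>y\<in>{y. a/2 \<le> y \<and> 0 < c y}. real (c y))"
  have N: "N \<ge> 0" by (simp add: N_def sum_nonneg)
  \<comment> \<open>Two approximation errors of at most \<open>\<eta> * N\<close> each must stay
    below \<open>e\<close>; the \<open>+ 1\<close> covers \<open>N = 0\<close>.\<close>
  define \<eta> where "\<eta> = e / (2 * N + 1)"
  have eta: "\<eta> > 0" "2 * (\<eta> * N) < e" using e N by (simp_all add: \<eta>_def field_simps)
  have "continuous_on {a/2..1} f"
    by (rule continuous_on_subset[of "{0<..1}"]) (use f a in \<open>simp_all add: Cc_def, force\<close>)
  then have "uniformly_continuous_on {a/2..1} f" by (rule compact_uniformly_continuous) auto
  then have "\<exists>\<delta>>0. \<forall>y\<in>{a/2..1}. \<forall>z\<in>{a/2..1}. \<bar>z - y\<bar> < \<delta> \<longrightarrow> \<bar>f z - f y\<bar> < \<eta>"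
    using eta(1) unfolding uniformly_continuous_on_def dist_real_def by blast
  then obtain \<delta> where \<delta>: "\<delta> > 0"
    "\<And>y z. y \<in> {a/2..1} \<Longrightarrow> z \<in> {a/2..1} \<Longrightarrow> \<bar>z - y\<bar> < \<delta> \<Longrightarrow> \<bar>f z - f y\<bar> < \<eta>"
    by blast
  have "(\<lambda>d. 1 / (real d + 1)) \<longlonglongrightarrow> 0"
    using LIMSEQ_inverse_real_of_nat by (simp add: inverse_eq_divide add.commute)
  then have "\<forall>\<^sub>F d in sequentially. 1 / (real d + 1) < min \<delta> (a / 2)"
    by (rule order_tendstoD) (use \<delta> a in auto)
  then show ?thesis
  proof (eventually_elim, intro ballI impI)
    case (elim d)
    fix c' assume c': "c' \<in> Conf" and eq: "level d c' = level d c"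
    define S where "S = {i. i < d \<and> a / 2 \<le> thr d i}"
    have osc: "\<bar>f y - f z\<bar> \<le> \<eta>" if "y \<in> {a/2..1}" "z \<in> {a/2..1}" "\<bar>y - z\<bar> \<le> 1 / (real d + 1)" for y z
      using \<delta>(2)[of z y] that elim by simp
    have d: "1 / (real d + 1) < a / 2" using elim by simp
    have approx: "\<bar>lin f b - (\<Sum>i\<in>S. real (level d b ! i) * f (thr d (Suc i)))\<bar> \<le> \<eta> * (\<Sum>i\<in>S. real (level d b ! i))"
      if "b \<in> Conf" for b
      using lin_level_approx[where f = f, OF that a f0 d osc] by (simp add: S_def)
    have "(\<Sum>i\<in>S. real (level d c ! i)) = (\<Sum>i\<in>S. \<Sum>y\<in>{y\<in>cell d i. 0 < c y}. real (c y))"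
      by (intro sum.cong refl) (simp add: S_def nth_level[OF c])
    also have "\<dots> = (\<Sum>y\<in>(\<Union>i\<in>S. {y\<in>cell d i. 0 < c y}). real (c y))"
      using finite_cell_support[OF c] cell_disjoint
      by (intro sum.UNION_disjoint[symmetric]) (simp add: S_def, blast+)
    also have "\<dots> \<le> N"
      unfolding N_def using Conf_finite[OF c, of "a/2"] a
      by (intro sum_mono2) (auto simp: S_def cell_def)
    finally have "\<eta> * (\<Sum>i\<in>S. real (level d c ! i)) \<le> \<eta> * N" using eta by (intro mult_left_mono) auto
    then show "\<bar>lin f c' - lin f c\<bar> < e"
      using approx[OF c] approx[OF c'] eta unfolding eq by linarith
  qed
qed

lemma topspace_vague: "topspace vague_topology = Conf"
proof -
  have "(\<lambda>_. 0) \<in> Cc" by (auto simp: Cc_def intro: exI[of _ 1])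
  then have "Conf \<in> {{c\<in>Conf. lin f c \<in> U} | f U. f \<in> Cc \<and> open U}"
    by (intro CollectI exI[of _ "\<lambda>_. 0"] exI[of _ UNIV]) auto
  then show ?thesis unfolding vague_topology_def topology_generated_by_topspace by blast
qed

text \<open>Eventual membership passes through finite intersections and arbitrary unions, so testing
  the generating sets suffices.\<close>

lemma limitin_vague:
  assumes c: "c \<in> Conf" and cs: "\<And>n. cs n \<in> Conf" and lim: "\<And>f. f \<in> Cc \<Longrightarrow> (\<lambda>n. lin f (cs n)) \<longlonglongrightarrow> lin f c"
  shows "limitin vague_topology cs c sequentially"
  unfolding limitin_def
proof (intro conjI allI impI)
  show "c \<in> topspace vague_topology" using c by (simp add: topspace_vague)
  fix U assume U: "openin vague_topology U \<and> c \<in> U"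
  then have "generate_topology_on {{c\<in>Conf. lin f c \<in> U} | f U. f \<in> Cc \<and> open U} U"
    unfolding vague_topology_def by (simp add: openin_topology_generated_by_iff)
  then have "c \<in> U \<longrightarrow> (\<forall>\<^sub>F n in sequentially. cs n \<in> U)"
  proof (induction rule: generate_topology_on.induct)
    case (Int a b)
    then show ?case by (auto intro: eventually_conj)
  next
    case (UN \<K>)
    show ?case
    proof
      assume "c \<in> \<Union>\<K>"
      then obtain k where k: "k \<in> \<K>" "c \<in> k" by blast
      then have "\<forall>\<^sub>F n in sequentially. cs n \<in> k" using UN by blast
      then show "\<forall>\<^sub>F n in sequentially. cs n \<in> \<Union>\<K>" by eventually_elim (use k in blast)
    qed
  next
    case (Basis s)
    then obtain f V where s: "s = {c\<in>Conf. lin f c \<in> V}" "f \<in> Cc" "open V" by blast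
    show ?case
      using topological_tendstoD[OF lim[OF s(2)] s(3)] cs by (auto simp: s(1))
  qed simp
  then show "\<forall>\<^sub>F n in sequentially. cs n \<in> U" using U by simp
qed

text \<open>Configurations that agree with \<open>c\<close> at level \<open>d\<close> converge vaguely to \<open>c\<close> as \<open>d\<close> grows. Hence a
  continuous functional is a pointwise limit of functionals of finitely many counts, which gives its
  measurability, and Fatou's lemma replaces any tightness argument.\<close>

lemma level_lower_envelope:
  fixes F :: "(real \<Rightarrow> nat) \<Rightarrow> real"
  assumes F: "continuous_map vague_topology euclideanreal F" and c: "c \<in> Conf"
  shows "(\<lambda>d. INF c'\<in>{c'\<in>Conf. level d c' = level d c}. ennreal (F c')) \<longlonglongrightarrow> ennreal (F c)"
    (is "?g \<longlonglongrightarrow> _")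
proof (rule order_tendstoI)
  fix b assume "ennreal (F c) < b"
  moreover have "?g d \<le> ennreal (F c)" for d using c by (intro INF_lower) auto
  ultimately show "\<forall>\<^sub>F d in sequentially. ?g d < b"
    by (intro always_eventually allI) (rule le_less_trans)
next
  fix b assume "b < ennreal (F c)"
  then obtain b' where b': "b < b'" "b' < ennreal (F c)" using dense by blast
  \<comment> \<open>Where the envelope is at most \<open>b\<close>, a configuration with value below
    \<open>b'\<close> is chosen, otherwise \<open>c\<close> itself. The chosen sequence tends to
    \<open>c\<close>, so its values finally exceed \<open>b'\<close> and the first case stops
    occurring. The gap between \<open>b\<close> and \<open>b'\<close> is there because the infimum
    need not be attained.\<close>
  have "\<exists>c'. c' \<in> Conf \<and> level d c' = level d c \<and> (?g d \<le> b \<longrightarrow> ennreal (F c') < b')" for d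
  proof (cases "?g d \<le> b")
    case True
    then have "?g d < b'" using b'(1) by (rule le_less_trans)
    then show ?thesis by (auto simp: INF_less_iff)
  qed (use c in blast)
  then have "\<exists>cs. \<forall>d. cs d \<in> Conf \<and> level d (cs d) = level d c \<and> (?g d \<le> b \<longrightarrow> ennreal (F (cs d)) < b')"
    by (intro choice allI)
  then obtain cs where cs: "\<And>d. cs d \<in> Conf" "\<And>d. level d (cs d) = level d c"
    "\<And>d. ?g d \<le> b \<Longrightarrow> ennreal (F (cs d)) < b'" by blast
  have "limitin vague_topology cs c sequentially"
  proof (rule limitin_vague[OF c cs(1)], rule tendstoI)
    fix f and e :: real assume "f \<in> Cc" "e > 0"
    from lin_level_continuous[OF this(1) c this(2)]
    show "\<forall>\<^sub>F n in sequentially. dist (lin f (cs n)) (lin f c) < e"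
      by eventually_elim (use cs in \<open>auto simp: dist_real_def\<close>)
  qed
  from continuous_map_limit[OF F this] have "(\<lambda>d. F (cs d)) \<longlonglongrightarrow> F c" by (simp add: o_def)
  then have "(\<lambda>d. ennreal (F (cs d))) \<longlonglongrightarrow> ennreal (F c)" by (rule tendsto_ennrealI)
  then have "\<forall>\<^sub>F d in sequentially. b' < ennreal (F (cs d))" using b'(2) by (rule order_tendstoD)
  then show "\<forall>\<^sub>F d in sequentially. b < ?g d"
    by eventually_elim (use cs(3) in \<open>meson less_asym not_le\<close>)
qed

section \<open>From lower bounds on count probabilities to convergence in distribution\<close>

lemma nn_integral_countable_valued:
  fixes g :: "'b::countable \<Rightarrow> ennreal"
  assumes [measurable]: "l \<in> measurable M (count_space UNIV)"
  shows "(\<integral>\<^sup>+c. g (l c) \<partial>M) = (\<integral>\<^sup>+v. g v * emeasure M {c\<in>space M. l c = v} \<partial>count_space UNIV)"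
proof -
  have "(\<integral>\<^sup>+c. g (l c) \<partial>M) = (\<integral>\<^sup>+c. \<integral>\<^sup>+v. g v * indicator {l c} v \<partial>count_space UNIV \<partial>M)"
    by (intro nn_integral_cong) (simp add: nn_integral_count_space_indicator nn_integral_indicator_finite)
  also have "\<dots> = (\<integral>\<^sup>+v. \<integral>\<^sup>+c. g v * indicator {l c} v \<partial>M \<partial>count_space UNIV)"
    by (intro nn_integral_count_space_nn_integral) auto
  also have "\<dots> = (\<integral>\<^sup>+v. g v * emeasure M {c\<in>space M. l c = v} \<partial>count_space UNIV)"
  proof (intro nn_integral_cong)
    fix v
    have "(\<integral>\<^sup>+c. g v * indicator {l c} v \<partial>M) = (\<integral>\<^sup>+c. g v * indicator {c\<in>space M. l c = v} c \<partial>M)"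
      by (intro nn_integral_cong) (auto simp: indicator_def)
    then show "(\<integral>\<^sup>+c. g v * indicator {l c} v \<partial>M) = g v * emeasure M {c\<in>space M. l c = v}"
      by (simp add: nn_integral_cmult_indicator)
  qed
  finally show ?thesis .
qed

text \<open>An infinite weight arises as an infimum over the empty set, when no configuration has
  the given counts; the limiting probability is then 0, and \<open>\<infinity> * 0 = 0\<close> keeps
  the bound true.\<close>

lemma ennreal_mult_le_liminf:
  fixes g :: ennreal
  assumes "\<And>\<delta>. \<delta> > 0 \<Longrightarrow> \<forall>\<^sub>F n in sequentially. q - \<delta> \<le> (a n :: real)" and g: "g = \<top> \<Longrightarrow> q \<le> 0"
  shows "g * ennreal q \<le> liminf (\<lambda>n. g * ennreal (a n))"
proof (cases "g = \<top> \<or> q \<le> 0")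
  case True
  then show ?thesis using g by (auto simp: ennreal_neg)
next
  case False
  then obtain r where r: "g = ennreal r" "r \<ge> 0" by (cases g) auto
  show ?thesis
    unfolding le_Liminf_iff
  proof (intro allI impI)
    fix y assume y: "y < g * ennreal q"
    then obtain s where s: "y = ennreal s" "s \<ge> 0" by (cases y) auto
    have "s < r * q" using y r s False by (simp add: ennreal_mult'[symmetric] ennreal_less_iff)
    then have pos: "r > 0" using s r(2) by (cases "r = 0") auto
    define \<delta> where "\<delta> = (r * q - s) / (2 * r)"
    have "r * \<delta> = (r * q - s) / 2" using pos by (simp add: \<delta>_def)
    moreover have "\<delta> > 0" unfolding \<delta>_def using \<open>s < r * q\<close> pos by (intro divide_pos_pos) auto
    ultimately have \<delta>: "\<delta> > 0" "r * \<delta> < r * q - s" using \<open>s < r * q\<close> by simp_all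
    show "\<forall>\<^sub>F n in sequentially. y < g * ennreal (a n)"
      using assms(1)[OF \<delta>(1)]
    proof eventually_elim
      case (elim n)
      have "s < r * (q - \<delta>)" using \<delta> by (simp add: right_diff_distrib)
      also have "\<dots> \<le> r * a n" using elim pos by (intro mult_left_mono) auto
      finally have "ennreal s < ennreal (r * a n)" using s by (intro ennreal_lessI) auto
      then show ?case using r s by (simp add: ennreal_mult')
    qed
  qed
qed

lemma vague_liminf:
  fixes P :: "nat \<Rightarrow> (real \<Rightarrow> nat) pmf" and F :: "(real \<Rightarrow> nat) \<Rightarrow> real"
  assumes Q: "prob_space Q" "sets Q = sets conf_measure"
    and P: "\<forall>\<^sub>F n in sequentially. set_pmf (P n) \<subseteq> Conf"
    and lev: "\<And>d v \<delta>. \<delta> > 0 \<Longrightarrow> length v = d \<Longrightarrow> \<forall>\<^sub>F n in sequentially.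
      measure Q {c\<in>Conf. level d c = v} - \<delta> \<le> pr (P n) {c. level d c = v}"
    and F: "continuous_map vague_topology euclideanreal F"
  shows "(\<integral>\<^sup>+c. ennreal (F c) \<partial>Q) \<le> liminf (\<lambda>n. \<integral>\<^sup>+c. ennreal (F c) \<partial>P n)"
    and "(\<lambda>c. ennreal (F c)) \<in> borel_measurable Q"
proof -
  interpret Q: prob_space Q by fact
  have spaceQ: "space Q = Conf" using sets_eq_imp_space_eq[OF Q(2)] by simp
  have [measurable]: "level d \<in> measurable Q (count_space UNIV)" for d
    using measurable_level by (simp only: measurable_cong_sets[OF Q(2) refl])
  define g where "g d v = (INF c\<in>{c\<in>Conf. level d c = v}. ennreal (F c))" for d v
  have g_lim: "(\<lambda>d. g d (level d c)) \<longlonglongrightarrow> ennreal (F c)" if "c \<in> Conf" for c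
    unfolding g_def by (rule level_lower_envelope[OF F that])
  have Feq: "ennreal (F c) = liminf (\<lambda>d. g d (level d c))" if "c \<in> Conf" for c
    using lim_imp_Liminf[OF _ g_lim[OF that]] by simp
  have "(\<lambda>c. liminf (\<lambda>d. g d (level d c))) \<in> borel_measurable Q" by measurable
  then show "(\<lambda>c. ennreal (F c)) \<in> borel_measurable Q"
    by (subst measurable_cong[OF Feq]) (simp_all add: spaceQ)
  have step: "(\<integral>\<^sup>+c. g d (level d c) \<partial>Q) \<le> liminf (\<lambda>n. \<integral>\<^sup>+c. ennreal (F c) \<partial>P n)" for d
  proof -
    have "(\<integral>\<^sup>+c. g d (level d c) \<partial>Q) = (\<integral>\<^sup>+v. g d v * emeasure Q {c\<in>space Q. level d c = v} \<partial>count_space UNIV)"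
      by (rule nn_integral_countable_valued) measurable
    also have "\<dots> \<le> (\<integral>\<^sup>+v. liminf (\<lambda>n. g d v * ennreal (pr (P n) {c. level d c = v})) \<partial>count_space UNIV)"
    proof (intro nn_integral_mono)
      fix v
      show "g d v * emeasure Q {c\<in>space Q. level d c = v} \<le>
          liminf (\<lambda>n. g d v * ennreal (pr (P n) {c. level d c = v}))"
      proof (cases "length v = d")
        case True
        show ?thesis
          unfolding Q.emeasure_eq_measure spaceQ
        proof (rule ennreal_mult_le_liminf)
          assume "g d v = \<top>"
          then have empty: "{c\<in>Conf. level d c = v} = {}"
            unfolding g_def by auto
          show "measure Q {c\<in>Conf. level d c = v} \<le> 0" by (simp only: empty measure_empty order_refl)
        qed (rule lev[OF _ True])
      next
        case False
        then have empty: "{c\<in>space Q. level d c = v} = {}" by (auto simp: level_def)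
        show ?thesis by (simp only: empty emeasure_empty mult_zero_right zero_le)
      qed
    qed
    also have "\<dots> \<le> liminf (\<lambda>n. \<integral>\<^sup>+v. g d v * ennreal (pr (P n) {c. level d c = v}) \<partial>count_space UNIV)"
      by (rule nn_integral_liminf) simp
    also have "(\<lambda>n. \<integral>\<^sup>+v. g d v * ennreal (pr (P n) {c. level d c = v}) \<partial>count_space UNIV) =
        (\<lambda>n. \<integral>\<^sup>+c. g d (level d c) \<partial>P n)"
      by (subst nn_integral_countable_valued) (simp_all add: measure_pmf.emeasure_eq_measure)
    also have "liminf (\<lambda>n. \<integral>\<^sup>+c. g d (level d c) \<partial>P n) \<le> liminf (\<lambda>n. \<integral>\<^sup>+c. ennreal (F c) \<partial>P n)"
    proof (rule Liminf_mono, use P in eventually_elim)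
      case (elim n)
      then show ?case
        by (intro nn_integral_mono_AE AE_pmfI) (auto simp: g_def intro!: INF_lower)
    qed
    finally show ?thesis .
  qed
  have "(\<integral>\<^sup>+c. ennreal (F c) \<partial>Q) = (\<integral>\<^sup>+c. liminf (\<lambda>d. g d (level d c)) \<partial>Q)"
    by (intro nn_integral_cong Feq) (simp add: spaceQ)
  also have "\<dots> \<le> liminf (\<lambda>d. \<integral>\<^sup>+c. g d (level d c) \<partial>Q)"
    by (rule nn_integral_liminf) measurable
  also have "\<dots> \<le> liminf (\<lambda>d::nat. liminf (\<lambda>n. \<integral>\<^sup>+c. ennreal (F c) \<partial>P n))"
    by (intro Liminf_mono always_eventually allI step)
  finally show "(\<integral>\<^sup>+c. ennreal (F c) \<partial>Q) \<le> liminf (\<lambda>n. \<integral>\<^sup>+c. ennreal (F c) \<partial>P n)"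
    by (simp add: Liminf_const)
qed

text \<open>Adding a constant changes the integrals against \<open>Q\<close> and against every
  \<open>P n\<close> equally, since all have mass 1. Lower bounds for \<open>F\<close> and for
  \<open>- F\<close> therefore combine to a two-sided bound, and escape of mass is excluded.\<close>

lemma conv_distr_vagueI:
  fixes P :: "nat \<Rightarrow> (real \<Rightarrow> nat) pmf"
  assumes Q: "prob_space Q" "sets Q = sets conf_measure"
    and P: "\<forall>\<^sub>F n in sequentially. set_pmf (P n) \<subseteq> Conf"
    and lev: "\<And>d v \<delta>. \<delta> > 0 \<Longrightarrow> length v = d \<Longrightarrow> \<forall>\<^sub>F n in sequentially.
      measure Q {c\<in>Conf. level d c = v} - \<delta> \<le> pr (P n) {c. level d c = v}"
  shows "conv_distr_vague (\<lambda>n. measure_pmf (P n)) Q"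
  unfolding conv_distr_vague_def
proof (intro allI impI)
  fix F assume "continuous_map vague_topology euclideanreal F \<and> (\<exists>B. \<forall>c\<in>Conf. \<bar>F c\<bar> \<le> B)"
  then obtain B where F: "continuous_map vague_topology euclideanreal F" and B: "\<And>c. c \<in> Conf \<Longrightarrow> \<bar>F c\<bar> \<le> B" by blast
  interpret Q: prob_space Q by fact
  have spaceQ: "space Q = Conf" using sets_eq_imp_space_eq[OF Q(2)] by simp
  have lower: "\<forall>\<^sub>F n in sequentially. (\<integral>c. G c \<partial>Q) - e < (\<integral>c. G c \<partial>P n)"
    if G: "continuous_map vague_topology euclideanreal G" and GB: "\<And>c. c \<in> Conf \<Longrightarrow> \<bar>G c\<bar> \<le> B" and e: "e > 0" for G e
  proof -
    \<comment> \<open>The shift makes \<open>H\<close> at least 1 on \<open>Conf\<close>, so passing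
      to \<open>ennreal\<close> loses nothing, and measurability of \<open>G\<close> is recovered
      through \<open>enn2real\<close>.\<close>
    define H where "H c = G c + (B + 1)" for c
    have H: "continuous_map vague_topology euclideanreal H"
      unfolding H_def by (intro continuous_intros G) simp
    have H1: "H c \<ge> 1" if "c \<in> Conf" for c using GB[OF that] by (simp add: H_def)
    have "(\<lambda>c. enn2real (ennreal (H c)) - (B + 1)) \<in> borel_measurable Q"
      using vague_liminf(2)[OF Q P lev H] by measurable
    moreover have "G c = enn2real (ennreal (H c)) - (B + 1)" if "c \<in> space Q" for c
      using H1[of c] that by (simp add: spaceQ H_def)
    ultimately have Gm: "G \<in> borel_measurable Q"
      by (simp cong: measurable_cong)
    have intQ: "integrable Q G"
      by (rule Q.integrable_const_bound[where B = B]) (use GB Gm spaceQ in auto)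
    have intP: "integrable (P n) G" if "set_pmf (P n) \<subseteq> Conf" for n
      by (rule measure_pmf.integrable_const_bound[where B = B]) (use GB that in \<open>auto intro!: AE_pmfI\<close>)
    have Qeq: "(\<integral>\<^sup>+c. ennreal (H c) \<partial>Q) = ennreal ((\<integral>c. G c \<partial>Q) + (B + 1))"
    proof -
      have "(\<integral>\<^sup>+c. ennreal (H c) \<partial>Q) = ennreal (\<integral>c. H c \<partial>Q)"
        using intQ H1 unfolding H_def by (intro nn_integral_eq_integral) (auto simp: spaceQ intro!: AE_I2 order_trans[OF zero_le_one])
      then show ?thesis using intQ Q.prob_space by (simp add: H_def)
    qed
    have Peq: "(\<integral>\<^sup>+c. ennreal (H c) \<partial>P n) = ennreal ((\<integral>c. G c \<partial>P n) + (B + 1))" if "set_pmf (P n) \<subseteq> Conf" for n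
    proof -
      have "(\<integral>\<^sup>+c. ennreal (H c) \<partial>P n) = ennreal (\<integral>c. H c \<partial>P n)"
        using intP[OF that] H1 that unfolding H_def by (intro nn_integral_eq_integral) (auto intro!: AE_pmfI order_trans[OF zero_le_one])
      then show ?thesis using intP[OF that] by (simp add: H_def)
    qed
    have "(\<integral>c. G c \<partial>Q) + (B + 1) \<ge> 1"
    proof -
      have "(\<integral>c. - B \<partial>Q) \<le> (\<integral>c. G c \<partial>Q)"
        using intQ GB by (intro integral_mono) (auto simp: spaceQ abs_le_iff minus_le_iff)
      then show ?thesis using Q.prob_space by simp
    qed
    then have "ennreal ((\<integral>c. G c \<partial>Q) - e + (B + 1)) < ennreal ((\<integral>c. G c \<partial>Q) + (B + 1))"
      using e by (intro ennreal_lessI) auto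
    also have "\<dots> \<le> liminf (\<lambda>n. \<integral>\<^sup>+c. ennreal (H c) \<partial>P n)"
      unfolding Qeq[symmetric] by (rule vague_liminf(1)[OF Q P lev H])
    finally have "\<forall>\<^sub>F n in sequentially. ennreal ((\<integral>c. G c \<partial>Q) - e + (B + 1)) < (\<integral>\<^sup>+c. ennreal (H c) \<partial>P n)"
      by (rule less_LiminfD)
    with P show ?thesis
    proof eventually_elim
      case (elim n)
      then have "ennreal ((\<integral>c. G c \<partial>Q) - e + (B + 1)) < ennreal ((\<integral>c. G c \<partial>P n) + (B + 1))"
        by (simp add: Peq)
      then show ?case by (metis add_le_cancel_right ennreal_leI not_le)
    qed
  qed
  show "(\<lambda>n. \<integral>c. F c \<partial>P n) \<longlonglongrightarrow> (\<integral>c. F c \<partial>Q)"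
  proof (rule order_tendstoI)
    fix a assume "a < (\<integral>c. F c \<partial>Q)"
    then show "\<forall>\<^sub>F n in sequentially. a < (\<integral>c. F c \<partial>P n)"
      using lower[OF F B, of "(\<integral>c. F c \<partial>Q) - a"] by simp
  next
    fix a assume "(\<integral>c. F c \<partial>Q) < a"
    moreover have "continuous_map vague_topology euclideanreal (\<lambda>c. - F c)"
      by (intro continuous_intros F)
    ultimately show "\<forall>\<^sub>F n in sequentially. (\<integral>c. F c \<partial>P n) < a"
      using lower[of "\<lambda>c. - F c" "a - (\<integral>c. F c \<partial>Q)"] B by simp
  qed
qed

section \<open>Probability generating functions of counts\<close>

text \<open>The slabs partition \<open>(0, 1]\<close> into pieces bounded away from 0. Each has
  finite intensity even when the total is infinite, so finite Poisson clouds can be placed in them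
  independently.\<close>

definition slab :: "nat \<Rightarrow> real set" where
  "slab j = {1 / (real j + 2)<..1 / (real j + 1)}"

definition slab_index :: "real \<Rightarrow> nat" where
  "slab_index y = nat \<lfloor>1 / y\<rfloor> - 1"

lemma slab_index_iff:
  assumes "0 < y" "y \<le> 1"
  shows "y \<in> slab j \<longleftrightarrow> slab_index y = j"
proof -
  have "1 \<le> 1 / y" using assms by simp
  then have fl: "\<lfloor>1 / y\<rfloor> \<ge> 1" by linarith
  have "y \<in> slab j \<longleftrightarrow> real j + 1 \<le> 1 / y \<and> 1 / y < real j + 2"
    using assms by (auto simp: slab_def field_simps)
  also have "\<dots> \<longleftrightarrow> \<lfloor>1 / y\<rfloor> = int j + 1" by (auto simp: floor_eq_iff)
  also have "\<dots> \<longleftrightarrow> slab_index y = j" using fl unfolding slab_index_def by linarith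
  finally show ?thesis .
qed

lemma slab_subset: "slab j \<subseteq> {0<..1}"
proof
  fix y assume y: "y \<in> slab j"
  have "0 < 1 / (real j + 2)" "1 / (real j + 1) \<le> 1" by simp_all
  then show "y \<in> {0<..1}" using y unfolding slab_def greaterThanAtMost_iff by linarith
qed

lemma sets_slab [measurable]: "slab j \<in> sets borel"
  by (simp add: slab_def)

lemma slab_disjoint: "i \<noteq> j \<Longrightarrow> slab i \<inter> slab j = {}"
  using slab_subset[of i] slab_index_iff by (force simp: subset_iff)

lemma slab_UN: "(\<Union>j<n. slab j) = {1 / (real n + 1)<..1}"
proof (induction n)
  case (Suc n)
  define b c where "b = 1 / (real n + 2)" and "c = 1 / (real n + 1)"
  have "b < c" "c \<le> 1" by (simp_all add: b_def c_def field_simps)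
  then have "{b<..1} = {c<..1} \<union> {b<..c}" by auto
  moreover have "1 / (real (Suc n) + 1) = b" by (simp add: b_def add.commute)
  ultimately have "{1 / (real (Suc n) + 1)<..1} = {1 / (real n + 1)<..1} \<union> slab n"
    by (simp only: slab_def b_def c_def)
  then show ?case using Suc by (simp add: lessThan_Suc Un_commute)
qed simp

definition cnt_upto :: "(real \<Rightarrow> nat) \<Rightarrow> real set \<Rightarrow> nat \<Rightarrow> nat" where
  "cnt_upto c B n = (\<Sum>j<n. \<Sum>y\<in>{y\<in>B \<inter> slab j. 0 < c y}. c y)"

lemma cnt_upto_limit:
  assumes c: "c \<in> Conf" and B: "B \<subseteq> {0<..1}"
  shows "cnt c B = enat m \<Longrightarrow> \<forall>\<^sub>F n in sequentially. cnt_upto c B n = m"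
    and "cnt c B = \<infinity> \<Longrightarrow> filterlim (cnt_upto c B) at_top sequentially"
proof -
  have fin: "finite {y\<in>B \<inter> slab j. 0 < c y}" for j
    by (rule finite_subset[OF _ Conf_finite[OF c, of "1 / (real j + 2)"]]) (auto simp: slab_def)
  have eq: "cnt_upto c B n = (\<Sum>y\<in>{y\<in>B \<inter> {1 / (real n + 1)<..1}. 0 < c y}. c y)" for n
  proof -
    have "cnt_upto c B n = (\<Sum>y\<in>(\<Union>j<n. {y\<in>B \<inter> slab j. 0 < c y}). c y)"
      unfolding cnt_upto_def using fin slab_disjoint by (intro sum.UNION_disjoint[symmetric]) (simp, simp, blast)
    also have "(\<Union>j<n. {y\<in>B \<inter> slab j. 0 < c y}) = {y\<in>B \<inter> (\<Union>j<n. slab j). 0 < c y}" by auto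
    finally show ?thesis unfolding slab_UN .
  qed
  have ev: "\<forall>\<^sub>F n in sequentially. S \<subseteq> {1 / (real n + 1)<..1}" if "finite S" "S \<subseteq> {0<..1}" for S
  proof -
    have lim: "(\<lambda>n. 1 / (real n + 1)) \<longlonglongrightarrow> 0"
      using LIMSEQ_inverse_real_of_nat by (simp add: inverse_eq_divide add.commute)
    have "\<forall>\<^sub>F n in sequentially. \<forall>y\<in>S. 1 / (real n + 1) < y"
      using that by (intro eventually_ball_finite ballI order_tendstoD(2)[OF lim]) auto
    then show ?thesis by eventually_elim (use that in auto)
  qed
  {
    assume "cnt c B = enat m"
    then have S: "finite {y\<in>B. 0 < c y}" "(\<Sum>y\<in>{y\<in>B. 0 < c y}. c y) = m"
      by (auto simp: cnt_def split: if_splits)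
    have "\<forall>\<^sub>F n in sequentially. {y\<in>B. 0 < c y} \<subseteq> {1 / (real n + 1)<..1}"
      using B S(1) by (intro ev) auto
    then show "\<forall>\<^sub>F n in sequentially. cnt_upto c B n = m"
    proof eventually_elim
      case (elim n)
      then have "{y\<in>B \<inter> {1 / (real n + 1)<..1}. 0 < c y} = {y\<in>B. 0 < c y}" by auto
      then show ?case by (simp only: eq S)
    qed
  next
    assume "cnt c B = \<infinity>"
    then have inf: "infinite {y\<in>B. 0 < c y}" by (auto simp: cnt_def split: if_splits)
    show "filterlim (cnt_upto c B) at_top sequentially"
      unfolding filterlim_at_top
    proof
      fix Z
      obtain S where S: "S \<subseteq> {y\<in>B. 0 < c y}" "finite S" "card S = Z"
        using infinite_arbitrarily_large[OF inf, of Z] by auto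
      have "\<forall>\<^sub>F n in sequentially. S \<subseteq> {1 / (real n + 1)<..1}"
        using B S by (intro ev) auto
      then show "\<forall>\<^sub>F n in sequentially. Z \<le> cnt_upto c B n"
      proof eventually_elim
        case (elim n)
        have finn: "finite {y\<in>B \<inter> {1 / (real n + 1)<..1}. 0 < c y}"
          by (rule finite_subset[OF _ Conf_finite[OF c, of "1 / (real n + 1)"]]) auto
        have "Z = (\<Sum>y\<in>S. 1)" using S by simp
        also have "\<dots> \<le> (\<Sum>y\<in>S. c y)" using S by (intro sum_mono) auto
        also have "\<dots> \<le> cnt_upto c B n" unfolding eq using finn S elim by (intro sum_mono2) auto
        finally show ?case .
      qed
    qed
  }
qed

text \<open>The value 0 at infinity is the limit of \<open>s^m\<close> for
  \<open>0 <= s < 1\<close>, so powers of truncated counts converge also where the full count is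
  infinite.\<close>

definition epow :: "real \<Rightarrow> enat \<Rightarrow> real" where
  "epow s e = (case e of enat m \<Rightarrow> s ^ m | \<infinity> \<Rightarrow> 0)"

lemma epow_simps [simp]: "epow s (enat m) = s ^ m" "epow s \<infinity> = 0"
  by (simp_all add: epow_def)

lemma epow_bounds: "0 \<le> s \<Longrightarrow> s \<le> 1 \<Longrightarrow> 0 \<le> epow s e" "0 \<le> s \<Longrightarrow> s \<le> 1 \<Longrightarrow> epow s e \<le> 1"
  by (cases e; simp add: power_le_one)+

lemma epow_cnt_upto:
  assumes "c \<in> Conf" "B \<subseteq> {0<..1}" "0 \<le> s" "s < 1"
  shows "(\<lambda>n. s ^ cnt_upto c B n) \<longlonglongrightarrow> epow s (cnt c B)"
proof (cases "cnt c B")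
  case (enat m)
  have "\<forall>\<^sub>F n in sequentially. s ^ cnt_upto c B n = s ^ m"
    using cnt_upto_limit(1)[OF assms(1,2) enat] by eventually_elim simp
  then show ?thesis unfolding enat epow_simps by (rule tendsto_eventually)
next
  case infinity
  have "(\<lambda>n. s ^ n) \<longlonglongrightarrow> 0" using assms by (intro LIMSEQ_power_zero) auto
  then show ?thesis
    unfolding infinity epow_simps by (rule filterlim_compose) (rule cnt_upto_limit(2)[OF assms(1,2) infinity])
qed

text \<open>Convergence on \<open>(0, 1)\<close> spreads to the open unit disc, where the sum is
  continuous at 0; approaching 0 from the right identifies the constant term.\<close>

lemma powser_const_zero:
  fixes c :: "nat \<Rightarrow> real"
  assumes 0: "\<And>t. 0 < t \<Longrightarrow> t < 1 \<Longrightarrow> (\<lambda>k. c k * t ^ k) sums 0"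
  shows "c 0 = 0"
proof -
  define f where "f t = (\<Sum>k. c k * t ^ k)" for t
  have sums: "(\<lambda>k. c k * t ^ k) sums f t" if "norm t < 1" for t
  proof -
    define r where "r = (1 + \<bar>t\<bar>) / 2"
    have r: "0 < r" "r < 1" "\<bar>t\<bar> < r" using that by (auto simp: r_def)
    have "summable (\<lambda>k. c k * t ^ k)"
      by (rule powser_inside[OF sums_summable[OF 0[OF r(1,2)]]]) (use r in auto)
    then show ?thesis by (simp add: f_def summable_sums)
  qed
  have "(f \<longlongrightarrow> c 0) (at 0)" by (rule powser_limit_0[OF zero_less_one sums])
  then have "(f \<longlongrightarrow> c 0) (at_right 0)" by (rule tendsto_mono[rotated]) (rule at_le, simp)
  moreover have "\<forall>\<^sub>F t in at_right 0. f t = 0"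
  proof -
    have "\<forall>\<^sub>F t in at_right (0::real). t \<in> {0<..<1}" by (rule eventually_at_rightI[of _ 1]) auto
    then show ?thesis by eventually_elim (use 0 in \<open>simp add: f_def sums_iff\<close>)
  qed
  ultimately have "((\<lambda>t::real. 0::real) \<longlongrightarrow> c 0) (at_right 0)" by (rule Lim_transform_eventually)
  then show ?thesis by (simp add: tendsto_const_iff)
qed

lemma powser_coeffs_zero:
  fixes c :: "nat \<Rightarrow> real"
  assumes "\<And>t. 0 < t \<Longrightarrow> t < 1 \<Longrightarrow> (\<lambda>k. c k * t ^ k) sums 0"
  shows "c k = 0"
  using assms
proof (induction k arbitrary: c)
  case 0
  then show ?case by (rule powser_const_zero)
next
  case (Suc k c)
  have "(\<lambda>k. c (Suc k) * t ^ k) sums 0" if t: "0 < t" "t < 1" for t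
  proof -
    have "(\<lambda>k. c (Suc k) * t ^ Suc k) sums (0 - c 0 * t ^ 0)"
      using Suc.prems[OF t] by (subst sums_Suc_iff) simp
    then have "(\<lambda>k. inverse t * (c (Suc k) * t ^ Suc k)) sums (inverse t * 0)"
      using powser_const_zero[OF Suc.prems] by (intro sums_mult) simp
    then show ?thesis using t by (simp add: field_simps)
  qed
  from Suc.IH[OF this] show ?case .
qed

text \<open>Coordinates are converted one at a time from a generating variable to the event
  \<open>X i = enat (v i)\<close>, by induction on the set \<open>A\<close> of converted ones. In
  the variable of the next coordinate both sides are power series, compared coefficientwise.
  Infinite values enter no coefficient, because \<open>epow\<close> vanishes there.\<close>

lemma pgf_determines_joint:
  fixes X :: "'i \<Rightarrow> 'a \<Rightarrow> enat" and m :: "'i \<Rightarrow> real"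
  assumes M: "prob_space M" and I: "finite I"
    and X: "\<And>i. i \<in> I \<Longrightarrow> X i \<in> measurable M (count_space UNIV)"
    and pgf: "\<And>s. (\<And>i. 0 < s i \<and> s i < 1) \<Longrightarrow>
      (\<integral>w. (\<Prod>i\<in>I. epow (s i) (X i w)) \<partial>M) = (\<Prod>i\<in>I. exp (- (1 - s i) * m i))"
  shows "measure M {w\<in>space M. \<forall>i\<in>I. X i w = enat (v i)} = (\<Prod>i\<in>I. exp (- m i) * m i ^ v i / fact (v i))"
proof -
  interpret prob_space M by fact
  define ind where "ind i w = (if X i w = enat (v i) then 1 else 0 :: real)" for i w
  have "(\<integral>w. (\<Prod>i\<in>A. ind i w) * (\<Prod>i\<in>I - A. epow (s i) (X i w)) \<partial>M) =
      (\<Prod>i\<in>A. exp (- m i) * m i ^ v i / fact (v i)) * (\<Prod>i\<in>I - A. exp (- (1 - s i) * m i))"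
    if "finite A" "A \<subseteq> I" "\<And>i. 0 < s i \<and> s i < 1" for A s
    using that
  proof (induction A arbitrary: s)
    case empty
    then show ?case using pgf by simp
  next
    case (insert a A)
    have a: "a \<in> I" and [measurable]: "X a \<in> measurable M (count_space UNIV)" using insert.prems X by auto
    define Y where "Y w = (\<Prod>i\<in>A. ind i w) * (\<Prod>i\<in>I - insert a A. epow (s i) (X i w))" for w
    define R where "R = (\<Prod>i\<in>A. exp (- m i) * m i ^ v i / fact (v i)) * (\<Prod>i\<in>I - insert a A. exp (- (1 - s i) * m i))"
    have Y_meas [measurable]: "Y \<in> borel_measurable M"
    proof -
      have "ind i \<in> borel_measurable M" if "i \<in> I" for i
        using measurable_compose[OF X[OF that], of "\<lambda>e. if e = enat (v i) then 1 else 0 :: real" borel]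
        by (simp add: ind_def[abs_def])
      moreover have "(\<lambda>w. epow (s i) (X i w)) \<in> borel_measurable M" if "i \<in> I" for i
        using measurable_compose[OF X[OF that], of "epow (s i)" borel] by simp
      ultimately show ?thesis unfolding Y_def using insert.prems
        by (intro borel_measurable_times borel_measurable_prod) auto
    qed
    have Y01: "0 \<le> Y w" "Y w \<le> 1" for w
    proof -
      have 1: "0 \<le> (\<Prod>i\<in>A. ind i w)" "(\<Prod>i\<in>A. ind i w) \<le> 1"
        by (auto intro!: prod_nonneg prod_le_1 simp: ind_def)
      have 2: "0 \<le> (\<Prod>i\<in>I - insert a A. epow (s i) (X i w))" "(\<Prod>i\<in>I - insert a A. epow (s i) (X i w)) \<le> 1"
        using insert.prems by (auto intro!: prod_nonneg prod_le_1 epow_bounds simp: less_imp_le)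
      show "0 \<le> Y w" unfolding Y_def using 1 2 by (intro mult_nonneg_nonneg)
      show "Y w \<le> 1" unfolding Y_def using 1 2 by (intro mult_le_one)
    qed
    define b where "b j = (\<integral>w. Y w * indicator {w. X a w = enat j} w \<partial>M)" for j
    have int_j: "integrable M (\<lambda>w. Y w * indicator {w. X a w = enat j} w * c)" for j c
    proof (rule integrable_const_bound[where B = "\<bar>c\<bar>"])
      show "AE w in M. norm (Y w * indicator {w. X a w = enat j} w * c) \<le> \<bar>c\<bar>"
        using Y01 by (intro AE_I2) (auto simp: abs_mult indicator_def mult_left_le_one_le)
    qed measurable
    have b_sums: "(\<lambda>j. b j * t ^ j) sums (\<integral>w. Y w * epow t (X a w) \<partial>M)" if t: "0 < t" "t < 1" for t
    proof -
      have pt: "(\<lambda>j. Y w * indicator {w. X a w = enat j} w * t ^ j) sums (Y w * epow t (X a w))" for w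
      proof (cases "X a w")
        case (enat j)
        have "(\<lambda>i. if i = j then Y w * t ^ i else 0) sums (Y w * t ^ j)" by (rule sums_single)
        moreover have "(\<lambda>i. Y w * indicator {w. X a w = enat i} w * t ^ i) = (\<lambda>i. if i = j then Y w * t ^ i else 0)"
          using enat by (auto simp: indicator_def)
        ultimately show ?thesis using enat by simp
      qed (simp add: indicator_def)
      have "(\<lambda>j. \<integral>w. Y w * indicator {w. X a w = enat j} w * t ^ j \<partial>M) sums
          (\<integral>w. (\<Sum>j. Y w * indicator {w. X a w = enat j} w * t ^ j) \<partial>M)"
      proof (rule sums_integral)
        show "AE w in M. summable (\<lambda>j. norm (Y w * indicator {w. X a w = enat j} w * t ^ j))"
          using pt Y01 t by (intro AE_I2) (auto simp: abs_mult sums_iff)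
        show "summable (\<lambda>j. \<integral>w. norm (Y w * indicator {w. X a w = enat j} w * t ^ j) \<partial>M)"
        proof (rule summable_comparison_test'[of "\<lambda>j. t ^ j" 0])
          show "summable (\<lambda>j. t ^ j)" using t by (intro summable_geometric) auto
          fix j
          have "(\<integral>w. norm (Y w * indicator {w. X a w = enat j} w * t ^ j) \<partial>M) \<le> (\<integral>w. t ^ j \<partial>M)"
            using int_j[of j "t ^ j"] Y01 t
            by (intro integral_mono integrable_norm) (auto simp: abs_mult indicator_def mult_left_le_one_le)
          then show "norm (\<integral>w. norm (Y w * indicator {w. X a w = enat j} w * t ^ j) \<partial>M) \<le> t ^ j"
            by (simp add: prob_space)
        qed
      qed (rule int_j)
      then show ?thesis using pt by (simp add: b_def sums_iff)
    qed
    \<comment> \<open>The induction hypothesis covers every admissible \<open>s\<close>, so the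
      entry at \<open>a\<close> can be replaced by a free variable \<open>t\<close>.\<close>
    have main: "(\<integral>w. Y w * epow t (X a w) \<partial>M) = R * exp (- (1 - t) * m a)" if t: "0 < t" "t < 1" for t
    proof -
      have IH: "(\<integral>w. (\<Prod>i\<in>A. ind i w) * (\<Prod>i\<in>I - A. epow ((s(a := t)) i) (X i w)) \<partial>M) =
        (\<Prod>i\<in>A. exp (- m i) * m i ^ v i / fact (v i)) * (\<Prod>i\<in>I - A. exp (- (1 - (s(a := t)) i) * m i))"
        using insert.prems t by (intro insert.IH) auto
      have eq: "I - A = insert a (I - insert a A)" using a insert.hyps by auto
      have split: "(\<Prod>i\<in>I - A. h ((s(a := t)) i) i) = h t a * (\<Prod>i\<in>I - insert a A. h (s i) i)" for h :: "real \<Rightarrow> 'i \<Rightarrow> real"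
        unfolding eq using I by (subst prod.insert) (auto intro!: prod.cong)
      show ?thesis
        using IH unfolding split[of "\<lambda>u i. epow u (X i _)"] split[of "\<lambda>u i. exp (- (1 - u) * m i)"]
        by (simp add: Y_def R_def mult_ac)
    qed
    have "b (v a) - R * exp (- m a) * m a ^ v a / fact (v a) = 0"
    proof (rule powser_coeffs_zero[of "\<lambda>j. b j - R * exp (- m a) * m a ^ j / fact j"])
      fix t :: real assume t: "0 < t" "t < 1"
      have "(\<lambda>j. (m a * t) ^ j /\<^sub>R fact j) sums exp (m a * t)" by (rule exp_converges)
      then have "(\<lambda>j. R * exp (- m a) * ((m a * t) ^ j /\<^sub>R fact j)) sums (R * exp (- m a) * exp (m a * t))"
        by (rule sums_mult)
      also have "R * exp (- m a) * exp (m a * t) = R * exp (- (1 - t) * m a)"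
        by (simp add: exp_add[symmetric] mult.assoc) (simp add: algebra_simps)
      finally have "(\<lambda>j. R * exp (- m a) * m a ^ j / fact j * t ^ j) sums (R * exp (- (1 - t) * m a))"
        by (simp add: power_mult_distrib divide_inverse mult_ac)
      from sums_diff[OF b_sums[OF t] this]
      show "(\<lambda>j. (b j - R * exp (- m a) * m a ^ j / fact j) * t ^ j) sums 0"
        by (simp add: main[OF t] left_diff_distrib)
    qed
    moreover have "b (v a) = (\<integral>w. (\<Prod>i\<in>insert a A. ind i w) * (\<Prod>i\<in>I - insert a A. epow (s i) (X i w)) \<partial>M)"
      unfolding b_def using insert.hyps
      by (intro Bochner_Integration.integral_cong refl) (simp add: Y_def ind_def indicator_def)
    ultimately show ?case
      using insert.hyps by (simp add: R_def mult_ac)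
  qed
  from this[of I "\<lambda>_. 1/2"] I
  have "(\<integral>w. (\<Prod>i\<in>I. ind i w) \<partial>M) = (\<Prod>i\<in>I. exp (- m i) * m i ^ v i / fact (v i))" by simp
  moreover have "(\<integral>w. (\<Prod>i\<in>I. ind i w) \<partial>M) = (\<integral>w. indicator {w\<in>space M. \<forall>i\<in>I. X i w = enat (v i)} w \<partial>M)"
    using I by (intro Bochner_Integration.integral_cong refl) (auto simp: ind_def indicator_def)
  moreover have "{w\<in>space M. \<forall>i\<in>I. X i w = enat (v i)} \<in> sets M"
  proof -
    have "{w\<in>space M. X i w = enat (v i)} \<in> sets M" if "i \<in> I" for i
      using measurable_sets[OF X[OF that], of "{enat (v i)}"] by (simp add: vimage_def Int_def conj_commute)
    then show ?thesis using I by (intro sets.sets_Collect_finite_All) auto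
  qed
  ultimately show ?thesis by simp
qed

section \<open>Poisson point processes on the unit interval\<close>

lemma nn_integral_PiM_prod:
  fixes f :: "'i \<Rightarrow> 'a \<Rightarrow> ennreal"
  assumes M: "\<And>i. prob_space (M i)" and J: "finite J"
    and f: "\<And>i. i \<in> J \<Longrightarrow> f i \<in> borel_measurable (M i)"
  shows "(\<integral>\<^sup>+w. (\<Prod>i\<in>J. f i (w i)) \<partial>PiM UNIV M) = (\<Prod>i\<in>J. \<integral>\<^sup>+x. f i x \<partial>M i)"
proof -
  interpret product_prob_space M UNIV
    using M by (rule product_prob_spaceI)
  have meas: "(\<lambda>w. \<Prod>i\<in>J. f i (w i)) \<in> borel_measurable (PiM J M)"
    using f J by (intro borel_measurable_prod_ennreal) (auto intro: measurable_compose[OF measurable_component_singleton])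
  have "(\<integral>\<^sup>+w. (\<Prod>i\<in>J. f i (w i)) \<partial>PiM UNIV M) =
      (\<integral>\<^sup>+w. (\<Prod>i\<in>J. f i (restrict w J i)) \<partial>PiM UNIV M)"
    by (intro nn_integral_cong prod.cong) auto
  also have "\<dots> = (\<integral>\<^sup>+w. (\<Prod>i\<in>J. f i (w i)) \<partial>distr (PiM UNIV M) (PiM J M) (\<lambda>w. restrict w J))"
    using meas by (subst nn_integral_distr) (auto intro: measurable_restrict_subset)
  also have "distr (PiM UNIV M) (PiM J M) (\<lambda>w. restrict w J) = PiM J M"
    using J M by (intro distr_PiM_restrict_finite) auto
  also have "(\<integral>\<^sup>+w. (\<Prod>i\<in>J. f i (w i)) \<partial>PiM J M) = (\<Prod>i\<in>J. \<integral>\<^sup>+x. f i x \<partial>M i)"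
    using f J by (intro product_nn_integral_prod) auto
  finally show ?thesis .
qed

text \<open>Rate 0 does occur: for \<open>\<gamma> = 0\<close> the intensity vanishes on every slab,
  and the Poisson law degenerates to the point mass at 0.\<close>

definition poisson0 :: "real \<Rightarrow> nat pmf" where
  "poisson0 a = (if a = 0 then return_pmf 0 else poisson_pmf a)"

lemma nn_integral_poisson0_power:
  assumes a: "a \<ge> 0" and c: "c \<ge> 0"
  shows "(\<integral>\<^sup>+N. ennreal c ^ N \<partial>poisson0 a) = ennreal (exp (a * (c - 1)))"
proof (cases "a = 0")
  case False
  then have a0: "a > 0" using a by simp
  have "(\<integral>\<^sup>+N. ennreal c ^ N \<partial>poisson0 a) = (\<integral>\<^sup>+N. ennreal (pmf (poisson_pmf a) N) * ennreal c ^ N \<partial>count_space UNIV)"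
    using False by (simp add: poisson0_def nn_integral_measure_pmf)
  also have "\<dots> = (\<Sum>N. ennreal ((a * c) ^ N /\<^sub>R fact N * exp (- a)))"
    using a0 c by (simp add: nn_integral_count_space_nat ennreal_power ennreal_mult'[symmetric] power_mult_distrib divide_inverse mult_ac)
  also have "\<dots> = ennreal (exp (a * c) * exp (- a))"
    using a0 c by (intro suminf_ennreal_eq sums_mult2 exp_converges) auto
  finally show ?thesis by (simp add: exp_add[symmetric] right_diff_distrib)
qed (simp add: poisson0_def)

locale slab_finite =
  fixes \<mu> :: "real measure"
  assumes sets_mu: "sets \<mu> = sets borel" and slab_fin: "\<And>j. emeasure \<mu> (slab j) < \<infinity>"
begin

text \<open>A Poisson number of independent points is thrown into each slab; the value of \<open>\<nu> j\<close> on a slab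
  of mass 0 is irrelevant.\<close>

definition \<nu> :: "nat \<Rightarrow> real measure" where
  "\<nu> j = (if emeasure \<mu> (slab j) = 0 then return borel 1 else uniform_measure \<mu> (slab j))"

text \<open>A random number of points together with an infinite sequence of candidate positions, of
  which an initial piece of that length is used; the product space then does not depend on the
  number.\<close>

definition \<Omega>j :: "nat \<Rightarrow> (nat \<times> (nat \<Rightarrow> real)) measure" where
  "\<Omega>j j = measure_pmf (poisson0 (measure \<mu> (slab j))) \<Otimes>\<^sub>M PiM UNIV (\<lambda>_. \<nu> j)"

definition \<Omega> :: "(nat \<Rightarrow> nat \<times> (nat \<Rightarrow> real)) measure" where
  "\<Omega> = PiM UNIV \<Omega>j"

text \<open>At \<open>y\<close> only the cloud of the slab containing \<open>y\<close> is consulted,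
  so a candidate that falls outside its own slab is dropped. This makes every outcome, not just
  almost every one, a configuration.\<close>

definition \<xi> :: "(nat \<Rightarrow> nat \<times> (nat \<Rightarrow> real)) \<Rightarrow> real \<Rightarrow> nat" where
  "\<xi> w y = (if 0 < y \<and> y \<le> 1
     then card {i. i < fst (w (slab_index y)) \<and> snd (w (slab_index y)) i = y} else 0)"

lemma sets_nu [measurable_cong]: "sets (\<nu> j) = sets borel"
  by (simp add: \<nu>_def sets_mu)

lemma prob_space_nu: "prob_space (\<nu> j)"
  using slab_fin[of j] by (auto simp: \<nu>_def intro!: prob_space_return prob_space_uniform_measure)

text \<open>The product form avoids a case distinction later: on a slab of mass 0 both sides vanish,
  whatever \<open>\<nu> j\<close> is.\<close>

lemma measure_nu:
  assumes "B \<in> sets borel"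
  shows "measure \<mu> (slab j) * measure (\<nu> j) B = measure \<mu> (B \<inter> slab j)"
proof (cases "emeasure \<mu> (slab j) = 0")
  case True
  then have "emeasure \<mu> (B \<inter> slab j) = 0"
    using emeasure_mono[of "B \<inter> slab j" "slab j" \<mu>] by (simp add: sets_mu)
  then show ?thesis using True by (simp add: measure_def)
next
  case False
  then have "measure \<mu> (slab j) \<noteq> 0" using slab_fin[of j] by (simp add: measure_def enn2real_eq_0_iff)
  moreover have "measure (\<nu> j) B = measure \<mu> (slab j \<inter> B) / measure \<mu> (slab j)"
    using False slab_fin[of j] assms
    by (auto simp: \<nu>_def sets_mu intro!: measure_uniform_measure)
  ultimately show ?thesis by (simp add: Int_commute)
qed

lemma prob_space_Omegaj: "prob_space (\<Omega>j j)"
proof -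
  interpret A: prob_space "measure_pmf (poisson0 (measure \<mu> (slab j)))" by (rule prob_space_measure_pmf)
  interpret B: prob_space "PiM UNIV (\<lambda>_::nat. \<nu> j)" by (intro prob_space_PiM prob_space_nu)
  interpret P: pair_prob_space "measure_pmf (poisson0 (measure \<mu> (slab j)))" "PiM UNIV (\<lambda>_::nat. \<nu> j)" ..
  show ?thesis unfolding \<Omega>j_def by (rule P.prob_space_axioms)
qed

lemma prob_space_Omega: "prob_space \<Omega>"
  unfolding \<Omega>_def by (intro prob_space_PiM prob_space_Omegaj)

lemma xi_Conf: "\<xi> w \<in> Conf"
proof -
  have "finite {y. a \<le> y \<and> 0 < \<xi> w y}" if a: "a > 0" for a
  proof (rule finite_subset)
    show "{y. a \<le> y \<and> 0 < \<xi> w y} \<subseteq> (\<Union>j\<in>{..nat \<lfloor>1 / a\<rfloor>}. snd (w j) ` {..<fst (w j)})"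
    proof
      fix y assume y: "y \<in> {y. a \<le> y \<and> 0 < \<xi> w y}"
      then have y01: "0 < y" "y \<le> 1" by (auto simp: \<xi>_def split: if_splits)
      then have "card {i. i < fst (w (slab_index y)) \<and> snd (w (slab_index y)) i = y} > 0"
        using y by (simp add: \<xi>_def)
      then obtain i where i: "i < fst (w (slab_index y))" "snd (w (slab_index y)) i = y"
        by (auto simp: card_gt_0_iff)
      have "1 / y \<le> 1 / a" using y a by (intro divide_left_mono) auto
      then have "slab_index y \<le> nat \<lfloor>1 / a\<rfloor>" unfolding slab_index_def
        by (meson diff_le_self floor_mono nat_mono order_trans)
      then show "y \<in> (\<Union>j\<in>{..nat \<lfloor>1 / a\<rfloor>}. snd (w j) ` {..<fst (w j)})"
        using i(1) i(2)[symmetric] by (intro UN_I[of "slab_index y"] image_eqI[of _ _ i]) auto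
    qed
  qed auto
  moreover have "0 < y \<and> y \<le> 1" if "0 < \<xi> w y" for y using that by (auto simp: \<xi>_def split: if_splits)
  ultimately show ?thesis by (auto simp: Conf_def)
qed

definition hits :: "real set \<Rightarrow> nat \<Rightarrow> nat \<times> (nat \<Rightarrow> real) \<Rightarrow> nat" where
  "hits B j z = card {i. i < fst z \<and> snd z i \<in> B \<inter> slab j}"

lemma cnt_upto_xi: "cnt_upto (\<xi> w) B n = (\<Sum>j<n. hits B j (w j))"
  unfolding cnt_upto_def
proof (intro sum.cong refl)
  fix j
  define u where "u = snd (w j)"
  define S where "S = {i. i < fst (w j) \<and> u i \<in> B \<inter> slab j}"
  have finS: "finite S" by (simp add: S_def)
  have xi: "\<xi> w y = card {i. i < fst (w j) \<and> u i = y}" if "y \<in> slab j" for y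
    using that slab_subset[of j] slab_index_iff[of y j] by (auto simp: \<xi>_def u_def)
  have "{y\<in>B \<inter> slab j. 0 < \<xi> w y} = u ` S"
    by (auto simp: xi S_def card_gt_0_iff)
  then have "(\<Sum>y\<in>{y\<in>B \<inter> slab j. 0 < \<xi> w y}. \<xi> w y) = (\<Sum>y\<in>u ` S. \<xi> w y)" by simp
  also have "\<dots> = (\<Sum>y\<in>u ` S. \<Sum>i\<in>{i\<in>S. u i = y}. 1)"
  proof (intro sum.cong refl)
    fix y assume "y \<in> u ` S"
    then have "y \<in> B \<inter> slab j" by (auto simp: S_def)
    moreover from this have "{i\<in>S. u i = y} = {i. i < fst (w j) \<and> u i = y}" by (auto simp: S_def)
    ultimately show "\<xi> w y = (\<Sum>i\<in>{i\<in>S. u i = y}. 1)" by (simp add: xi)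
  qed
  also have "\<dots> = (\<Sum>i\<in>S. 1)" using finS by (intro sum.group) auto
  finally show "(\<Sum>y\<in>{y\<in>B \<inter> slab j. 0 < \<xi> w y}. \<xi> w y) = hits B j (w j)"
    by (simp add: hits_def S_def u_def)
qed

lemma measurable_hits:
  assumes "B \<in> sets borel"
  shows "hits B j \<in> measurable (\<Omega>j j) (count_space UNIV)"
proof -
  have [measurable]: "B \<in> sets borel" by fact
  have eq: "hits B j z = (case z of (N, u) \<Rightarrow> \<Sum>i<N. if u i \<in> B \<inter> slab j then 1 else 0)" for z
    by (simp add: hits_def case_prod_beta sum.If_cases Int_def)
  have "(\<lambda>z. (\<lambda>N u. \<Sum>i<N. if u i \<in> B \<inter> slab j then 1 else 0 :: nat) (fst z) (snd z)) \<in> measurable (\<Omega>j j) (count_space UNIV)"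
    unfolding \<Omega>j_def
  proof (rule measurable_compose_countable[where g = fst])
    fix N :: nat
    show "(\<lambda>z. \<Sum>i<N. if snd z i \<in> B \<inter> slab j then 1 else 0 :: nat) \<in>
      measurable (measure_pmf (poisson0 (measure \<mu> (slab j))) \<Otimes>\<^sub>M PiM UNIV (\<lambda>_. \<nu> j)) (count_space UNIV)"
      by measurable
  qed measurable
  then show ?thesis by (simp add: eq[abs_def] case_prod_beta)
qed

text \<open>Given the number \<open>N\<close> of points, independence yields \<open>c^N\<close> with
  \<open>c\<close> the mean of \<open>g\<close> at one point. As the \<open>B l\<close> are
  disjoint, \<open>g\<close> is 1 minus a weighted sum of indicators, so \<open>c\<close> is affine
  in the masses, and the Poisson generating function makes an exponential of it.\<close>

lemma hits_pgf:
  assumes I: "finite I" and B: "\<And>l. l \<in> I \<Longrightarrow> B l \<in> sets borel" and disj: "disjoint_family_on B I"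
    and s: "\<And>l. 0 < s l \<and> s l < 1"
  shows "(\<integral>\<^sup>+z. ennreal (\<Prod>l\<in>I. s l ^ hits (B l) j z) \<partial>\<Omega>j j) =
    ennreal (exp (- (\<Sum>l\<in>I. (1 - s l) * measure \<mu> (B l \<inter> slab j))))"
proof -
  define g where "g u = (\<Prod>l\<in>I. if u \<in> B l \<inter> slab j then s l else 1)" for u
  have g_eq: "g u = 1 - (\<Sum>l\<in>I. (1 - s l) * indicator (B l \<inter> slab j) u)" for u
  proof (cases "\<exists>l\<in>I. u \<in> B l \<inter> slab j")
    case True
    then obtain l where l: "l \<in> I" "u \<in> B l \<inter> slab j" by blast
    have other: "u \<notin> B l'" if "l' \<in> I" "l' \<noteq> l" for l'
      using disj l that unfolding disjoint_family_on_def by blast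
    have "g u = (\<Prod>l'\<in>I. if l' = l then s l else 1)" unfolding g_def using l other by (intro prod.cong) auto
    moreover have "(\<Sum>l'\<in>I. (1 - s l') * indicator (B l' \<inter> slab j) u) = (\<Sum>l'\<in>I. if l' = l then 1 - s l else 0)"
      using l other by (intro sum.cong) (auto simp: indicator_def)
    ultimately show ?thesis using I l by simp
  next
    case False
    have "g u = (\<Prod>l\<in>I. 1)" unfolding g_def using False by (intro prod.cong) auto
    moreover have "(\<Sum>l\<in>I. (1 - s l) * indicator (B l \<inter> slab j) u) = 0"
      using False by (intro sum.neutral) (auto simp: indicator_def)
    ultimately show ?thesis by simp
  qed
  have g01: "0 \<le> g u" for u unfolding g_def using s by (intro prod_nonneg) (auto simp: less_imp_le)
  have [measurable]: "g \<in> borel_measurable borel"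
    unfolding g_eq[abs_def] using B by measurable
  interpret N: prob_space "\<nu> j" by (rule prob_space_nu)
  interpret PN: prob_space "PiM UNIV (\<lambda>_::nat. \<nu> j)" by (intro prob_space_PiM prob_space_nu)
  define c where "c = (\<integral>u. g u \<partial>\<nu> j)"
  have c: "c = 1 - (\<Sum>l\<in>I. (1 - s l) * measure (\<nu> j) (B l \<inter> slab j))"
  proof -
    have int: "integrable (\<nu> j) (\<lambda>u. (1 - s l) * indicator (B l \<inter> slab j) u)" if "l \<in> I" for l
      using B[OF that] by (intro integrable_mult_right integrable_real_indicator) (auto simp: sets_nu N.emeasure_eq_measure)
    have "c = (\<integral>u. 1 \<partial>\<nu> j) - (\<integral>u. (\<Sum>l\<in>I. (1 - s l) * indicator (B l \<inter> slab j) u) \<partial>\<nu> j)"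
      unfolding c_def g_eq using int by (intro Bochner_Integration.integral_diff Bochner_Integration.integrable_sum) auto
    also have "(\<integral>u. (\<Sum>l\<in>I. (1 - s l) * indicator (B l \<inter> slab j) u) \<partial>\<nu> j) =
        (\<Sum>l\<in>I. (1 - s l) * measure (\<nu> j) (B l \<inter> slab j))"
      using int B by (subst Bochner_Integration.integral_sum) (auto intro!: sum.cong simp: sets_nu)
    finally show ?thesis by (simp add: N.prob_space)
  qed
  have g_le: "g u \<le> 1" for u unfolding g_def using s by (intro prod_le_1) (auto simp: less_imp_le)
  have intg: "integrable (\<nu> j) g"
    by (rule N.integrable_const_bound[where B = 1]) (use g01 g_le in auto)
  have c0: "c \<ge> 0" unfolding c_def using g01 by (intro Bochner_Integration.integral_nonneg)
  have nn: "(\<integral>\<^sup>+u. ennreal (g u) \<partial>\<nu> j) = ennreal c"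
    unfolding c_def using intg g01 by (intro nn_integral_eq_integral) auto
  have prod_eq: "(\<Prod>l\<in>I. s l ^ hits (B l) j (M, u)) = (\<Prod>i<M. g (u i))" for M u
  proof -
    have "(\<Prod>i<M. g (u i)) = (\<Prod>l\<in>I. \<Prod>i<M. if u i \<in> B l \<inter> slab j then s l else 1)"
      unfolding g_def by (rule prod.swap)
    also have "\<dots> = (\<Prod>l\<in>I. s l ^ hits (B l) j (M, u))"
      by (intro prod.cong refl) (simp add: hits_def prod.If_cases Int_def)
    finally show ?thesis ..
  qed
  have "(\<integral>\<^sup>+z. ennreal (\<Prod>l\<in>I. s l ^ hits (B l) j z) \<partial>\<Omega>j j) =
      (\<integral>\<^sup>+M. \<integral>\<^sup>+u. ennreal (\<Prod>l\<in>I. s l ^ hits (B l) j (M, u)) \<partial>PiM UNIV (\<lambda>_. \<nu> j) \<partial>poisson0 (measure \<mu> (slab j)))"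
    unfolding \<Omega>j_def
  proof (rule PN.nn_integral_fst[symmetric])
    have "(\<lambda>z. \<Prod>l\<in>I. s l ^ hits (B l) j z) \<in> borel_measurable (\<Omega>j j)"
    proof (intro borel_measurable_prod)
      fix l assume "l \<in> I"
      show "(\<lambda>z. s l ^ hits (B l) j z) \<in> borel_measurable (\<Omega>j j)"
        using measurable_compose[OF measurable_hits[OF B[OF \<open>l \<in> I\<close>]], of "\<lambda>n. s l ^ n" borel j] by simp
    qed
    then show "(\<lambda>z. ennreal (\<Prod>l\<in>I. s l ^ hits (B l) j z)) \<in>
        borel_measurable (measure_pmf (poisson0 (measure \<mu> (slab j))) \<Otimes>\<^sub>M PiM UNIV (\<lambda>_. \<nu> j))"
      unfolding \<Omega>j_def by measurable
  qed
  also have "\<dots> = (\<integral>\<^sup>+M. ennreal c ^ M \<partial>poisson0 (measure \<mu> (slab j)))"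
  proof (intro nn_integral_cong)
    fix M
    have "(\<integral>\<^sup>+u. ennreal (\<Prod>l\<in>I. s l ^ hits (B l) j (M, u)) \<partial>PiM UNIV (\<lambda>_. \<nu> j)) =
        (\<integral>\<^sup>+u. (\<Prod>i<M. ennreal (g (u i))) \<partial>PiM UNIV (\<lambda>_. \<nu> j))"
      unfolding prod_eq using g01 by (simp add: prod_ennreal)
    also have "\<dots> = (\<Prod>i<M. \<integral>\<^sup>+u. ennreal (g u) \<partial>\<nu> j)"
      by (rule nn_integral_PiM_prod) (auto intro: prob_space_nu)
    finally show "(\<integral>\<^sup>+u. ennreal (\<Prod>l\<in>I. s l ^ hits (B l) j (M, u)) \<partial>PiM UNIV (\<lambda>_. \<nu> j)) = ennreal c ^ M"
      by (simp add: nn)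
  qed
  also have "\<dots> = ennreal (exp (measure \<mu> (slab j) * (c - 1)))"
    using c0 by (intro nn_integral_poisson0_power) auto
  also have "measure \<mu> (slab j) * (c - 1) = - (\<Sum>l\<in>I. (1 - s l) * measure \<mu> (B l \<inter> slab j))"
  proof -
    have "measure \<mu> (slab j) * (\<Sum>l\<in>I. (1 - s l) * measure (\<nu> j) (B l \<inter> slab j)) =
        (\<Sum>l\<in>I. (1 - s l) * (measure \<mu> (slab j) * measure (\<nu> j) (B l \<inter> slab j)))"
      by (simp add: sum_distrib_left mult_ac)
    also have "\<dots> = (\<Sum>l\<in>I. (1 - s l) * measure \<mu> (B l \<inter> slab j))"
      using B by (intro sum.cong refl) (simp add: measure_nu Int_assoc)
    finally show ?thesis by (simp add: c)
  qed
  finally show ?thesis .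
qed

lemma measurable_cnt_upto_xi:
  assumes "B \<in> sets borel"
  shows "(\<lambda>w. cnt_upto (\<xi> w) B n) \<in> measurable \<Omega> (count_space UNIV)"
proof -
  have [measurable]: "(\<lambda>w. hits B j (w j)) \<in> measurable (PiM UNIV \<Omega>j) (count_space UNIV)" for j
    by (rule measurable_compose[OF measurable_component_singleton[of j UNIV \<Omega>j] measurable_hits[OF assms(1)]]) simp
  show ?thesis unfolding cnt_upto_xi \<Omega>_def by measurable
qed

text \<open>\<open>epow (1/2)\<close> is injective on the extended naturals.\<close>

lemma sets_cnt_xi:
  assumes "B \<in> sets borel" "B \<subseteq> {0<..1}"
  shows "{w\<in>space \<Omega>. cnt (\<xi> w) B = c} \<in> sets \<Omega>"
proof -
  have inj: "epow (1/2) a = epow (1/2) b \<longleftrightarrow> a = b" for a b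
    by (cases a; cases b) (auto simp: power_one_over)
  have "(\<lambda>w. epow (1/2) (cnt (\<xi> w) B)) \<in> borel_measurable \<Omega>"
  proof (rule borel_measurable_LIMSEQ_real)
    show "(\<lambda>n. (1/2) ^ cnt_upto (\<xi> w) B n) \<longlonglongrightarrow> epow (1/2) (cnt (\<xi> w) B)" for w
      using assms by (intro epow_cnt_upto xi_Conf) auto
    show "(\<lambda>w. (1/2) ^ cnt_upto (\<xi> w) B n) \<in> borel_measurable \<Omega>" for n
      using measurable_compose[OF measurable_cnt_upto_xi[OF assms(1)], of "\<lambda>n. (1/2) ^ n" borel n] by simp
  qed
  then have "{w\<in>space \<Omega>. epow (1/2) (cnt (\<xi> w) B) = epow (1/2) c} \<in> sets \<Omega>" by measurable
  then show ?thesis by (simp add: inj)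
qed

lemma measurable_xi: "\<xi> \<in> measurable \<Omega> conf_measure"
  unfolding conf_measure_def
proof (rule measurable_measure_of)
  fix A assume "A \<in> {{c\<in>Conf. cnt c B = k} | B k. B \<in> sets borel \<and> B \<subseteq> {0<..1}}"
  then obtain B k where A: "A = {c\<in>Conf. cnt c B = k}" "B \<in> sets borel" "B \<subseteq> {0<..1}" by blast
  have "\<xi> -` A \<inter> space \<Omega> = {w\<in>space \<Omega>. cnt (\<xi> w) B = k}" using xi_Conf by (auto simp: A)
  then show "\<xi> -` A \<inter> space \<Omega> \<in> sets \<Omega>" using sets_cnt_xi A by simp
qed (use xi_Conf in auto)

lemma cnt_upto_pgf:
  assumes I: "finite I" and B: "\<And>l. l \<in> I \<Longrightarrow> B l \<in> sets borel" and disj: "disjoint_family_on B I"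
    and s: "\<And>l. 0 < s l \<and> s l < 1"
  shows "(\<integral>\<^sup>+w. ennreal (\<Prod>l\<in>I. s l ^ cnt_upto (\<xi> w) (B l) n) \<partial>\<Omega>) =
    ennreal (\<Prod>l\<in>I. exp (- (1 - s l) * (\<Sum>j<n. measure \<mu> (B l \<inter> slab j))))"
proof -
  have nonneg: "0 \<le> (\<Prod>l\<in>I. s l ^ hits (B l) j z)" for j z
    using s by (intro prod_nonneg) (auto simp: less_imp_le)
  have "(\<Prod>l\<in>I. s l ^ cnt_upto (\<xi> w) (B l) n) = (\<Prod>j<n. \<Prod>l\<in>I. s l ^ hits (B l) j (w j))" for w
    unfolding cnt_upto_xi power_sum by (rule prod.swap)
  then have "(\<integral>\<^sup>+w. ennreal (\<Prod>l\<in>I. s l ^ cnt_upto (\<xi> w) (B l) n) \<partial>\<Omega>) =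
      (\<integral>\<^sup>+w. (\<Prod>j<n. ennreal (\<Prod>l\<in>I. s l ^ hits (B l) j (w j))) \<partial>\<Omega>)"
    using nonneg by (simp add: prod_ennreal)
  also have "\<dots> = (\<Prod>j<n. \<integral>\<^sup>+z. ennreal (\<Prod>l\<in>I. s l ^ hits (B l) j z) \<partial>\<Omega>j j)"
    unfolding \<Omega>_def
  proof (rule nn_integral_PiM_prod[where f = "\<lambda>j z. ennreal (\<Prod>l\<in>I. s l ^ hits (B l) j z)"])
    fix j
    have "(\<lambda>z. s l ^ hits (B l) j z) \<in> borel_measurable (\<Omega>j j)" if "l \<in> I" for l
      using measurable_compose[OF measurable_hits[OF B[OF that]], of "\<lambda>n. s l ^ n" borel j] by simp
    then show "(\<lambda>z. ennreal (\<Prod>l\<in>I. s l ^ hits (B l) j z)) \<in> borel_measurable (\<Omega>j j)"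
      by (intro measurable_compose[OF _ measurable_ennreal] borel_measurable_prod)
  qed (auto intro: prob_space_Omegaj)
  also have "\<dots> = ennreal (\<Prod>j<n. exp (- (\<Sum>l\<in>I. (1 - s l) * measure \<mu> (B l \<inter> slab j))))"
    using hits_pgf[OF I B disj s] by (simp add: prod_ennreal)
  also have "(\<Prod>j<n. exp (- (\<Sum>l\<in>I. (1 - s l) * measure \<mu> (B l \<inter> slab j)))) =
      (\<Prod>l\<in>I. exp (- (1 - s l) * (\<Sum>j<n. measure \<mu> (B l \<inter> slab j))))"
  proof -
    have "(\<Prod>j<n. exp (- (\<Sum>l\<in>I. (1 - s l) * measure \<mu> (B l \<inter> slab j)))) =
        (\<Prod>j<n. \<Prod>l\<in>I. exp (- (1 - s l) * measure \<mu> (B l \<inter> slab j)))"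
      unfolding sum_negf[symmetric] exp_sum[OF I] by (simp only: mult_minus_left)
    also have "\<dots> = (\<Prod>l\<in>I. \<Prod>j<n. exp (- (1 - s l) * measure \<mu> (B l \<inter> slab j)))"
      by (rule prod.swap)
    also have "\<dots> = (\<Prod>l\<in>I. exp (- (1 - s l) * (\<Sum>j<n. measure \<mu> (B l \<inter> slab j))))"
      by (intro prod.cong refl) (simp add: exp_sum sum_distrib_left)
    finally show ?thesis .
  qed
  finally show ?thesis .
qed

lemma measurable_cnt_xi:
  assumes "B \<in> sets borel" "B \<subseteq> {0<..1}"
  shows "(\<lambda>w. cnt (\<xi> w) B) \<in> measurable \<Omega> (count_space UNIV)"
  using measurable_compose[OF measurable_xi measurable_cnt[OF assms]] .

text \<open>Independence of the slabs gives the formula for points above \<open>1 / (n + 1)\<close>;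
  dominated convergence carries it to all of \<open>B l\<close>, since \<open>epow\<close> is
  continuous along truncated counts.\<close>

lemma cnt_pgf:
  assumes I: "finite I" and B: "\<And>l. l \<in> I \<Longrightarrow> B l \<in> sets borel \<and> B l \<subseteq> {0<..1} \<and> emeasure \<mu> (B l) < \<infinity>"
    and disj: "disjoint_family_on B I" and s: "\<And>l. 0 < s l \<and> s l < 1"
  shows "(\<integral>w. (\<Prod>l\<in>I. epow (s l) (cnt (\<xi> w) (B l))) \<partial>\<Omega>) = (\<Prod>l\<in>I. exp (- (1 - s l) * measure \<mu> (B l)))"
proof -
  interpret prob_space \<Omega> by (rule prob_space_Omega)
  define f where "f n w = (\<Prod>l\<in>I. s l ^ cnt_upto (\<xi> w) (B l) n)" for n w
  have f0: "0 \<le> f n w" for n w unfolding f_def using s by (intro prod_nonneg) (auto simp: less_imp_le)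
  have f1: "f n w \<le> 1" for n w
    unfolding f_def using s by (intro prod_le_1) (auto simp: less_imp_le power_le_one)
  have meas: "f n \<in> borel_measurable \<Omega>" for n
    unfolding f_def
  proof (intro borel_measurable_prod)
    fix l assume "l \<in> I"
    then show "(\<lambda>w. s l ^ cnt_upto (\<xi> w) (B l) n) \<in> borel_measurable \<Omega>"
      using measurable_compose[OF measurable_cnt_upto_xi, of "B l" "\<lambda>n. s l ^ n" borel n] B by simp
  qed
  have "(\<integral>w. f n w \<partial>\<Omega>) = (\<Prod>l\<in>I. exp (- (1 - s l) * (\<Sum>j<n. measure \<mu> (B l \<inter> slab j))))" for n
  proof -
    have "(\<integral>w. f n w \<partial>\<Omega>) = enn2real (\<integral>\<^sup>+w. ennreal (f n w) \<partial>\<Omega>)"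
      using f0 by (intro integral_eq_nn_integral meas) auto
    then show ?thesis
      unfolding f_def using cnt_upto_pgf[OF I _ disj s, where n = n] B by (simp add: prod_nonneg)
  qed
  moreover have "(\<lambda>n. \<integral>w. f n w \<partial>\<Omega>) \<longlonglongrightarrow> (\<integral>w. (\<Prod>l\<in>I. epow (s l) (cnt (\<xi> w) (B l))) \<partial>\<Omega>)"
  proof (rule integral_dominated_convergence[where w = "\<lambda>_. 1"])
    show "(\<lambda>w. \<Prod>l\<in>I. epow (s l) (cnt (\<xi> w) (B l))) \<in> borel_measurable \<Omega>"
    proof (intro borel_measurable_prod)
      fix l assume "l \<in> I"
      then show "(\<lambda>w. epow (s l) (cnt (\<xi> w) (B l))) \<in> borel_measurable \<Omega>"
        using measurable_compose[OF measurable_cnt_xi, of "B l" "epow (s l)" borel] B by simp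
    qed
    show "AE w in \<Omega>. (\<lambda>n. f n w) \<longlonglongrightarrow> (\<Prod>l\<in>I. epow (s l) (cnt (\<xi> w) (B l)))"
      unfolding f_def using B s by (intro AE_I2 tendsto_prod epow_cnt_upto xi_Conf) (auto simp: less_imp_le)
  qed (use meas f0 f1 in auto)
  moreover have "(\<lambda>n. \<Prod>l\<in>I. exp (- (1 - s l) * (\<Sum>j<n. measure \<mu> (B l \<inter> slab j)))) \<longlonglongrightarrow>
      (\<Prod>l\<in>I. exp (- (1 - s l) * measure \<mu> (B l)))"
  proof (intro tendsto_intros)
    fix l assume l: "l \<in> I"
    have "y \<in> slab (slab_index y)" if "0 < y" "y \<le> 1" for y using slab_index_iff[OF that] by simp
    then have Un: "(\<Union>j. B l \<inter> slab j) = B l" using B[OF l] by (auto simp: subset_iff)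
    have "(\<lambda>j. measure \<mu> (B l \<inter> slab j)) sums measure \<mu> (\<Union>j. B l \<inter> slab j)"
    proof (rule measure_UNION)
      show "emeasure \<mu> (\<Union>j. B l \<inter> slab j) \<noteq> \<infinity>" unfolding Un using B[OF l] by (simp add: top.not_eq_extremum)
    qed (use B[OF l] slab_disjoint in \<open>auto simp: sets_mu disjoint_family_on_def\<close>)
    then show "(\<lambda>n. \<Sum>j<n. measure \<mu> (B l \<inter> slab j)) \<longlonglongrightarrow> measure \<mu> (B l)"
      unfolding sums_def Un .
  qed
  ultimately show ?thesis using LIMSEQ_unique by auto
qed

definition Q :: "(real \<Rightarrow> nat) measure" where
  "Q = distr \<Omega> conf_measure \<xi>"

lemma prob_space_Q: "prob_space Q"
  unfolding Q_def by (rule prob_space.prob_space_distr[OF prob_space_Omega measurable_xi])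

lemma sets_Q: "sets Q = sets conf_measure"
  by (simp add: Q_def)

lemma space_Q: "space Q = Conf"
  by (simp add: Q_def)

lemma measurable_cnt_Q:
  "B \<in> sets borel \<Longrightarrow> B \<subseteq> {0<..1} \<Longrightarrow> (\<lambda>c. cnt c B) \<in> measurable Q (count_space UNIV)"
  using measurable_cnt by (simp only: measurable_cong_sets[OF sets_Q refl])

lemma joint_cnt_Q:
  assumes I: "finite I" and B: "\<And>l. l \<in> I \<Longrightarrow> B l \<in> sets borel \<and> B l \<subseteq> {0<..1} \<and> emeasure \<mu> (B l) < \<infinity>"
    and disj: "disjoint_family_on B I"
  shows "measure Q {c\<in>space Q. \<forall>l\<in>I. cnt c (B l) = enat (v l)} =
    (\<Prod>l\<in>I. exp (- measure \<mu> (B l)) * measure \<mu> (B l) ^ v l / fact (v l))"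
proof (rule pgf_determines_joint[OF prob_space_Q I])
  fix s :: "'a \<Rightarrow> real" assume s: "\<And>l. 0 < s l \<and> s l < 1"
  have "(\<lambda>c. \<Prod>l\<in>I. epow (s l) (cnt c (B l))) \<in> borel_measurable conf_measure"
  proof (intro borel_measurable_prod)
    fix l assume "l \<in> I"
    then show "(\<lambda>c. epow (s l) (cnt c (B l))) \<in> borel_measurable conf_measure"
      using measurable_compose[OF measurable_cnt, of "B l" "epow (s l)" borel] B by simp
  qed
  then have "(\<integral>c. (\<Prod>l\<in>I. epow (s l) (cnt c (B l))) \<partial>Q) = (\<integral>w. (\<Prod>l\<in>I. epow (s l) (cnt (\<xi> w) (B l))) \<partial>\<Omega>)"
    unfolding Q_def by (rule integral_distr[OF measurable_xi])
  also have "\<dots> = (\<Prod>l\<in>I. exp (- (1 - s l) * measure \<mu> (B l)))"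
    by (rule cnt_pgf[OF I B disj s])
  finally show "(\<integral>c. (\<Prod>l\<in>I. epow (s l) (cnt c (B l))) \<partial>Q) = (\<Prod>l\<in>I. exp (- (1 - s l) * measure \<mu> (B l)))" .
qed (use B measurable_cnt_Q in auto)

end

text \<open>Singletons of finite values form, with \<open>{}\<close> and \<open>UNIV\<close>, an
  intersection-stable generator; \<open>{\<infinity>}\<close> arises as a complement. Choosing
  \<open>UNIV\<close> drops a coordinate, which is why \<open>joint\<close> ranges over all subsets
  \<open>J\<close>.\<close>

lemma (in prob_space) indep_vars_enatI:
  fixes X :: "'i \<Rightarrow> 'a \<Rightarrow> enat"
  assumes I: "finite I" and X: "\<And>i. i \<in> I \<Longrightarrow> X i \<in> measurable M (count_space UNIV)"
    and joint: "\<And>J v. J \<subseteq> I \<Longrightarrow> prob {w\<in>space M. \<forall>i\<in>J. X i w = enat (v i)} =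
      (\<Prod>i\<in>J. prob {w\<in>space M. X i w = enat (v i)})"
  shows "indep_vars (\<lambda>_. count_space UNIV) X I"
proof (cases "I = {}")
  case True
  then show ?thesis by (simp add: indep_vars_def indep_sets_def)
next
  case False
  define E :: "enat set set" where "E = insert {} (insert UNIV (range (\<lambda>m. {enat m})))"
  show ?thesis
  proof (subst indep_vars_finite[OF False I, where E = "\<lambda>_. E"])
    have "sigma_sets UNIV E = Pow UNIV"
    proof (intro antisym subsetI)
      fix A :: "enat set"
      interpret S: sigma_algebra UNIV "sigma_sets UNIV E" by (rule sigma_algebra_sigma_sets) auto
      have single: "{e} \<in> sigma_sets UNIV E" for e
      proof (cases e)
        case (enat m)
        then show ?thesis by (intro sigma_sets.Basic) (auto simp: E_def)
      next
        case infinity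
        have "(\<Union>m. {enat m}) \<in> sigma_sets UNIV E"
          by (intro S.countable_UN) (auto simp: E_def intro!: sigma_sets.Basic)
        then have "UNIV - (\<Union>m. {enat m}) \<in> sigma_sets UNIV E" by (rule S.compl_sets)
        also have "UNIV - (\<Union>m. {enat m}) = {e}"
        proof (rule set_eqI)
          fix x show "x \<in> UNIV - (\<Union>m. {enat m}) \<longleftrightarrow> x \<in> {e}"
            using infinity by (cases x) auto
        qed
        finally show ?thesis .
      qed
      have "(\<Union>e\<in>A. {e}) \<in> sigma_sets UNIV E"
        using single by (intro S.countable_UN') auto
      then show "A \<in> sigma_sets UNIV E" by simp
    qed simp
    then show "sets (count_space UNIV) = sigma_sets (space (count_space UNIV)) E" by simp
    show "Int_stable E" by (auto simp: Int_stable_def E_def)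
    show "\<forall>A\<in>\<Pi> i\<in>I. E. prob (\<Inter>j\<in>I. X j -` A j \<inter> space M) = (\<Prod>j\<in>I. prob (X j -` A j \<inter> space M))"
    proof
      fix A assume A: "A \<in> (\<Pi> i\<in>I. E)"
      show "prob (\<Inter>j\<in>I. X j -` A j \<inter> space M) = (\<Prod>j\<in>I. prob (X j -` A j \<inter> space M))"
      proof (cases "\<exists>i\<in>I. A i = {}")
        case True
        then obtain i where i: "i \<in> I" "A i = {}" by blast
        then have "(\<Inter>j\<in>I. X j -` A j \<inter> space M) = {}" by blast
        moreover have "(\<Prod>j\<in>I. prob (X j -` A j \<inter> space M)) = 0" using i I by (intro prod_zero bexI[of _ i]) auto
        ultimately show ?thesis by simp
      next
        case False
        define J where "J = {i\<in>I. A i \<noteq> UNIV}"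
        define v where "v i = (SOME m. A i = {enat m})" for i
        have v: "A i = {enat (v i)}" if "i \<in> J" for i
        proof -
          have "\<exists>m. A i = {enat m}" using that A False by (auto simp: J_def E_def Pi_iff)
          then show ?thesis unfolding v_def by (rule someI_ex)
        qed
        have U: "A i = UNIV" if "i \<in> I" "i \<notin> J" for i using that by (simp add: J_def)
        have "(\<Inter>j\<in>I. X j -` A j \<inter> space M) = {w\<in>space M. \<forall>i\<in>J. X i w = enat (v i)}"
        proof (intro set_eqI iffI)
          fix w assume w: "w \<in> (\<Inter>j\<in>I. X j -` A j \<inter> space M)"
          moreover have "J \<subseteq> I" by (auto simp: J_def)
          ultimately have "w \<in> space M" "\<forall>i\<in>J. X i w \<in> A i" using \<open>I \<noteq> {}\<close> by auto
          then show "w \<in> {w\<in>space M. \<forall>i\<in>J. X i w = enat (v i)}" using v by auto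
        next
          fix w assume "w \<in> {w\<in>space M. \<forall>i\<in>J. X i w = enat (v i)}"
          then have "w \<in> space M" "X i w \<in> A i" if "i \<in> I" for i
            using that v[of i] U[of i] by (cases "i \<in> J"; auto)+
          then show "w \<in> (\<Inter>j\<in>I. X j -` A j \<inter> space M)" by auto
        qed
        then have "prob (\<Inter>j\<in>I. X j -` A j \<inter> space M) = (\<Prod>i\<in>J. prob {w\<in>space M. X i w = enat (v i)})"
          using joint[of J v] by (simp add: J_def)
        also have "\<dots> = (\<Prod>i\<in>J. prob (X i -` A i \<inter> space M))"
          using v by (intro prod.cong refl arg_cong[where f = prob]) auto
        also have "\<dots> = (\<Prod>i\<in>I. prob (X i -` A i \<inter> space M))"
          using I U by (intro prod.mono_neutral_left) (auto simp: J_def prob_space)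
        finally show ?thesis .
      qed
    qed
  qed (use X in \<open>auto simp: E_def\<close>)
qed

context slab_finite
begin

text \<open>The process is canonical: the configuration space carries its law, and the identity is
  the process. Single counts are the one-element case of the joint formula, which therefore
  factorizes.\<close>

theorem poisson_pp_Q: "is_poisson_pp Q \<mu> (\<lambda>c. c)"
proof -
  interpret Q: prob_space Q by (rule prob_space_Q)
  have single: "measure Q {c\<in>space Q. cnt c B = enat k} = exp (- measure \<mu> B) * measure \<mu> B ^ k / fact k"
    if "B \<in> sets borel \<and> B \<subseteq> {0<..1} \<and> emeasure \<mu> B < \<infinity>" for B k
    using joint_cnt_Q[of "{()}" "\<lambda>_. B" "\<lambda>_. k"] that by (simp add: disjoint_family_on_def)
  show ?thesis
    unfolding is_poisson_pp_def
  proof (intro conjI allI impI)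
    show "prob_space Q" by (rule prob_space_Q)
    show "(\<lambda>c. c) \<in> measurable Q conf_measure" by (rule measurable_ident_sets[OF sets_Q])
    fix B k assume "B \<in> sets borel \<and> B \<subseteq> {0<..1} \<and> emeasure \<mu> B < \<infinity>"
    from single[OF this]
    show "measure Q {c\<in>space Q. cnt c B = enat k} =
        exp (- enn2real (emeasure \<mu> B)) * enn2real (emeasure \<mu> B) ^ k / fact k"
      by (simp add: measure_def)
  next
    fix m :: nat and B
    assume B: "(\<forall>i<m. B i \<in> sets borel \<and> B i \<subseteq> {0<..1} \<and> emeasure \<mu> (B i) < \<infinity>) \<and> disjoint_family_on B {..<m}"
    show "Q.indep_vars (\<lambda>_. count_space UNIV) (\<lambda>i c. cnt c (B i)) {..<m}"
    proof (rule Q.indep_vars_enatI)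
      fix J v assume J: "J \<subseteq> {..<m}"
      have "finite J" using J finite_subset by blast
      then have "Q.prob {c\<in>space Q. \<forall>i\<in>J. cnt c (B i) = enat (v i)} =
          (\<Prod>i\<in>J. exp (- measure \<mu> (B i)) * measure \<mu> (B i) ^ v i / fact (v i))"
        using B J disjoint_family_on_mono[OF J, of B] by (intro joint_cnt_Q) auto
      also have "\<dots> = (\<Prod>i\<in>J. Q.prob {c\<in>space Q. cnt c (B i) = enat (v i)})"
        using B J by (intro prod.cong refl single[symmetric]) auto
      finally show "Q.prob {c\<in>space Q. \<forall>i\<in>J. cnt c (B i) = enat (v i)} =
          (\<Prod>i\<in>J. Q.prob {c\<in>space Q. cnt c (B i) = enat (v i)})" .
    qed (use B measurable_cnt_Q in auto)
  qed
qed

lemma prob_level_Q: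
  assumes len: "length v = d" and fin: "\<And>i. i < d \<Longrightarrow> emeasure \<mu> (cell d i) < \<infinity>"
  shows "measure Q {c\<in>Conf. level d c = v} =
    (\<Prod>i<d. exp (- measure \<mu> (cell d i)) * measure \<mu> (cell d i) ^ (v ! i) / fact (v ! i))"
proof -
  have cnt_cell: "cnt c (cell d i) = enat (level d c ! i)" if "c \<in> Conf" "i < d" for c i
    using finite_cell_support[OF that(1), of d i] by (simp add: nth_level[OF that] cnt_def)
  have "level d c = v \<longleftrightarrow> (\<forall>i\<in>{..<d}. cnt c (cell d i) = enat (v ! i))" if "c \<in> Conf" for c
  proof -
    have "level d c = v \<longleftrightarrow> (\<forall>i<d. level d c ! i = v ! i)"
      using len by (auto simp: list_eq_iff_nth_eq level_def)
    then show ?thesis using that by (auto simp: cnt_cell)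
  qed
  then have "{c\<in>Conf. level d c = v} = {c\<in>space Q. \<forall>i\<in>{..<d}. cnt c (cell d i) = enat (v ! i)}"
    by (auto simp: space_Q)
  then show ?thesis
    using joint_cnt_Q[of "{..<d}" "cell d" "\<lambda>i. v ! i"] cell_subset fin cell_disjoint
    by (simp add: disjoint_family_on_def)
qed

end

section \<open>Convergence of the point process\<close>

lemma log_pp_Conf:
  assumes "n \<ge> 2" "\<forall>m\<in>set xs. m \<le> n"
  shows "log_pp n xs \<in> Conf"
proof -
  have sub: "{y. 0 < log_pp n xs y} \<subseteq> (\<lambda>m. ln (real m) / ln (real n)) ` set xs"
    by (auto simp: log_pp_def filter_empty_conv)
  have "y \<in> {0<..1}" if "0 < log_pp n xs y" for y
  proof -
    from that obtain m where m: "m \<in> set xs" "1 < m" "y = ln (real m) / ln (real n)"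
      by (auto simp: log_pp_def filter_empty_conv)
    then have "m \<le> n" using assms by auto
    then show ?thesis using m assms by (auto simp: divide_le_eq)
  qed
  moreover have "finite {y. a \<le> y \<and> 0 < log_pp n xs y}" for a
    by (rule finite_subset[OF _ finite_subset[OF sub]]) auto
  ultimately show ?thesis by (auto simp: Conf_def)
qed

lemma set_delete_first_max: "set (delete_first_max xs) \<subseteq> set xs"
  by (simp add: delete_first_max_def set_remove1_subset)

text \<open>The values on closed intervals exclude atoms: \<open>{a}\<close> lies in
  \<open>{c..a}\<close> for every \<open>c < a\<close>, and the mass of the latter tends to 0 as
  \<open>c\<close> approaches \<open>a\<close>.\<close>

lemma emeasure_half_open:
  fixes \<Lambda> :: "real measure"
  assumes sets: "sets \<Lambda> = sets borel"
    and int: "\<And>a b. 0 < a \<Longrightarrow> a < b \<Longrightarrow> b \<le> 1 \<Longrightarrow> emeasure \<Lambda> {a..b} = ennreal (a powr (-\<gamma>) - b powr (-\<gamma>))"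
    and ab: "0 < a" "a < b" "b \<le> 1"
  shows "emeasure \<Lambda> {a<..b} = ennreal (a powr (-\<gamma>) - b powr (-\<gamma>))"
proof -
  have "((\<lambda>c. ennreal (c powr (-\<gamma>) - a powr (-\<gamma>))) \<longlongrightarrow> ennreal (a powr (-\<gamma>) - a powr (-\<gamma>))) (at_left a)"
    using ab by (intro tendsto_ennrealI tendsto_intros) auto
  moreover have "\<forall>\<^sub>F c in at_left a. emeasure \<Lambda> {a} \<le> ennreal (c powr (-\<gamma>) - a powr (-\<gamma>))"
  proof -
    have "\<forall>\<^sub>F c in at_left a. c \<in> {0<..<a}" using ab by (intro eventually_at_leftI[of 0]) auto
    then show ?thesis
    proof eventually_elim
      case (elim c)
      then have "emeasure \<Lambda> {a} \<le> emeasure \<Lambda> {c..a}" using sets by (intro emeasure_mono) auto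
      then show ?case using int[of c a] elim ab by simp
    qed
  qed
  ultimately have "emeasure \<Lambda> {a} \<le> ennreal (a powr (-\<gamma>) - a powr (-\<gamma>))"
    by (rule tendsto_lowerbound) simp
  then have "emeasure \<Lambda> {a} = 0" by simp
  moreover have "emeasure \<Lambda> ({a} \<union> {a<..b}) = emeasure \<Lambda> {a} + emeasure \<Lambda> {a<..b}"
    using sets by (intro plus_emeasure[symmetric]) auto
  moreover have "{a} \<union> {a<..b} = {a..b}" using ab by auto
  ultimately show ?thesis using int[OF ab] by simp
qed

theorem theorem2p4:
  fixes w :: "nat \<Rightarrow> real" and \<rho> :: real and L :: "real \<Rightarrow> real"
    and pX :: "nat pmf" and \<gamma> :: real and \<Lambda> :: "real measure"
    and k :: "nat \<Rightarrow> nat" and x :: real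
  assumes w_nonneg: "\<And>n. w n \<ge> 0"
    and rho_pos: "\<rho> > 0"
    and L_sv: "slowly_varying L"
    and w_asymp: "w \<sim>[sequentially] (\<lambda>n. L (real n) * (real n) powr (-1) * \<rho> powr (- real n))"
    and W_fin: "summable (\<lambda>n. w n * \<rho> ^ n)"
    and W_pos: "(\<Sum>n. w n * \<rho> ^ n) > 0"
    and X_law: "\<And>m. pmf pX m = w m * \<rho> ^ m / (\<Sum>n. w n * \<rho> ^ n)"
    and gamma_nonneg: "\<gamma> \<ge> 0"
    and tail: "\<And>t. 0 < t \<Longrightarrow> t < 1 \<Longrightarrow>
       ((\<lambda>n. measure_pmf.prob pX {m. real m > real n powr t} / measure_pmf.prob pX {m. real m > real n})
          \<longlongrightarrow> t powr (-\<gamma>)) sequentially"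
    and Lambda_sets: "sets \<Lambda> = sets borel"
    and Lambda_supp: "emeasure \<Lambda> (UNIV - {0<..1}) = 0"
    and Lambda_int: "\<And>a b. 0 < a \<Longrightarrow> a < b \<Longrightarrow> b \<le> 1 \<Longrightarrow>
       emeasure \<Lambda> {a..b} = ennreal (a powr (-\<gamma>) - b powr (-\<gamma>))"
    and k_pos: "\<And>n. k n > 0"
    and x_pos: "x > 0"
    and k_lim: "(\<lambda>n. real (k n) * measure_pmf.prob pX {m. m > n}) \<longlonglongrightarrow> x"
  shows "\<exists>(Q :: (real \<Rightarrow> nat) measure) \<xi>.
     is_poisson_pp Q (scale_measure (ennreal x) \<Lambda>) \<xi> \<and>
     conv_distr_vague
       (\<lambda>n. measure_pmf (map_pmf (\<lambda>xs. log_pp n (delete_first_max xs))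
              (cond_pmf (replicate_pmf (k n) pX) {xs. sum_list xs = n})))
       (distr Q conf_measure \<xi>)"
proof -
  define \<mu> where "\<mu> = scale_measure (ennreal x) \<Lambda>"
  have half_open: "emeasure \<mu> {a<..b} = ennreal (x * (a powr (-\<gamma>) - b powr (-\<gamma>)))"
    if "0 < a" "a < b" "b \<le> 1" for a b
    using emeasure_half_open[OF Lambda_sets Lambda_int that] x_pos
    by (simp add: \<mu>_def ennreal_mult')
  interpret J: local_big_jump pX \<gamma> k x
  proof
    show "\<exists>N>0. \<forall>n\<ge>N. \<forall>m. n \<le> 2 * m \<and> m \<le> n \<longrightarrow>
        pmf pX n > 0 \<and> \<bar>(real m * pmf pX m) / (real n * pmf pX n) - 1\<bar> < e" if "e > 0" for e
      by (rule regular_variation_pmf[OF rho_pos L_sv w_asymp W_pos X_law that])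
  qed (fact gamma_nonneg tail k_pos x_pos k_lim)+
  interpret S: slab_finite \<mu>
  proof
    show "sets \<mu> = sets borel" by (simp add: \<mu>_def Lambda_sets)
    fix j
    have "1 / (real j + 2) < 1 / (real j + 1)" "1 / (real j + 1) \<le> 1" by (simp_all add: field_simps)
    then show "emeasure \<mu> (slab j) < \<infinity>" by (simp add: slab_def half_open)
  qed
  define P where "P n = map_pmf (\<lambda>xs. log_pp n (delete_first_max xs))
      (cond_pmf (replicate_pmf (k n) pX) {xs. sum_list xs = n})" for n
  have "conv_distr_vague (\<lambda>n. measure_pmf (P n)) S.Q"
  proof (rule conv_distr_vagueI[OF S.prob_space_Q S.sets_Q])
    \<comment> \<open>For small \<open>n\<close> the conditioning event may have probability 0 and
      \<open>ln n\<close> may vanish, so this is claimed only eventually.\<close>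
    show "\<forall>\<^sub>F n in sequentially. set_pmf (P n) \<subseteq> Conf"
      using J.sum_eq_prob_pos eventually_ge_at_top[of 2]
    proof eventually_elim
      case (elim n)
      have "set_pmf (replicate_pmf (k n) pX) \<inter> {xs. sum_list xs = n} \<noteq> {}"
        using elim(1) measure_pmf_zero_iff[of "replicate_pmf (k n) pX" "{xs. sum_list xs = n}"] by auto
      then have "set_pmf (P n) \<subseteq> (\<lambda>xs. log_pp n (delete_first_max xs)) ` {xs. sum_list xs = n}"
        by (auto simp: P_def)
      moreover have "log_pp n (delete_first_max xs) \<in> Conf" if "sum_list xs = n" for xs
        using that set_delete_first_max[of xs] member_le_sum_list[of _ xs] elim
        by (intro log_pp_Conf) auto
      ultimately show ?case by auto
    qed
    fix d and v :: "nat list" and \<delta> :: real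
    assume \<delta>: "\<delta> > 0" and len: "length v = d"
    have cell: "emeasure \<mu> (cell d i) = ennreal (x * (thr d i powr (-\<gamma>) - thr d (Suc i) powr (-\<gamma>)))"
      if "i < d" for i
      unfolding cell_def using that by (intro half_open thr_pos thr_less_Suc thr_le_1) auto
    define m where "m i = x * (thr d i powr (-\<gamma>) - thr d (Suc i) powr (-\<gamma>))" for i
    have m0: "m i \<ge> 0" for i
      unfolding m_def using x_pos thr_less_Suc[of d i] thr_pos[of d i] gamma_nonneg
      by (intro mult_nonneg_nonneg) (auto intro!: powr_mono2')
    have cell_m: "measure \<mu> (cell d i) = m i" if "i < d" for i
      using cell[OF that] m0[of i] by (simp add: measure_def m_def)
    have "measure S.Q {c\<in>Conf. level d c = v} = (\<Prod>i<d. exp (- m i) * m i ^ (v ! i) / fact (v ! i))"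
      using cell by (subst S.prob_level_Q[OF len]) (auto simp: cell_m)
    also have "\<dots> = (\<Prod>i<d. exp (- m i)) * (\<Prod>i<d. m i ^ (v ! i) / fact (v ! i))"
      by (simp flip: prod.distrib)
    also have "(\<Prod>i<d. exp (- m i)) = exp (- (\<Sum>i<d. m i))"
      by (simp add: exp_sum flip: sum_negf)
    \<comment> \<open>The sum telescopes to the endpoint \<open>thr d d = 1\<close>; the resulting
      \<open>x\<close> matches the factor \<open>exp x\<close> that the conditioning produces in
      \<open>level_lower_bound\<close>.\<close>
    also have "(\<Sum>i<d. m i) = x * thr d 0 powr (-\<gamma>) - x"
      unfolding m_def sum_distrib_left[symmetric]
      using sum_lessThan_telescope'[of "\<lambda>i. thr d i powr (-\<gamma>)" d] by (simp add: right_diff_distrib)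
    finally have "measure S.Q {c\<in>Conf. level d c = v} = exp (x - x * thr d 0 powr (-\<gamma>)) *
        (\<Prod>i<d. (x * (thr d i powr (-\<gamma>) - thr d (Suc i) powr (-\<gamma>))) ^ (v ! i) / fact (v ! i))"
      by (simp add: m_def)
    then show "\<forall>\<^sub>F n in sequentially. measure S.Q {c\<in>Conf. level d c = v} - \<delta> \<le>
        measure_pmf.prob (P n) {c. level d c = v}"
      using J.level_lower_bound[OF len \<delta>] by (simp add: P_def vimage_def)
  qed
  moreover have "distr S.Q conf_measure (\<lambda>c. c) = S.Q"
    by (rule distr_id2) (simp add: S.sets_Q)
  ultimately have "is_poisson_pp S.Q \<mu> (\<lambda>c. c) \<and>
      conv_distr_vague (\<lambda>n. measure_pmf (P n)) (distr S.Q conf_measure (\<lambda>c. c))"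
    using S.poisson_pp_Q by simp
  then show ?thesis unfolding P_def \<mu>_def[symmetric] by blast
qed

end
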